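(* Let $k$ be an algebraically closed field of characteristic $p>0$, let $q=p^e$ with $e>0$ be fixed, and let $n\ge 1$. There is a bijection between partitions of $n$ and non-degenerate Frobenius forms of degree $q+1$ in $n$ variables over $k$ up to linear change of coordinates. The bijection sends a partition $n=\sum s$ to the class of the Frobenius form represented by the block diagonal matrix having exactly one $s\times s$ block $J_s$ along the diagonal for each summand $s$ of the partition, where $J_1=[1]$ and, for $s\geq 2$, $J_s$ is the $s\times s$ matrix with $1$'s on the super-diagonal (entries $(i,i+1)$, $1\le i\le s-1$) and zeros elsewhere.
   Context: A Frobenius form of degree $q+1$ in $n$ variables is a homogeneous polynomial of degree $q+1$ in $k[x_1,\dots,x_n]$ lying in the ideal $\langle x_1^q,\dots,x_n^q\rangle$. Each such form $h$ can be written uniquely as $$h=\begin{bmatrix}x_1^q & x_2^q & \cdots & x_n^q\end{bmatrix}A\begin{bmatrix}x_1\\ x_2\\ \vdots\\ x_n\end{bmatrix}$$ with $A$ an $n\times n$ matrix over $k$; $A$ is the matrix representing $h$. A form $f\in k[x_1,\dots,x_n]$ is non-degenerate if it cannot be written as a polynomial in fewer than $n$ variables after any invertible linear change of coordinates. "Up to linear change of coordinates" means that two forms are identified if one is taken to the other by an invertible linear change of the coordinates $x_1,\dots,x_n$. *)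

theory Defs
  imports
    "HOL-Computational_Algebra.Computational_Algebra"
    "HOL-Library.Poly_Mapping"
    "HOL-Library.Multiset"
    "Jordan_Normal_Form.Matrix"
begin

text \<open>
  Multivariate polynomials over \<open>'a\<close> are finitely supported functions from monomials to
  coefficients, where a monomial is a finitely supported exponent function \<open>nat \<Rightarrow>\<^sub>0 nat\<close>.
  Multiplication is the convolution product of \<^theory>\<open>HOL-Library.Poly_Mapping\<close>.
  Variables are numbered from 0, as are matrix rows and columns, so that
  \<open>Var i\<close> is the indeterminate usually written $x_{i+1}$.
\<close>

type_synonym 'a mpoly = "(nat \<Rightarrow>\<^sub>0 nat) \<Rightarrow>\<^sub>0 'a"

definition Const :: "'a \<Rightarrow> 'a::comm_ring_1 mpoly"
  where "Const c = Poly_Mapping.single 0 c"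

definition Var :: "nat \<Rightarrow> 'a::comm_ring_1 mpoly"
  where "Var i = Poly_Mapping.single (Poly_Mapping.single i 1) 1"

definition vars :: "'a::comm_ring_1 mpoly \<Rightarrow> nat set"
  where "vars f = (\<Union>m \<in> Poly_Mapping.keys f. Poly_Mapping.keys m)"

definition poly_ring :: "nat \<Rightarrow> 'a::comm_ring_1 mpoly set"
  where "poly_ring n = {f. vars f \<subseteq> {..<n}}"

definition monom_degree :: "(nat \<Rightarrow>\<^sub>0 nat) \<Rightarrow> nat"
  where "monom_degree m = (\<Sum>i \<in> Poly_Mapping.keys m. Poly_Mapping.lookup m i)"

definition homogeneous :: "nat \<Rightarrow> 'a::comm_ring_1 mpoly \<Rightarrow> bool"
  where "homogeneous d f \<longleftrightarrow> (\<forall>m \<in> Poly_Mapping.keys f. monom_degree m = d)"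

definition subst :: "(nat \<Rightarrow> 'a mpoly) \<Rightarrow> 'a::comm_ring_1 mpoly \<Rightarrow> 'a mpoly"
  where "subst \<sigma> f =
    (\<Sum>m \<in> Poly_Mapping.keys f.
       Const (Poly_Mapping.lookup f m) * (\<Prod>i \<in> Poly_Mapping.keys m. \<sigma> i ^ Poly_Mapping.lookup m i))"

text \<open>\<open>lin_subst M f\<close> is $f(Mx)$. It is only meaningful for \<open>f \<in> poly_ring (dim_row M)\<close>, since
  \<open>M $$ (i, j)\<close> is unspecified for \<open>i \<ge> dim_row M\<close>.\<close>

definition lin_subst :: "'a::comm_ring_1 mat \<Rightarrow> 'a mpoly \<Rightarrow> 'a mpoly"
  where "lin_subst M f = subst (\<lambda>i. \<Sum>j<dim_col M. Const (M $$ (i, j)) * Var j) f"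

definition lin_equiv :: "nat \<Rightarrow> 'a::comm_ring_1 mpoly \<Rightarrow> 'a mpoly \<Rightarrow> bool"
  where "lin_equiv n f g \<longleftrightarrow>
    (\<exists>M \<in> carrier_mat n n. invertible_mat M \<and> g = lin_subst M f)"

definition nondegenerate :: "nat \<Rightarrow> 'a::comm_ring_1 mpoly \<Rightarrow> bool"
  where "nondegenerate n f \<longleftrightarrow>
    \<not> (\<exists>M \<in> carrier_mat n n. invertible_mat M \<and> card (vars (lin_subst M f)) < n)"

definition power_ideal :: "nat \<Rightarrow> nat \<Rightarrow> 'a::comm_ring_1 mpoly set"
  where "power_ideal n q =
    {(\<Sum>i<n. g i * Var i ^ q) | g. \<forall>i<n. g i \<in> poly_ring n}"

text \<open>As usual, the zero polynomial counts as homogeneous of every degree, hence as a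
  Frobenius form (the one represented by the zero matrix).\<close>

definition frobenius_form :: "nat \<Rightarrow> nat \<Rightarrow> 'a::comm_ring_1 mpoly \<Rightarrow> bool"
  where "frobenius_form n q h \<longleftrightarrow>
    h \<in> poly_ring n \<and> homogeneous (q + 1) h \<and> h \<in> power_ideal n q"

definition nondeg_frobenius_forms :: "nat \<Rightarrow> nat \<Rightarrow> 'a::comm_ring_1 mpoly set"
  where "nondeg_frobenius_forms n q = {h. frobenius_form n q h \<and> nondegenerate n h}"

definition lin_equiv_rel :: "nat \<Rightarrow> nat \<Rightarrow> ('a::comm_ring_1 mpoly \<times> 'a mpoly) set"
  where "lin_equiv_rel n q =
    {(f, g). f \<in> nondeg_frobenius_forms n q \<and> g \<in> nondeg_frobenius_forms n q \<and> lin_equiv n f g}"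

definition form_of_mat :: "nat \<Rightarrow> 'a::comm_ring_1 mat \<Rightarrow> 'a mpoly"
  where "form_of_mat q A =
    (\<Sum>i<dim_row A. \<Sum>j<dim_col A. Var i ^ q * Const (A $$ (i, j)) * Var j)"

definition J_block :: "nat \<Rightarrow> 'a::comm_ring_1 mat"
  where "J_block s =
    (if s = 1 then 1\<^sub>m 1 else mat s s (\<lambda>(i, j). if j = i + 1 then 1 else 0))"

definition number_partitions :: "nat \<Rightarrow> nat multiset set"
  where "number_partitions n = {P. 0 \<notin># P \<and> sum_mset P = n}"

end

theory Submission
  imports Defs "Jordan_Normal_Form.Determinant" "HOL-Library.Function_Algebras"
begin

text \<open>
  A linear change of coordinates \<open>M\<close> turns the form represented by \<open>A\<close> into the one represented by
  \<open>(M\<^sup>[\<^sup>q\<^sup>])\<^sup>T A M\<close>, so the task is to classify forms \<open>\<beta>\<close> that are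
  linear in the second argument and semilinear for the \<open>q\<close>-power map in the first.

  If the left radical of \<open>\<beta>\<close> is 0, then \<open>\<beta>\<close> has an orthonormal basis; this rests on the fact that over an
  algebraically closed field an injective Frobenius-semilinear map has a basis of fixed vectors.
  Otherwise remove the part common to the left radical \<open>L\<close> and the right radical, pass to a complement of
  \<open>L\<close> in its left orthogonal, whose dimension is smaller, and obtain a basis of the whole space
  by prolonging all chains \<open>x\<^sub>1, x\<^sub>2, \<dots>\<close> with \<open>\<beta> x\<^sub>i x\<^sub>i\<^sub>+\<^sub>1 = 1\<close>
  by two vectors and adding chains of length 2. Non-degeneracy says that there is no block \<open>[0]\<close>.

  For uniqueness let \<open>U\<^sub>0\<close> be the whole space and \<open>U\<^sub>k\<^sub>+\<^sub>1\<close> the right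
  orthogonal of \<open>U\<^sub>k\<close>. In \<open>J\<^sub>s\<close> these are coordinate subspaces, and the dimensions of
  \<open>U\<^sub>k\<^sub>+\<^sub>2\<close> and \<open>U\<^sub>k\<close> differ by \<open>(-1)\<^sup>k\<^sup>+\<^sup>1\<close> if
  \<open>s \<ge> k + 2\<close> and by 0 otherwise.
\<close>

section \<open>Frobenius-semilinear maps\<close>

text \<open>The obstacle is that \<beta> is linear in one argument and semilinear in the other, so
  left and right orthogonals differ and a vector with \<beta> v v nonzero need not split off.
  Algebraic closedness compensates: q-th roots turn every linear functional into a left vector, so
  duality works as for bilinear forms. The chains grow by two because a basis of L is paired with
  vectors g outside the left orthogonal of L: each g either continues a chain at its end or begins a
  new one, and is followed by its partner in L. A vector lying in both radicals has no such partner
  and stays alone as a block [0]. The dimensions of the U_k give the number of blocks of size at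
  least m for every m \<ge> 2. The blocks [1] leave no trace in the differences; their number is
  what is left of n. That q is a power of the characteristic keeps Frobenius forms stable under
  substitution, and q \<ge> 2 makes the representing matrix unique.\<close>

lemma function_subspace_eq_UNIV:
  fixes F :: "('i \<Rightarrow> 'a::field) set"
  assumes "finite I"
    and "\<And>f g. f \<in> F \<Longrightarrow> g \<in> F \<Longrightarrow> (\<lambda>i. f i + g i) \<in> F"
    and "\<And>c f. f \<in> F \<Longrightarrow> (\<lambda>i. c * f i) \<in> F"
    and "F \<noteq> {}"
    and "\<And>c i. (\<And>f. f \<in> F \<Longrightarrow> (\<Sum>i\<in>I. c i * f i) = 0) \<Longrightarrow> i \<in> I \<Longrightarrow> c i = 0"
  shows "\<exists>f\<in>F. \<forall>i\<in>I. f i = t i"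
  using assms(1,5)
proof (induction I arbitrary: t)
  case empty
  then show ?case using assms(4) by auto
next
  case (insert a I)
  have IH: "\<exists>f\<in>F. \<forall>i\<in>I. f i = t i" for t
  proof (rule insert.IH)
    fix c i assume c: "\<And>f. f \<in> F \<Longrightarrow> (\<Sum>i\<in>I. c i * f i) = 0" and i: "i \<in> I"
    define c' where "c' = c(a := 0)"
    have "(\<Sum>i\<in>insert a I. c' i * f i) = 0" if "f \<in> F" for f
    proof -
      have "(\<Sum>i\<in>I. c' i * f i) = (\<Sum>i\<in>I. c i * f i)"
        using insert.hyps by (intro sum.cong) (auto simp: c'_def)
      then show ?thesis using c[OF that] insert.hyps by (simp add: c'_def)
    qed
    then have "c' i = 0" using insert.prems i by blast
    then show "c i = 0" using insert.hyps i by (auto simp: c'_def split: if_splits)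
  qed
  define \<delta> where "\<delta> i = (SOME f. f \<in> F \<and> (\<forall>j\<in>I. f j = (if j = i then 1 else 0)))" for i
  have \<delta>: "\<delta> i \<in> F \<and> (\<forall>j\<in>I. \<delta> i j = (if j = i then 1 else 0))" for i
    unfolding \<delta>_def using IH[of "\<lambda>j. if j = i then 1 else 0"]
    by (intro someI_ex[of "\<lambda>f. f \<in> F \<and> (\<forall>j\<in>I. f j = (if j = i then 1 else 0))"]) auto
  have zero: "(\<lambda>_. 0) \<in> F"
    using assms(3)[of "\<delta> a" 0] \<delta> by simp
  have comb: "(\<lambda>j. \<Sum>i\<in>J. c i * \<delta> i j) \<in> F" if "finite J" for c J
    using that
  proof (induction J)
    case (insert x J)
    then show ?case using assms(2)[OF assms(3)[of "\<delta> x" "c x"]] \<delta> by simp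
  qed (simp add: zero)
  \<comment> \<open>Otherwise the value at \<open>a\<close> would depend linearly on the values on
    \<open>I\<close>, and this relation is a nonzero functional that kills \<open>F\<close>. The
    correction \<open>g\<close> below vanishes on \<open>I\<close> but not at
    \<open>a\<close>.\<close>
  have "\<exists>f\<in>F. f a \<noteq> (\<Sum>i\<in>I. f i * \<delta> i a)"
  proof (rule ccontr)
    assume neg: "\<not> ?thesis"
    define c where "c i = (if i = a then 1 else - \<delta> i a)" for i
    have "(\<Sum>i\<in>insert a I. c i * f i) = 0" if "f \<in> F" for f
    proof -
      have "(\<Sum>i\<in>I. c i * f i) = - (\<Sum>i\<in>I. f i * \<delta> i a)"
        unfolding sum_negf[symmetric] using insert.hyps by (intro sum.cong) (auto simp: c_def)
      then show ?thesis using neg that insert.hyps by (auto simp: c_def)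
    qed
    then have "c a = 0" using insert.prems by blast
    then show False by (simp add: c_def)
  qed
  then obtain f where f: "f \<in> F" "f a \<noteq> (\<Sum>i\<in>I. f i * \<delta> i a)" by blast
  define g where "g = (\<lambda>j. f j + (-1) * (\<Sum>i\<in>I. f i * \<delta> i j))"
  have gF: "g \<in> F"
    unfolding g_def using f(1) assms(2,3) comb insert.hyps by blast
  have g0: "g j = 0" if "j \<in> I" for j
  proof -
    have "(\<Sum>i\<in>I. f i * \<delta> i j) = (\<Sum>i\<in>I. if i = j then f i else 0)"
      using \<delta> that by (intro sum.cong) auto
    then show ?thesis using that insert.hyps by (simp add: g_def)
  qed
  have ga: "g a \<noteq> 0" using f(2) by (simp add: g_def)
  obtain h where h: "h \<in> F" "\<forall>i\<in>I. h i = t i" using IH by blast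
  define k where "k = (\<lambda>j. h j + (t a - h a) / g a * g j)"
  have "k \<in> F" unfolding k_def using h gF assms(2,3) by blast
  moreover have "\<forall>i\<in>insert a I. k i = t i"
    using h g0 ga by (auto simp: k_def)
  ultimately show ?case by blast
qed

section \<open>Equations in one variable over an algebraically closed field\<close>

lemma additive_power_minus:
  fixes x :: "'a::field"
  assumes q: "q > 0" and "\<And>x y :: 'a. (x + y) ^ q = x ^ q + y ^ q"
  shows "(- x) ^ q = - (x ^ q)"
proof -
  have "x ^ q + (- x) ^ q = 0" using assms(2)[of x "- x"] q by (simp add: zero_power)
  then show ?thesis by (simp add: add_eq_0_iff)
qed

text \<open>With \<open>y = x k\<close> as the only unknown, each \<open>x i\<close> is a polynomial
  \<open>P i\<close> in y divisible by y^2. If \<open>P k\<close> is y^2 S, the condition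
  \<open>P k = y\<close> reads y (y S - 1) = 0, and a root of y S - 1 is automatically nonzero. It
  exists as soon as S is nonzero, which is what the degree bound is for.\<close>

lemma root_of_frobenius_recurrence:
  fixes a :: "nat \<Rightarrow> 'a::alg_closed_field"
  assumes Q: "Q > 1" and nz: "\<exists>i\<le>k. a i \<noteq> 0"
  shows "\<exists>y x. y \<noteq> 0 \<and> x 0 = a 0 * y ^ Q \<and> (\<forall>i. x (Suc i) = x i ^ Q + a (Suc i) * y ^ Q) \<and> x k = y"
proof -
  define P where "P = rec_nat (monom (a 0) Q) (\<lambda>i p. p ^ Q + monom (a (Suc i)) Q)"
  have P0: "P 0 = monom (a 0) Q" and PS: "\<And>i. P (Suc i) = P i ^ Q + monom (a (Suc i)) Q"
    by (simp_all add: P_def)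
  have dvd: "monom 1 2 dvd P i" for i
  proof (induction i)
    case 0
    then show ?case using Q by (auto simp: P0 monom_1_dvd_iff')
  next
    case (Suc i)
    have "P i dvd P i ^ Q" using Q by (simp add: dvd_power)
    then have "monom 1 2 dvd P i ^ Q" by (rule dvd_trans[OF Suc])
    moreover have "monom 1 2 dvd monom (a (Suc i)) Q" using Q by (auto simp: monom_1_dvd_iff')
    ultimately show ?case by (simp add: PS)
  qed
  \<comment> \<open>From the first nonzero \<open>a j\<close> on, \<open>P i\<close> has degree at
    least Q, so its Q-th power has degree above Q and the next monomial, of degree at most Q, cannot
    cancel it.\<close>
  have deg: "if \<exists>j\<le>i. a j \<noteq> 0 then degree (P i) \<ge> Q else P i = 0" for i
  proof (induction i)
    case 0
    then show ?case by (auto simp: P0 degree_monom_eq)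
  next
    case (Suc i)
    show ?case
    proof (cases "\<exists>j\<le>i. a j \<noteq> 0")
      case True
      then have d: "degree (P i) \<ge> Q" using Suc by simp
      have "degree (P i ^ Q) = Q * degree (P i)"
        using d Q by (subst degree_power_eq) auto
      then have "degree (P i ^ Q) > Q" using d Q n_less_m_mult_n[of Q "degree (P i)"] by (simp add: mult.commute)
      moreover have "degree (monom (a (Suc i)) Q) \<le> Q" by (rule degree_monom_le)
      ultimately have "degree (P (Suc i)) = degree (P i ^ Q)"
        by (simp add: PS degree_add_eq_left)
      then show ?thesis using True \<open>degree (P i ^ Q) > Q\<close> le_SucI by auto
    next
      case False
      then have "P i = 0" using Suc by simp
      then have "P (Suc i) = monom (a (Suc i)) Q" using Q by (simp add: PS power_0_left)
      then show ?thesis using False le_Suc_eq by (auto simp: degree_monom_eq)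
    qed
  qed
  obtain S where S: "P k = monom 1 2 * S" using dvd[of k] by (auto elim: dvdE)
  have "S \<noteq> 0" using deg[of k] nz S Q by auto
  define T where "T = pCons (-1) S"
  have "degree T > 0" using \<open>S \<noteq> 0\<close> by (simp add: T_def)
  then obtain y where y: "poly T y = 0" using alg_closed_imp_poly_has_root by blast
  then have ys: "y * poly S y = 1" by (simp add: T_def)
  then have "y \<noteq> 0" by auto
  have "poly (P k) y = y"
    using ys by (simp add: S poly_monom power2_eq_square mult.assoc)
  then show ?thesis using \<open>y \<noteq> 0\<close>
    by (intro exI[of _ y] exI[of _ "\<lambda>i. poly (P i) y"]) (simp add: P0 PS poly_monom)
qed

text \<open>With a = -1 this makes a semilinear map minus the identity surjective on the span of its
  fixed vectors; with a = 1 it provides an element of trace 1.\<close>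

lemma power_plus_linear_solvable:
  fixes a c :: "'a::alg_closed_field"
  assumes "q > 1"
  shows "\<exists>x. x ^ q + a * x = c"
proof -
  let ?p = "monom 1 q + [:- c, a:]"
  have "degree [:- c, a:] < degree (monom (1::'a) q)"
    using assms by (simp add: degree_monom_eq)
  then have "degree ?p = q" by (simp add: degree_add_eq_left degree_monom_eq)
  then obtain x where "poly ?p x = 0" using assms alg_closed_imp_poly_has_root[of ?p] by auto
  then show ?thesis by (intro exI[of _ x]) (simp add: poly_monom algebra_simps)
qed

section \<open>Finite spans and dimension counts\<close>

context vector_space
begin

lemma span_image_finite:
  assumes "finite I" "x \<in> span (f ` I)"
  shows "\<exists>a. x = (\<Sum>i\<in>I. scale (a i) (f i))"
  using assms(2)
proof (induction rule: span_induct_alt)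
  case base
  then show ?case by (intro exI[of _ "\<lambda>_. 0"]) simp
next
  case (step c x y)
  then obtain a j where a: "y = (\<Sum>i\<in>I. scale (a i) (f i))" and j: "j \<in> I" "x = f j" by auto
  have "(\<Sum>i\<in>I. scale ((a(j := a j + c)) i) (f i)) = scale (a j + c) (f j) + (\<Sum>i\<in>I - {j}. scale (a i) (f i))"
    using assms(1) j by (simp add: sum.remove)
  also have "\<dots> = scale c x + y"
    using assms(1) j by (simp add: a sum.remove[of I j] scale_left_distrib)
  finally show ?case by (intro exI[of _ "a(j := a j + c)"]) simp
qed

lemma independent_card_spans:
  assumes "finite B" "independent U" "U \<subseteq> span B" "card B \<le> card U"
  shows "span B \<subseteq> span U"
proof
  fix x assume x: "x \<in> span B"
  show "x \<in> span U"
  proof (rule ccontr)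
    assume n: "x \<notin> span U"
    then have "independent (insert x U)" using assms(2) by (rule independent_insertI)
    then have "finite (insert x U) \<and> card (insert x U) \<le> card B"
      using assms x by (intro independent_span_bound) auto
    moreover have "x \<notin> U" using n span_base by blast
    ultimately show False using assms(4) by auto
  qed
qed

lemma subspace_finite_basis:
  assumes "finite B" "subspace V" "V \<subseteq> span B"
  obtains C where "finite C" "independent C" "span C = V" "card C \<le> card B"
proof -
  obtain C where C: "C \<subseteq> V" "independent C" "V \<subseteq> span C" by (rule maximal_independent_subset)
  have "span C = V" using C assms(2) span_minimal by blast
  moreover have "finite C \<and> card C \<le> card B"
    using C assms by (intro independent_span_bound) auto
  ultimately show ?thesis using that C by blast
qed

end

locale alg_closed_vector_space = vector_space scale
  for scale :: "'a::alg_closed_field \<Rightarrow> 'b::ab_group_add \<Rightarrow> 'b" (infixr "*s" 75)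
begin

text \<open>Given \<open>v\<close> outside the span \<open>W\<close> of the fixed vectors, a suitable combination
  \<open>z\<close> of \<open>v, F v, F\<^sup>2 v, \<dots>\<close> outside \<open>W\<close> is fixed modulo \<open>W\<close>; its
  coefficients come from a root of a one-variable polynomial. Since \<open>F - id\<close> is onto on
  \<open>W\<close>, the vector \<open>z\<close> can be corrected to a fixed vector.\<close>

lemma span_Frobenius_fixed:
  assumes Q: "Q > 1" and add: "\<And>x y :: 'a. (x + y) ^ Q = x ^ Q + y ^ Q"
    and V: "subspace V" "finite B0" "V \<subseteq> span B0"
    and FV: "\<And>v. v \<in> V \<Longrightarrow> F v \<in> V"
    and Fadd: "\<And>u v. u \<in> V \<Longrightarrow> v \<in> V \<Longrightarrow> F (u + v) = F u + F v"
    and Fsc: "\<And>c v. v \<in> V \<Longrightarrow> F (c *s v) = (c ^ Q) *s F v"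
    and Finj: "\<And>v. v \<in> V \<Longrightarrow> F v = 0 \<Longrightarrow> v = 0"
  shows "V \<subseteq> span {v \<in> V. F v = v}"
proof
  define W where "W = span {v \<in> V. F v = v}"
  have WV: "W \<subseteq> V" unfolding W_def using V by (intro span_minimal) auto
  have sW: "subspace W" by (simp add: W_def)
  have F0: "F 0 = 0" using Fsc[of 0 0] subspace_0[OF V(1)] Q by (simp add: power_0_left)
  have Fsum: "F (\<Sum>i\<in>I. c i *s g i) = (\<Sum>i\<in>I. (c i ^ Q) *s F (g i))"
    if "finite I" "\<And>i. i \<in> I \<Longrightarrow> g i \<in> V" for I :: "nat set" and c g
    using that
  proof (induction I)
    case (insert x I)
    then have "(\<Sum>i\<in>I. c i *s g i) \<in> V" using V by (intro subspace_sum subspace_scale) auto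
    then show ?case using insert V by (simp add: Fadd Fsc subspace_scale)
  qed (simp add: F0)
  \<comment> \<open>\<open>F\<close> fixes the generators of \<open>W\<close> and every coefficient
    has a Q-th root, so \<open>F\<close> maps \<open>W\<close> onto \<open>W\<close>.\<close>
  have pre: "\<exists>u\<in>W. F u = w" if "w \<in> W" for w
    using that unfolding W_def
  proof (induction rule: span_induct_alt)
    case base
    then show ?case using F0 span_zero by blast
  next
    case (step c x y)
    then obtain u where u: "u \<in> span {v \<in> V. F v = v}" "F u = y" by blast
    obtain d where d: "d ^ Q = c" using nth_root_exists[of Q c] Q by auto
    have "F (d *s x + u) = c *s x + y"
      using step.hyps u d WV V by (simp add: Fadd Fsc W_def subspace_scale subset_iff)
    moreover have "d *s x + u \<in> span {v \<in> V. F v = v}"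
      using step.hyps u by (intro span_add span_scale) (auto intro: span_base)
    ultimately show ?case by blast
  qed
  have solve: "\<exists>u\<in>W. F u - u = w" if "w \<in> W" for w
    using that unfolding W_def
  proof (induction rule: span_induct_alt)
    case base
    then show ?case using F0 span_zero by (intro bexI[of _ 0]) auto
  next
    case (step c x y)
    then obtain u where u: "u \<in> span {v \<in> V. F v = v}" "F u - u = y" by blast
    obtain d where d: "d ^ Q + (-1) * d = c" using power_plus_linear_solvable[OF Q] by blast
    have "F (d *s x + u) - (d *s x + u) = (d ^ Q + (-1) * d) *s x + (F u - u)"
      using step.hyps u WV V
      by (simp add: Fadd Fsc W_def subspace_scale subset_iff scale_left_diff_distrib)
    then have "F (d *s x + u) - (d *s x + u) = c *s x + y" using u d by simp
    moreover have "d *s x + u \<in> span {v \<in> V. F v = v}"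
      using step.hyps u by (intro span_add span_scale) (auto intro: span_base)
    ultimately show ?case by blast
  qed
  fix v assume v: "v \<in> V"
  have "v \<in> W"
  proof (rule ccontr)
    assume vW: "v \<notin> W"
    define vs where "vs i = (F ^^ i) v" for i :: nat
    have vsS: "vs (Suc i) = F (vs i)" for i by (simp add: vs_def)
    have vsV: "vs i \<in> V" for i by (induction i) (simp_all add: vsS FV, simp add: vs_def v)
    \<comment> \<open>Otherwise the orbit of \<open>v\<close> would contain arbitrarily large
      independent families inside a finite-dimensional space.\<close>
    have "\<exists>m. vs m \<in> span (W \<union> vs ` {..<m})"
    proof (rule ccontr)
      assume n: "\<not> ?thesis"
      have ind: "independent (vs ` {..<m}) \<and> card (vs ` {..<m}) = m" for m
      proof (induction m)
        case (Suc m)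
        have a: "vs m \<notin> span (vs ` {..<m})"
          using n span_mono[of "vs ` {..<m}" "W \<union> vs ` {..<m}"] by blast
        moreover have "vs m \<notin> vs ` {..<m}" by (rule contrapos_nn[OF a]) (rule span_base)
        ultimately show ?case using Suc by (simp add: lessThan_Suc independent_insertI)
      qed (simp add: independent_empty)
      have "vs ` {..<Suc (card B0)} \<subseteq> span B0" using vsV V by blast
      then show False
        using independent_span_bound[OF V(2), of "vs ` {..<Suc (card B0)}"] ind[of "Suc (card B0)"] by auto
    qed
    then obtain m where m: "vs m \<in> span (W \<union> vs ` {..<m})"
      and least: "\<And>j. j < m \<Longrightarrow> vs j \<notin> span (W \<union> vs ` {..<j})"
      using exists_least_iff[of "\<lambda>m. vs m \<in> span (W \<union> vs ` {..<m})"] by blast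
    have spW: "span W = W" using sW by simp
    have "m \<noteq> 0" using m vW spW by (intro notI) (simp add: vs_def)
    then obtain k where k: "m = Suc k" using not0_implies_Suc by blast
    have notk: "vs k \<notin> span (W \<union> vs ` {..<k})" using least k by simp
    obtain w y where w: "w \<in> W" and y: "y \<in> span (vs ` {..k})" and wy: "vs (Suc k) = w + y"
      using m by (auto simp: k lessThan_Suc_atMost span_Un spW)
    obtain a where a: "y = (\<Sum>i\<le>k. a i *s vs i)" using span_image_finite[OF _ y] by auto
    \<comment> \<open>If all \<open>a i\<close> vanish, \<open>F (vs k)\<close> lies in
      \<open>W\<close>, hence equals \<open>F u\<close> with \<open>u\<close> in \<open>W\<close>;
      injectivity gives \<open>vs k = u\<close>, against the minimality of \<open>m\<close>.\<close>
    have "\<exists>i\<le>k. a i \<noteq> 0"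
    proof (rule ccontr)
      assume "\<not> ?thesis"
      then have Fk: "F (vs k) = w" using wy a by (simp add: vsS)
      obtain u where u: "u \<in> W" "F u = w" using pre w by blast
      have mem: "vs k - u \<in> V" using vsV u WV V by (intro subspace_diff) auto
      have "F (vs k - u + u) = F (vs k - u) + F u" using mem u WV by (intro Fadd) auto
      then have "F (vs k - u) = 0" unfolding u(2) by (simp add: Fk)
      then have "vs k = u" using Finj[OF mem] by simp
      then show False using notk u span_base[of u "W \<union> vs ` {..<k}"] by auto
    qed
    then obtain t x where t: "t \<noteq> 0" "x 0 = a 0 * t ^ Q" "x k = t"
      and xS: "\<And>i. x (Suc i) = x i ^ Q + a (Suc i) * t ^ Q"
      using root_of_frobenius_recurrence[OF Q, of k a] by blast
    \<comment> \<open>\<open>F\<close> shifts the orbit by one step and raises the coefficients to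
      the power Q. Reducing \<open>vs (Suc k)\<close> by its relation then returns the coefficients
      \<open>x i\<close>, by the recurrence.\<close>
    define z where "z = (\<Sum>i\<le>k. x i *s vs i)"
    have zV: "z \<in> V" unfolding z_def using V vsV by (intro subspace_sum subspace_scale) auto
    have "F z = (\<Sum>i\<le>k. (x i ^ Q) *s vs (Suc i))"
      unfolding z_def using vsV by (subst Fsum) (auto simp: vsS)
    also have "\<dots> = (\<Sum>i<k. (x i ^ Q) *s vs (Suc i)) + (t ^ Q) *s vs (Suc k)"
      using t by (simp add: lessThan_Suc_atMost[symmetric])
    also have "vs (Suc k) = w + (a 0 *s vs 0 + (\<Sum>i<k. a (Suc i) *s vs (Suc i)))"
      unfolding wy a by (subst sum.atMost_shift) simp
    also have "(\<Sum>i<k. (x i ^ Q) *s vs (Suc i)) + (t ^ Q) *s (w + (a 0 *s vs 0 + (\<Sum>i<k. a (Suc i) *s vs (Suc i))))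
       = (x 0 *s vs 0 + (\<Sum>i<k. x (Suc i) *s vs (Suc i))) + (t ^ Q) *s w"
      by (simp add: xS t scale_right_distrib scale_left_distrib scale_sum_right sum.distrib mult.commute algebra_simps)
    also have "x 0 *s vs 0 + (\<Sum>i<k. x (Suc i) *s vs (Suc i)) = z"
      unfolding z_def by (subst sum.atMost_shift) simp
    finally have Fz: "F z = z + (t ^ Q) *s w" .
    \<comment> \<open>The coefficient \<open>t\<close> of \<open>vs k\<close> is nonzero, so
      \<open>z\<close> in \<open>W\<close> would express \<open>vs k\<close> through
      \<open>W\<close> and earlier orbit vectors.\<close>
    have zW: "z \<notin> W"
    proof
      assume "z \<in> W"
      have "z = (\<Sum>i<k. x i *s vs i) + t *s vs k"
        using t by (simp add: z_def lessThan_Suc_atMost[symmetric])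
      then have "t *s vs k = z - (\<Sum>i<k. x i *s vs i)" by simp
      also have "\<dots> \<in> span (W \<union> vs ` {..<k})"
        using \<open>z \<in> W\<close> by (intro span_diff span_sum span_scale) (auto intro: span_base)
      finally have "(inverse t) *s t *s vs k \<in> span (W \<union> vs ` {..<k})" by (rule span_scale)
      then show False using t notk by simp
    qed
    have "- ((t ^ Q) *s w) \<in> W" using w sW by (intro subspace_neg subspace_scale) auto
    then obtain u where u: "u \<in> W" "F u - u = - ((t ^ Q) *s w)" using solve by blast
    have "F (z + u) = F z + F u" using zV u WV by (intro Fadd) auto
    also have "\<dots> = z + u" using u(2) unfolding Fz by (simp add: algebra_simps)
    finally have "F (z + u) = z + u" .
    moreover have "z + u \<in> V" using zV u WV V by (intro subspace_add) auto
    ultimately have "z + u \<in> W" unfolding W_def by (intro span_base) simp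
    then have "z + u - u \<in> W" using u sW by (intro subspace_diff) auto
    then show False using zW by simp
  qed
  then show "v \<in> span {v \<in> V. F v = v}" by (simp add: W_def)
qed

end

section \<open>Sesquilinear forms with trivial left radical\<close>

text \<open>Of the characteristic only \<open>frob_add\<close> is kept. Subspaces are spans of
  finite sets in one fixed ambient space, so that inductions on the dimension remain within the same
  instance of the locale.\<close>

locale sesquilinear_space = alg_closed_vector_space scale
  for scale :: "'a::alg_closed_field \<Rightarrow> 'b::ab_group_add \<Rightarrow> 'b" (infixr "*s" 75) +
  fixes q :: nat and \<beta> :: "'b \<Rightarrow> 'b \<Rightarrow> 'a"
  assumes q_gt_1: "q > 1"
    and frob_add: "(x + y :: 'a) ^ q = x ^ q + y ^ q"
    and add_left: "\<beta> (u + v) w = \<beta> u w + \<beta> v w"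
    and add_right: "\<beta> u (v + w) = \<beta> u v + \<beta> u w"
    and scale_left: "\<beta> (c *s u) v = c ^ q * \<beta> u v"
    and scale_right: "\<beta> u (c *s v) = c * \<beta> u v"
begin

lemma frob_minus: "(- x :: 'a) ^ q = - (x ^ q)"
  using q_gt_1 by (intro additive_power_minus frob_add) auto

lemma frob_root: "\<exists>y :: 'a. y ^ q = x"
  using q_gt_1 by (intro nth_root_exists) auto

lemma zero_left [simp]: "\<beta> 0 v = 0"
  using scale_left[of 0 0 v] q_gt_1 by (simp add: power_0_left)

lemma zero_right [simp]: "\<beta> v 0 = 0"
  using scale_right[of v 0 0] by simp

lemma minus_left: "\<beta> (- u) v = - \<beta> u v"
  using add_left[of u "- u" v] by (simp add: add_eq_0_iff)

lemma minus_right: "\<beta> u (- v) = - \<beta> u v"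
  using add_right[of u v "- v"] by (simp add: add_eq_0_iff)

lemma diff_left: "\<beta> (u - v) w = \<beta> u w - \<beta> v w"
  using add_left[of u "- v" w] by (simp add: minus_left)

lemma diff_right: "\<beta> u (v - w) = \<beta> u v - \<beta> u w"
  using add_right[of u v "- w"] by (simp add: minus_right)

lemma sum_left: "\<beta> (\<Sum>i\<in>A. c i *s f i) v = (\<Sum>i\<in>A. c i ^ q * \<beta> (f i) v)"
  by (induction A rule: infinite_finite_induct) (simp_all add: add_left scale_left)

lemma sum_right: "\<beta> v (\<Sum>i\<in>A. c i *s f i) = (\<Sum>i\<in>A. c i * \<beta> v (f i))"
  by (induction A rule: infinite_finite_induct) (simp_all add: add_right scale_right)

lemma span_left_zero:
  assumes "x \<in> span S" "\<And>s. s \<in> S \<Longrightarrow> \<beta> s v = 0"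
  shows "\<beta> x v = 0"
  using assms(1) by (induction rule: span_induct_alt) (simp_all add: add_left scale_left assms(2))

lemma span_right_zero:
  assumes "x \<in> span S" "\<And>s. s \<in> S \<Longrightarrow> \<beta> v s = 0"
  shows "\<beta> v x = 0"
  using assms(1) by (induction rule: span_induct_alt) (simp_all add: add_right scale_right assms(2))

text \<open>The families of values \<beta> b w, for w in \<open>W\<close>, form a subspace of k^B,
  so it is enough that no nonzero functional kills it. Taking q-th roots \<open>d b\<close> of the
  coefficients turns such a functional into pairing with the left vector \<Sum> d b b, and
  \<open>nd\<close> makes this vector 0.\<close>

lemma exists_prescribed_pairing:
  assumes "subspace W" "finite B" "independent B"
    and nd: "\<And>x. x \<in> span B \<Longrightarrow> (\<And>w. w \<in> W \<Longrightarrow> \<beta> x w = 0) \<Longrightarrow> x = 0"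
  shows "\<exists>w\<in>W. \<forall>b\<in>B. \<beta> b w = t b"
proof -
  define F where "F = (\<lambda>w b. \<beta> b w) ` W"
  have "\<exists>f\<in>F. \<forall>b\<in>B. f b = t b"
  proof (rule function_subspace_eq_UNIV[OF assms(2)])
    show "(\<lambda>i. f i + g i) \<in> F" if f: "f \<in> F" and g: "g \<in> F" for f g
    proof -
      obtain u where "u \<in> W" "f = (\<lambda>b. \<beta> b u)" using f by (auto simp: F_def)
      moreover obtain v where "v \<in> W" "g = (\<lambda>b. \<beta> b v)" using g by (auto simp: F_def)
      ultimately show ?thesis using assms(1) unfolding F_def
        by (intro image_eqI[of _ _ "u + v"]) (auto simp: add_right subspace_add)
    qed
    show "(\<lambda>i. c * f i) \<in> F" if f: "f \<in> F" for c f
    proof -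
      obtain u where "u \<in> W" "f = (\<lambda>b. \<beta> b u)" using f by (auto simp: F_def)
      then show ?thesis using assms(1) unfolding F_def
        by (intro image_eqI[of _ _ "c *s u"]) (auto simp: scale_right subspace_scale)
    qed
    show "F \<noteq> {}" using subspace_0[OF assms(1)] by (auto simp: F_def)
    fix c i assume c: "\<And>f. f \<in> F \<Longrightarrow> (\<Sum>b\<in>B. c b * f b) = 0" and i: "i \<in> B"
    have "\<forall>b. \<exists>y. y ^ q = c b" using frob_root by blast
    then obtain d where d: "\<And>b. d b ^ q = c b" by metis
    have "\<beta> (\<Sum>b\<in>B. d b *s b) w = 0" if "w \<in> W" for w
      using c[of "\<lambda>b. \<beta> b w"] that by (auto simp: sum_left d F_def)
    moreover have "(\<Sum>b\<in>B. d b *s b) \<in> span B" by (intro span_sum span_scale span_base)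
    ultimately have "(\<Sum>b\<in>B. d b *s b) = 0" by (intro nd) auto
    then have "d i = 0" using independentD[OF assms(3,2) subset_refl] i by blast
    then show "c i = 0" using d[of i] q_gt_1 by (simp add: power_0_left)
  qed
  then show ?thesis by (auto simp: F_def)
qed

lemma dual_sum:
  assumes "finite B" "b \<in> B" "\<And>a b. a \<in> B \<Longrightarrow> b \<in> B \<Longrightarrow> \<beta> b (D a) = (if b = a then 1 else 0)"
  shows "\<beta> b (\<Sum>a\<in>B. c a *s D a) = c b"
proof -
  have "\<beta> b (\<Sum>a\<in>B. c a *s D a) = (\<Sum>a\<in>B. if a = b then c a else 0)"
    unfolding sum_right using assms by (intro sum.cong) auto
  then show ?thesis using assms by simp
qed

lemma dual_inj_on:
  assumes "\<And>a b. a \<in> B \<Longrightarrow> b \<in> B \<Longrightarrow> \<beta> b (D a) = (if b = a then 1 else 0)"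
  shows "inj_on D B"
proof (rule inj_onI)
  fix a b assume "a \<in> B" "b \<in> B" "D a = D b"
  then show "a = b" using assms[of a a] assms[of b a] by (auto split: if_splits)
qed

lemma dual_independent:
  assumes "finite B" "\<And>a b. a \<in> B \<Longrightarrow> b \<in> B \<Longrightarrow> \<beta> b (D a) = (if b = a then 1 else 0)"
  shows "independent (D ` B)"
proof (rule independent_if_scalars_zero)
  fix f y assume z: "(\<Sum>x\<in>D ` B. f x *s x) = 0" and y: "y \<in> D ` B"
  then have "(\<Sum>a\<in>B. f (D a) *s D a) = 0"
    using dual_inj_on[OF assms(2)] by (simp add: sum.reindex)
  moreover obtain b where "b \<in> B" "y = D b" using y by blast
  ultimately show "f y = 0" using dual_sum[OF assms(1) _ assms(2), of b "\<lambda>a. f (D a)"] by simp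
qed (use assms in auto)

text \<open>Vectors \<open>D a\<close> dual to the basis are independent and as many as
  \<open>B\<close>, hence they span. The coordinates of \<open>x\<close> with respect to them are
  the values \<beta> b x, which all vanish.\<close>

lemma nondegenerate_right:
  assumes "finite B" "independent B"
    and nd: "\<And>x. x \<in> span B \<Longrightarrow> (\<And>w. w \<in> span B \<Longrightarrow> \<beta> x w = 0) \<Longrightarrow> x = 0"
    and x: "x \<in> span B" "\<And>w. w \<in> span B \<Longrightarrow> \<beta> w x = 0"
  shows "x = 0"
proof -
  have "\<exists>w\<in>span B. \<forall>b\<in>B. \<beta> b w = (if b = a then 1 else 0)" for a
    using assms by (intro exists_prescribed_pairing) auto
  then obtain D where D: "\<And>a. D a \<in> span B" and dual: "\<And>a b. b \<in> B \<Longrightarrow> \<beta> b (D a) = (if b = a then 1 else 0)"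
    by metis
  have inj: "inj_on D B" using dual by (rule dual_inj_on)
  have eval: "\<beta> b (\<Sum>a\<in>B. c a *s D a) = c b" if "b \<in> B" for b c
    using assms(1) that dual by (rule dual_sum)
  have "independent (D ` B)" using assms(1) dual by (rule dual_independent)
  then have "span B \<subseteq> span (D ` B)"
    using assms D inj by (intro independent_card_spans) (auto simp: card_image)
  then obtain c where c: "x = (\<Sum>a\<in>B. c a *s D a)"
    using span_image_finite[OF assms(1)] x(1) by blast
  have "c b = 0" if "b \<in> B" for b using eval[OF that, of c] x(2)[of b] c that span_base by simp
  then show ?thesis by (simp add: c)
qed

text \<open>The map \<open>F\<close> below satisfies \<open>\<beta> w (F v) = (\<beta> v w)\<^sup>q\<close> and is semilinear for the
  \<open>q\<^sup>2\<close>-power map. A vector fixed by \<open>F\<close> has the same left and right orthogonal, so an anisotropic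
  one splits off.\<close>

lemma orthonormal_basis:
  assumes "finite B0" "independent B0"
    and "\<And>x. x \<in> span B0 \<Longrightarrow> (\<And>w. w \<in> span B0 \<Longrightarrow> \<beta> x w = 0) \<Longrightarrow> x = 0"
  shows "\<exists>B. finite B \<and> independent B \<and> span B = span B0 \<and>
    (\<forall>x\<in>B. \<forall>y\<in>B. \<beta> x y = (if x = y then 1 else 0))"
  using assms
proof (induction "card B0" arbitrary: B0 rule: less_induct)
  case less
  define V where "V = span B0"
  have sV: "subspace V" by (simp add: V_def)
  have nd: "x = 0" if "x \<in> V" "\<And>w. w \<in> V \<Longrightarrow> \<beta> x w = 0" for x
    using less.prems(3) that by (auto simp: V_def)
  have ndr: "x = 0" if "x \<in> V" "\<And>w. w \<in> V \<Longrightarrow> \<beta> w x = 0" for x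
    using nondegenerate_right[OF less.prems] that by (auto simp: V_def)
  show ?case
  proof (cases "B0 = {}")
    case True
    then show ?thesis by (intro exI[of _ "{}"]) (auto simp: independent_empty)
  next
    case False
    \<comment> \<open>Prescribing the values on the basis \<open>B0\<close> is enough, since both
      \<beta> w u and \<open>(\<beta> v w) ^ q\<close> are q-semilinear in w.\<close>
    have "\<exists>u\<in>V. \<forall>w\<in>V. \<beta> w u = (\<beta> v w) ^ q" for v
    proof -
      obtain u where u: "u \<in> V" "\<forall>b\<in>B0. \<beta> b u = (\<beta> v b) ^ q"
        using exists_prescribed_pairing[OF sV less.prems(1,2), of "\<lambda>b. (\<beta> v b) ^ q"] nd
        by (auto simp: V_def)
      have "\<beta> w u = (\<beta> v w) ^ q" if "w \<in> V" for w
        using that unfolding V_def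
      proof (induction rule: span_induct_alt)
        case base
        then show ?case using q_gt_1 by simp
      next
        case (step c x y)
        then show ?case using u
          by (simp add: add_left add_right scale_left scale_right frob_add power_mult_distrib)
      qed
      then show ?thesis using u by blast
    qed
    then obtain F where FV: "\<And>v. F v \<in> V" and F: "\<And>v w. w \<in> V \<Longrightarrow> \<beta> w (F v) = (\<beta> v w) ^ q"
      by metis
    have Funique: "F v = u" if "u \<in> V" "\<And>w. w \<in> V \<Longrightarrow> \<beta> w u = (\<beta> v w) ^ q" for u v
    proof -
      have "F v - u = 0" using that FV F sV
        by (intro ndr) (auto simp: subspace_diff diff_right)
      then show ?thesis by simp
    qed
    \<comment> \<open>The power q enters twice: through the first argument of \<beta>, and through
      the q-th power in the equation defining \<open>F\<close>.\<close>
    define Q where "Q = q * q"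
    have Q1: "Q > 1" unfolding Q_def by (rule less_1_mult[OF q_gt_1 q_gt_1])
    have Qadd: "(x + y) ^ Q = x ^ Q + y ^ Q" for x y :: 'a
      by (simp add: Q_def power_mult frob_add)
    have Fadd: "F (u + v) = F u + F v" for u v
      using FV sV by (intro Funique) (auto simp: subspace_add F add_left add_right frob_add)
    have Fsc: "F (c *s v) = (c ^ Q) *s F v" for c v
      using FV sV
      by (intro Funique) (auto simp: subspace_scale F scale_left scale_right Q_def power_mult power_mult_distrib)
    have Finj: "v = 0" if "v \<in> V" "F v = 0" for v
      using that F[of _ v] q_gt_1 by (intro nd) auto
    have fix_span: "V \<subseteq> span {v \<in> V. F v = v}"
      by (rule span_Frobenius_fixed[OF Q1 Qadd sV less.prems(1)]) (auto simp: V_def[symmetric] FV Fadd Fsc Finj)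
    \<comment> \<open>If all fixed vectors were isotropic, polarization would make any two of them
      orthogonal. As they span \<open>V\<close>, this would make \<beta> vanish on
      \<open>V\<close>.\<close>
    have "\<exists>v\<in>V. F v = v \<and> \<beta> v v \<noteq> 0"
    proof (rule ccontr)
      assume "\<not> ?thesis"
      then have iso: "\<beta> v v = 0" if "v \<in> V" "F v = v" for v using that by blast
      have orth: "\<beta> u v = 0" if uv: "u \<in> V" "F u = u" "v \<in> V" "F v = v" for u v
      proof (rule ccontr)
        define b where "b = \<beta> u v"
        assume "\<beta> u v \<noteq> 0"
        then have b0: "b \<noteq> 0" by (simp add: b_def)
        have vu: "\<beta> v u = b ^ q" using F[of v u] uv by (simp add: b_def)
        have bQ: "b ^ Q = b" using F[of u v] uv vu by (simp add: b_def Q_def power_mult)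
        \<comment> \<open>The equation says that \<open>d\<close> has trace
          \<open>d + d ^ q = 1\<close>; it also forces \<open>d ^ Q = d\<close>.\<close>
        obtain d :: 'a where "d ^ q + 1 * d = 1" using power_plus_linear_solvable[OF q_gt_1] by blast
        then have dq: "d ^ q = 1 + - d" by (simp add: algebra_simps)
        have dQ: "d ^ Q = d" unfolding Q_def power_mult dq frob_add frob_minus by (simp add: dq)
        \<comment> \<open>\<open>c\<close> is fixed by the \<open>q\<^sup>2\<close>-power map and the trace of \<open>c * b\<close> is 1.\<close>
        define c where "c = d / b"
        have cQ: "c ^ Q = c" by (simp add: c_def power_divide dQ bQ)
        define x where "x = u + c *s v"
        have "x \<in> V" using uv sV by (simp add: x_def subspace_add subspace_scale)
        moreover have "F x = x" by (simp add: x_def Fadd Fsc uv cQ)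
        ultimately have "\<beta> x x = 0" by (rule iso)
        moreover have "\<beta> x x = c * b + c ^ q * b ^ q"
          using iso uv by (simp add: x_def add_left add_right scale_left scale_right vu b_def[symmetric])
        moreover have "c * b + c ^ q * b ^ q = 1"
          using b0 by (simp add: c_def power_divide dq)
        ultimately show False by simp
      qed
      have "x = 0" if x: "x \<in> V" "F x = x" for x
      proof (rule nd[OF x(1)])
        fix w assume "w \<in> V"
        then have "w \<in> span {v \<in> V. F v = v}" using fix_span by blast
        then show "\<beta> x w = 0" by (rule span_right_zero) (use orth x in auto)
      qed
      then have "span {v \<in> V. F v = v} \<subseteq> span {0}" by (intro span_mono) auto
      then have "V \<subseteq> {0}" using fix_span by auto
      then have "B0 \<subseteq> {0}" using span_superset by (auto simp: V_def)
      then show False using False less.prems(2) dependent_zero by auto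
    qed
    then obtain v where v: "v \<in> V" "F v = v" "\<beta> v v \<noteq> 0" by blast
    \<comment> \<open>Scaling \<open>v\<close> by c multiplies \<beta> v v by
      \<open>c ^ q * c\<close>, hence the exponent q + 1.\<close>
    obtain c where c: "c ^ Suc q = 1 / \<beta> v v" using nth_root_exists[of "Suc q"] by blast
    then have c0: "c \<noteq> 0" using v(3) by auto
    define e where "e = c *s v"
    have eV: "e \<in> V" using v sV by (simp add: e_def subspace_scale)
    have ee: "\<beta> e e = 1" using c v(3) by (simp add: e_def scale_left scale_right mult.assoc[symmetric])
    \<comment> \<open>The scaling may destroy the equation \<open>F e = e\<close>. What survives is
      that the right orthogonal \<open>H\<close> of \<open>e\<close> is contained in its left
      orthogonal.\<close>
    have sym: "\<beta> w e = 0" if "w \<in> V" "\<beta> e w = 0" for w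
      using F[of w v] that v(2) c0 q_gt_1 by (simp add: e_def scale_left scale_right)
    define H where "H = {w \<in> V. \<beta> e w = 0}"
    have sH: "subspace H" using sV
      by (auto simp: H_def subspace_def add_right scale_right)
    have HV: "H \<subseteq> span B0" by (auto simp: H_def V_def)
    obtain C where C: "finite C" "independent C" "span C = H"
      using subspace_finite_basis[OF less.prems(1) sH HV] by blast
    have eH: "e \<notin> H" using ee by (simp add: H_def)
    have "independent (insert e C)" using C eH by (intro independent_insertI) auto
    moreover have "insert e C \<subseteq> span B0" using C HV eV span_superset by (auto simp: V_def)
    ultimately have "card (insert e C) \<le> card B0"
      using independent_span_bound[OF less.prems(1)] by blast
    moreover have "e \<notin> C" using C eH span_base by blast
    ultimately have card: "card C < card B0" using C by simp
    \<comment> \<open>\<open>V\<close> is the sum of \<open>H\<close> and the line through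
      \<open>e\<close>, and \<beta> x e = 0 for x in \<open>H\<close> by \<open>sym\<close>; so the
      trivial left radical is inherited by \<open>H\<close>.\<close>
    have "x = 0" if x: "x \<in> span C" "\<And>w. w \<in> span C \<Longrightarrow> \<beta> x w = 0" for x
    proof (rule nd)
      show "x \<in> V" using x C by (auto simp: H_def)
      fix y assume y: "y \<in> V"
      define z where "z = y - (\<beta> e y) *s e"
      have "z \<in> H" using y eV sV ee by (simp add: z_def H_def subspace_diff subspace_scale diff_right scale_right)
      then have "\<beta> x z = 0" using x C by simp
      moreover have "\<beta> x e = 0" using x(1) C sym by (auto simp: H_def)
      ultimately show "\<beta> x y = 0" by (simp add: z_def diff_right scale_right)
    qed
    from less.hyps[OF card C(1,2) this]
    obtain B where B: "finite B" "independent B" "span B = span C"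
      "\<forall>x\<in>B. \<forall>y\<in>B. \<beta> x y = (if x = y then 1 else 0)" by blast
    have BH: "B \<subseteq> H" using B C span_superset by blast
    have eB: "e \<notin> B" using BH eH by blast
    have "independent (insert e B)" using B C eH by (intro independent_insertI) auto
    moreover have "span (insert e B) = span B0"
    proof
      show "span (insert e B) \<subseteq> span B0" using BH HV eV by (intro span_minimal) (auto simp: V_def)
      show "span B0 \<subseteq> span (insert e B)"
      proof
        fix y assume y: "y \<in> span B0"
        have "y - (\<beta> e y) *s e \<in> H"
          using y eV sV ee by (simp add: H_def subspace_diff subspace_scale diff_right scale_right V_def)
        then show "y \<in> span (insert e B)" using B C by (auto simp: span_breakdown_eq)
      qed
    qed
    moreover have "\<forall>x\<in>insert e B. \<forall>y\<in>insert e B. \<beta> x y = (if x = y then 1 else 0)"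
      using B(4) ee eB BH sym by (auto simp: H_def)
    ultimately show ?thesis using B(1) by (intro exI[of _ "insert e B"]) auto
  qed
qed

end

section \<open>Partial permutation bases\<close>

context vector_space
begin

lemma span_Int_independent_Un:
  assumes "finite A" "finite B" "independent (A \<union> B)" "A \<inter> B = {}" "x \<in> span A" "x \<in> span B"
  shows "x = 0"
proof -
  obtain a where a: "x = (\<Sum>v\<in>A. scale (a v) v)" using assms(1,5) by (auto simp: span_finite)
  obtain b where b: "x = (\<Sum>v\<in>B. scale (b v) v)" using assms(2,6) by (auto simp: span_finite)
  define c where "c v = (if v \<in> A then a v else - b v)" for v
  have "(\<Sum>v\<in>A \<union> B. scale (c v) v) = (\<Sum>v\<in>A. scale (c v) v) + (\<Sum>v\<in>B. scale (c v) v)"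
    using assms by (intro sum.union_disjoint) auto
  also have "(\<Sum>v\<in>A. scale (c v) v) = x" unfolding a by (intro sum.cong) (auto simp: c_def)
  also have "(\<Sum>v\<in>B. scale (c v) v) = - x"
    unfolding b sum_negf[symmetric] using assms(4) by (intro sum.cong) (auto simp: c_def)
  finally have "(\<Sum>v\<in>A \<union> B. scale (c v) v) = 0" by simp
  then have "c v = 0" if "v \<in> A" for v
    using independentD[OF assms(3), of "A \<union> B" c v] that assms(1,2) by auto
  then show ?thesis unfolding a by (intro sum.neutral) (auto simp: c_def)
qed

lemma independent_Un_if_span_Int:
  assumes "finite A" "finite B" "independent A" "independent B"
    and "\<And>x. x \<in> span A \<Longrightarrow> x \<in> span B \<Longrightarrow> x = 0"
  shows "independent (A \<union> B)" "A \<inter> B = {}"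
proof -
  show disj: "A \<inter> B = {}"
    using assms(3,5) dependent_zero span_base by (metis disjoint_iff)
  show "independent (A \<union> B)"
  proof (rule independent_if_scalars_zero)
    fix f y assume z: "(\<Sum>x\<in>A \<union> B. scale (f x) x) = 0" and y: "y \<in> A \<union> B"
    have eq: "(\<Sum>x\<in>A. scale (f x) x) = - (\<Sum>x\<in>B. scale (f x) x)"
      using z assms(1,2) disj by (simp add: sum.union_disjoint eq_neg_iff_add_eq_0)
    have "(\<Sum>x\<in>A. scale (f x) x) = 0"
    proof (rule assms(5))
      show "(\<Sum>x\<in>A. scale (f x) x) \<in> span A" by (intro span_sum span_scale span_base)
      show "(\<Sum>x\<in>A. scale (f x) x) \<in> span B"
        unfolding eq by (intro span_neg span_sum span_scale span_base)
    qed
    then show "f y = 0"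
      using eq y independentD[OF assms(3,1) subset_refl] independentD[OF assms(4,2) subset_refl] by auto
  qed (use assms in auto)
qed

lemma independent_if_card_le_spans:
  assumes "finite N" "independent C" "C \<subseteq> span N" "card N \<le> card C"
  shows "independent N"
proof -
  obtain N' where N': "N' \<subseteq> N" "independent N'" "N \<subseteq> span N'" by (rule maximal_independent_subset)
  have fN': "finite N'" using N'(1) assms(1) finite_subset by blast
  have "span N \<subseteq> span N'" using N'(3) by (intro span_minimal) auto
  then have "C \<subseteq> span N'" using assms(3) by blast
  then have "card C \<le> card N'" using independent_span_bound[OF fN' assms(2)] by blast
  then have "card N' = card N" using assms(1,4) N'(1) card_mono[of N N'] by linarith
  then have "N' = N" using card_subset_eq[OF assms(1) N'(1)] by blast
  then show ?thesis using N'(2) by simp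
qed

end

context sesquilinear_space
begin

text \<open>The Gram matrix in such a basis is a partial permutation matrix all of whose cycles are
  fixed points, i.e. up to reordering it is a block sum of blocks \<open>[1]\<close> and nilpotent shifts
  (of size 1, too).\<close>

definition partial_permutation_basis :: "'b set \<Rightarrow> bool"
  where "partial_permutation_basis B \<longleftrightarrow> finite B \<and> independent B \<and>
    (\<forall>x\<in>B. \<forall>y\<in>B. \<beta> x y \<noteq> 0 \<longrightarrow> \<beta> x y = 1) \<and>
    (\<forall>x\<in>B. \<forall>y\<in>B. \<forall>z\<in>B. \<beta> x y \<noteq> 0 \<longrightarrow> \<beta> x z \<noteq> 0 \<longrightarrow> y = z) \<and>
    (\<forall>x\<in>B. \<forall>y\<in>B. \<forall>z\<in>B. \<beta> x z \<noteq> 0 \<longrightarrow> \<beta> y z \<noteq> 0 \<longrightarrow> x = y) \<and>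
    (\<exists>\<rho> :: 'b \<Rightarrow> nat. \<forall>x\<in>B. \<forall>y\<in>B. \<beta> x y \<noteq> 0 \<longrightarrow> x = y \<or> \<rho> x < \<rho> y)"

text \<open>Write \<open>L\<close> for the left radical and \<open>K\<close> for its left orthogonal, and let \<open>B1\<close> be a partial
  permutation basis of a complement of \<open>L\<close> in \<open>K\<close>. A complement \<open>G\<close> of \<open>K\<close> is dual to
  \<open>L\<close>. It is chosen such that some of its elements continue the chains of \<open>B1\<close> and the others are right
  orthogonal to \<open>B1\<close>; each \<open>g \<in> G\<close> is followed by its dual vector \<open>h g \<in> L\<close>. The projection
  \<open>T\<close> along \<open>L\<close> removes the remaining values \<open>\<beta> g x\<close>.\<close>

lemma partial_permutation_basis_extend:
  assumes B0: "finite B0" and V: "V = span B0"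
    and L: "L = {x \<in> V. \<forall>w\<in>V. \<beta> x w = 0}"
    and LR: "\<And>x. x \<in> L \<Longrightarrow> (\<And>w. w \<in> V \<Longrightarrow> \<beta> w x = 0) \<Longrightarrow> x = 0"
    and K: "K = {v \<in> V. \<forall>l\<in>L. \<beta> v l = 0}"
    and ppb: "partial_permutation_basis B1"
    and H0: "finite H0" "span H0 = L"
    and ind: "independent (B1 \<union> H0)" and disj: "B1 \<inter> H0 = {}" and spK: "span (B1 \<union> H0) = K"
  shows "\<exists>B. partial_permutation_basis B \<and> span B = V"
proof -
  have fB1: "finite B1" and indB1: "independent B1"
    and B1_01: "\<And>x y. x \<in> B1 \<Longrightarrow> y \<in> B1 \<Longrightarrow> \<beta> x y \<noteq> 0 \<Longrightarrow> \<beta> x y = 1"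
    and B1_fun: "\<And>x y z. x \<in> B1 \<Longrightarrow> y \<in> B1 \<Longrightarrow> z \<in> B1 \<Longrightarrow> \<beta> x y \<noteq> 0 \<Longrightarrow> \<beta> x z \<noteq> 0 \<Longrightarrow> y = z"
    and B1_inj: "\<And>x y z. x \<in> B1 \<Longrightarrow> y \<in> B1 \<Longrightarrow> z \<in> B1 \<Longrightarrow> \<beta> x z \<noteq> 0 \<Longrightarrow> \<beta> y z \<noteq> 0 \<Longrightarrow> x = y"
    using ppb unfolding partial_permutation_basis_def by blast+
  obtain \<rho> :: "'b \<Rightarrow> nat" where \<rho>: "\<And>x y. x \<in> B1 \<Longrightarrow> y \<in> B1 \<Longrightarrow> \<beta> x y \<noteq> 0 \<Longrightarrow> x = y \<or> \<rho> x < \<rho> y"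
    using ppb unfolding partial_permutation_basis_def by blast
  have sV: "subspace V" by (simp add: V)
  have sL: "subspace L" using H0(2) subspace_span by blast
  have LV: "L \<subseteq> V" and KV: "K \<subseteq> V" by (auto simp: L K)
  have LB: "\<beta> x w = 0" if "x \<in> L" "w \<in> V" for x w using that by (auto simp: L)
  have KL: "\<beta> x w = 0" if "x \<in> K" "w \<in> L" for x w using that by (auto simp: K)
  have H0L: "H0 \<subseteq> L" using H0 span_superset by blast
  have B1K: "B1 \<subseteq> K" using spK span_superset[of "B1 \<union> H0"] by blast
  have B1V: "B1 \<subseteq> V" using B1K KV by blast
  \<comment> \<open>The ends of the chains of \<open>B1\<close>, including single vectors without a
    loop; a vector with a loop is its own successor and does not belong to \<open>E\<close>.\<close>
  define E where "E = {b \<in> B1. \<forall>b'\<in>B1. \<beta> b b' = 0}"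
  \<comment> \<open>Inside a chain the successor of \<open>b\<close> is already dual to
    \<open>b\<close>; only an end needs a new vector. It exists because the span of
    \<open>B1\<close> meets the left radical \<open>L\<close> in 0.\<close>
  have dual1: "\<exists>v\<in>V. (\<forall>b'\<in>B1. \<beta> b' v = (if b' = b then 1 else 0)) \<and> (b \<in> E \<or> v \<in> B1)" if b: "b \<in> B1" for b
  proof (cases "b \<in> E")
    case True
    have "\<exists>v\<in>V. \<forall>b'\<in>B1. \<beta> b' v = (if b' = b then 1 else 0)"
    proof (rule exists_prescribed_pairing[OF sV fB1 indB1])
      fix x assume x: "x \<in> span B1" "\<And>w. w \<in> V \<Longrightarrow> \<beta> x w = 0"
      then have "x \<in> L" using span_minimal[OF B1V sV] by (auto simp: L)
      then show "x = 0" using span_Int_independent_Un[OF fB1 H0(1) ind disj x(1)] H0 by simp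
    qed
    then show ?thesis using True by blast
  next
    case False
    then obtain b' where b': "b' \<in> B1" "\<beta> b b' \<noteq> 0" using b by (auto simp: E_def)
    have "\<beta> b b' = 1" using B1_01[OF b b'] .
    moreover have "\<beta> c b' = 0" if "c \<in> B1" "c \<noteq> b" for c
      using B1_inj[OF that(1) b b'(1) _ b'(2)] that(2) by blast
    ultimately have "\<forall>c\<in>B1. \<beta> c b' = (if c = b then 1 else 0)" by simp
    then show ?thesis using b' B1V by blast
  qed
  then obtain \<gamma> where \<gamma>V: "\<And>b. b \<in> B1 \<Longrightarrow> \<gamma> b \<in> V"
    and \<gamma>: "\<And>b b'. b \<in> B1 \<Longrightarrow> b' \<in> B1 \<Longrightarrow> \<beta> b' (\<gamma> b) = (if b' = b then 1 else 0)"
    and \<gamma>E: "\<And>b. b \<in> B1 \<Longrightarrow> b \<in> E \<or> \<gamma> b \<in> B1"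
    by metis
  have EB1: "E \<subseteq> B1" by (auto simp: E_def)
  have fE: "finite E" using EB1 fB1 finite_subset by blast
  have E\<gamma>: "\<beta> e (\<gamma> f) = (if e = f then 1 else 0)" if "f \<in> E" "e \<in> E" for e f
    by (rule \<gamma>) (use that EB1 in auto)
  \<comment> \<open>Ends of chains pair to 0 with \<open>B1\<close>, and with \<open>L\<close> since
    they lie in \<open>K\<close>. They thus annihilate \<open>K\<close>, so the vectors
    \<open>\<gamma> e\<close> dual to them are independent modulo \<open>K\<close>.\<close>
  have EK: "\<beta> e k = 0" if "e \<in> E" "k \<in> span (B1 \<union> H0)" for e k
    using that(2)
  proof (rule span_right_zero)
    fix s assume "s \<in> B1 \<union> H0"
    then show "\<beta> e s = 0" using that(1) EB1 B1K H0L KL[of e s] by (auto simp: E_def)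
  qed
  define A where "A = B1 \<union> H0"
  define G0 where "G0 = \<gamma> ` E"
  have fA: "finite A" and indA: "independent A" using fB1 H0 ind by (auto simp: A_def)
  have AK: "A \<subseteq> K" unfolding spK[symmetric] A_def by (rule span_superset)
  have indAG0: "independent (A \<union> G0)" and disjAG0: "A \<inter> G0 = {}"
  proof -
    have zero: "x = 0" if "x \<in> span A" "x \<in> span G0" for x
    proof -
      obtain c where c: "x = (\<Sum>e\<in>E. c e *s \<gamma> e)"
        using span_image_finite[OF fE] \<open>x \<in> span G0\<close> by (auto simp: G0_def)
      have "c e = 0" if e: "e \<in> E" for e
        using dual_sum[OF fE e E\<gamma>, of c] EK[OF e] \<open>x \<in> span A\<close> by (simp add: c A_def)
      then show ?thesis by (simp add: c)
    qed
    have "independent G0" unfolding G0_def using fE E\<gamma> by (rule dual_independent)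
    then show "independent (A \<union> G0)" "A \<inter> G0 = {}"
      using independent_Un_if_span_Int[OF fA _ indA _ zero] fE by (auto simp: G0_def)
  qed
  define G' where "G' = {v \<in> V. \<forall>b\<in>B1. \<beta> b v = 0}"
  \<comment> \<open>Beyond \<open>G0\<close> only vectors right orthogonal to \<open>B1\<close> are
    used to complete the basis, so these start new chains instead of continuing old ones.\<close>
  obtain C where C: "A \<union> G0 \<subseteq> C" "C \<subseteq> A \<union> G0 \<union> G'" "independent C" "A \<union> G0 \<union> G' \<subseteq> span C"
    using maximal_independent_subset_extend[of "A \<union> G0" "A \<union> G0 \<union> G'"] indAG0 by blast
  have G0V: "G0 \<subseteq> V" using \<gamma>V EB1 by (auto simp: G0_def)
  have CV: "C \<subseteq> V" using C(2) AK KV G0V by (auto simp: G'_def)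
  have fC: "finite C" using independent_span_bound[OF B0 C(3)] CV V by blast
  \<comment> \<open>Subtracting \<Sum> \<beta> b v \<gamma> b makes \<open>v\<close> right
    orthogonal to \<open>B1\<close>, and each \<open>\<gamma> b\<close> belongs to \<open>B1\<close>
    or to \<open>G0\<close>.\<close>
  have VC: "V \<subseteq> span C"
  proof
    fix v assume v: "v \<in> V"
    define s where "s = (\<Sum>b\<in>B1. \<beta> b v *s \<gamma> b)"
    have "\<gamma> b \<in> span C" if "b \<in> B1" for b
      using \<gamma>E[OF that] C(1) span_base[of _ C] by (auto simp: A_def G0_def)
    then have sC: "s \<in> span C" unfolding s_def by (intro span_sum span_scale) auto
    have "s \<in> V" unfolding s_def using sV \<gamma>V by (intro subspace_sum subspace_scale) auto
    then have "v - s \<in> V" using v sV by (simp add: subspace_diff)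
    moreover have "\<beta> b (v - s) = 0" if "b \<in> B1" for b
      unfolding diff_right s_def using dual_sum[OF fB1 that \<gamma>] by simp
    ultimately have "v - s \<in> G'" by (simp add: G'_def)
    then have "v - s \<in> span C" using C(4) by blast
    then have "v - s + s \<in> span C" using sC by (rule span_add)
    then show "v \<in> span C" by simp
  qed
  define G where "G = C - A"
  have CAG: "C = A \<union> G" and AG: "A \<inter> G = {}" using C(1) by (auto simp: G_def)
  have fG: "finite G" and indG: "independent G" and GV: "G \<subseteq> V" and G0G: "G0 \<subseteq> G"
    using fC C(1,3) CV disjAG0 independent_mono[of C G] by (auto simp: G_def)
  have Gcases: "(\<exists>e\<in>E. g = \<gamma> e) \<or> (\<forall>b\<in>B1. \<beta> b g = 0)" if "g \<in> G" for g
    using that C(2) by (auto simp: G_def G0_def G'_def)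
  have GK0: "x = 0" if "x \<in> span G" "x \<in> K" for x
    using span_Int_independent_Un[OF fA fG, of x] C(3) CAG AG that spK by (simp add: A_def)
  \<comment> \<open>A combination of \<open>G\<close> pairing to 0 with all of \<open>L\<close>
    belongs to \<open>K\<close> and is therefore 0; so \<open>L\<close> contains a family dual to
    \<open>G\<close>.\<close>
  have "\<exists>h\<in>L. \<forall>b\<in>G. \<beta> b h = (if b = g then 1 else 0)" for g
  proof (rule exists_prescribed_pairing[OF sL fG indG])
    fix x assume x: "x \<in> span G" "\<And>w. w \<in> L \<Longrightarrow> \<beta> x w = 0"
    moreover have "x \<in> V" using span_minimal[OF GV sV] x(1) by blast
    ultimately show "x = 0" using GK0 by (simp add: K)
  qed
  then obtain h where hL: "\<And>g. h g \<in> L" and h: "\<And>g b. b \<in> G \<Longrightarrow> \<beta> b (h g) = (if b = g then 1 else 0)"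
    by metis
  \<comment> \<open>The difference \<open>l - s\<close> is annihilated from the left by
    \<open>G\<close> by construction and by \<open>K\<close> because it lies in \<open>L\<close>,
    hence by all of \<open>V\<close>. It belongs to both radicals, and \<open>LR\<close> makes it
    0.\<close>
  have Lh: "L \<subseteq> span (h ` G)"
  proof
    fix l assume l: "l \<in> L"
    define s where "s = (\<Sum>g\<in>G. \<beta> g l *s h g)"
    have "s \<in> L" unfolding s_def using sL hL by (intro subspace_sum subspace_scale) auto
    then have lsL: "l - s \<in> L" using l sL by (simp add: subspace_diff)
    have "l - s = 0"
    proof (rule LR[OF lsL])
      fix w assume "w \<in> V"
      then have "w \<in> span C" using VC by blast
      then show "\<beta> w (l - s) = 0"
      proof (rule span_left_zero)
        fix c assume "c \<in> C"
        then consider "c \<in> A" | "c \<in> G" using CAG by blast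
        then show "\<beta> c (l - s) = 0"
        proof cases
          case 1
          then show ?thesis using AK lsL KL by blast
        next
          case 2
          then show ?thesis unfolding diff_right s_def using dual_sum[OF fG 2 h] by simp
        qed
      qed
    qed
    then have "l = s" by simp
    also have "s \<in> span (h ` G)" unfolding s_def by (intro span_sum span_scale span_base) auto
    finally show "l \<in> span (h ` G)" .
  qed
  \<comment> \<open>A change of x by a vector of \<open>L\<close> affects neither \<beta> x z for z
    in \<open>V\<close>, since \<open>L\<close> is the left radical, nor \<beta> b x for b in
    \<open>K\<close>. The values \<beta> g x with g in \<open>G\<close> can therefore be cleared
    without damage to the chains.\<close>
  define \<tau> where "\<tau> x = (\<Sum>g\<in>G. \<beta> g x *s h g)" for x
  define T where "T x = x - \<tau> x" for x
  have \<tau>L: "\<tau> x \<in> L" for x unfolding \<tau>_def using sL hL by (intro subspace_sum subspace_scale) auto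
  have TV: "T x \<in> V" if "x \<in> V" for x using that \<tau>L[of x] LV sV by (auto simp: T_def intro: subspace_diff)
  have T_left: "\<beta> (T x) z = \<beta> x z" if "z \<in> V" for x z
    using that \<tau>L[of x] LB by (simp add: T_def diff_left)
  have K_T: "\<beta> b (T x) = \<beta> b x" if "b \<in> K" for b x
    using that \<tau>L[of x] KL by (simp add: T_def diff_right)
  have G_T: "\<beta> g (T x) = 0" if "g \<in> G" for g x
    unfolding T_def diff_right \<tau>_def using dual_sum[OF fG that h] by simp
  have B1G: "B1 \<inter> G = {}" using AG by (auto simp: A_def)
  have CU: "C = (B1 \<union> G) \<union> H0" "(B1 \<union> G) \<inter> H0 = {}" using CAG AG disj by (auto simp: A_def)
  have B1G_L: "x = 0" if "x \<in> span (B1 \<union> G)" "x \<in> L" for x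
    using span_Int_independent_Un[of "B1 \<union> G" H0 x] fB1 fG H0 C(3) CU that by simp
  have nz: "0 \<notin> C" using C(3) dependent_zero by blast
  have injT: "inj_on T (B1 \<union> G)"
  proof (rule inj_onI)
    fix x y assume xy: "x \<in> B1 \<union> G" "y \<in> B1 \<union> G" "T x = T y"
    then have "x - y = \<tau> x - \<tau> y" by (simp add: T_def algebra_simps)
    then have "x - y \<in> L" using \<tau>L sL by (simp add: subspace_diff)
    moreover have "x - y \<in> span (B1 \<union> G)" using xy by (intro span_diff span_base)
    ultimately have "x - y = 0" by (rule B1G_L[rotated])
    then show "x = y" by simp
  qed
  have TL: "T x \<notin> L" if x: "x \<in> B1 \<union> G" for x
  proof
    assume "T x \<in> L"
    then have "T x + \<tau> x \<in> L" using \<tau>L sL by (simp add: subspace_add)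
    then have "x = 0" using B1G_L[of x] x span_base by (simp add: T_def)
    then show False using nz x CU by auto
  qed
  have injh: "inj_on h G" using h by (rule dual_inj_on) auto
  define N where "N = T ` (B1 \<union> G) \<union> h ` G"
  have fN: "finite N" using fB1 fG by (simp add: N_def)
  have NV: "N \<subseteq> V" using TV B1V GV hL LV by (auto simp: N_def)
  have CN: "C \<subseteq> span N"
  proof
    fix x assume "x \<in> C"
    have LN: "L \<subseteq> span N" using Lh span_mono[of "h ` G" N] by (auto simp: N_def)
    show "x \<in> span N"
    proof (cases "x \<in> H0")
      case True
      then show ?thesis using H0L LN by blast
    next
      case False
      then have "T x \<in> span N" using \<open>x \<in> C\<close> CU by (intro span_base) (auto simp: N_def)
      moreover have "\<tau> x \<in> span N" using \<tau>L LN by blast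
      ultimately have "T x + \<tau> x \<in> span N" by (rule span_add)
      then show ?thesis by (simp add: T_def)
    qed
  qed
  \<comment> \<open>Independence comes from counting: the vectors \<open>h g\<close> are independent
    in \<open>L\<close>, so there are at most \<open>card H0\<close> of them, and \<open>N\<close>
    has no more elements than the independent set \<open>C\<close> contained in its span.\<close>
  have indN: "independent N"
  proof (rule independent_if_card_le_spans[OF fN C(3) CN])
    have "independent (h ` G)" using fG h by (rule dual_independent)
    then have "card (h ` G) \<le> card H0"
      using independent_span_bound[OF H0(1)] hL H0(2) by blast
    moreover have "card N \<le> card (T ` (B1 \<union> G)) + card (h ` G)" unfolding N_def by (rule card_Un_le)
    moreover have "card (T ` (B1 \<union> G)) \<le> card (B1 \<union> G)" using fB1 fG by (intro card_image_le) auto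
    moreover have "card C = card (B1 \<union> G) + card H0"
      unfolding CU(1) using fB1 fG H0 CU(2) by (intro card_Un_disjoint) auto
    ultimately show "card N \<le> card C" by linarith
  qed
  have spN: "span N = V"
  proof
    show "span N \<subseteq> V" using NV sV by (rule span_minimal)
    have "span C \<subseteq> span N" using CN by (intro span_minimal) auto
    then show "V \<subseteq> span N" using VC by blast
  qed
  \<comment> \<open>The three kinds of arrows: those of the old chains, from an end \<open>e\<close>
    to \<open>\<gamma> e\<close>, and from \<open>g\<close> to its partner in
    \<open>L\<close>.\<close>
  define edge where "edge x y \<longleftrightarrow> (\<exists>b\<in>B1. \<exists>b'\<in>B1. x = T b \<and> y = T b' \<and> \<beta> b b' \<noteq> 0) \<or>
      (\<exists>e\<in>E. x = T e \<and> y = T (\<gamma> e)) \<or> (\<exists>g\<in>G. x = T g \<and> y = h g)" for x y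
  have edge: "\<beta> x y = 1 \<and> edge x y" if xN: "x \<in> N" and yN: "y \<in> N" and xy0: "\<beta> x y \<noteq> 0" for x y
  proof -
    have yV: "y \<in> V" using yN NV by blast
    have "x \<notin> L" using LB yV xy0 by blast
    then consider b where "b \<in> B1" "x = T b" | g where "g \<in> G" "x = T g"
      using xN hL by (auto simp: N_def)
    then show ?thesis
    proof cases
      case b: 1
      have bK: "b \<in> K" using b B1K by blast
      have xy: "\<beta> x y = \<beta> b y" using b T_left yV by simp
      consider b' where "b' \<in> B1" "y = T b'" | g where "g \<in> G" "y = T g" | g where "g \<in> G" "y = h g"
        using yN by (auto simp: N_def)
      then show ?thesis
      proof cases
        case 1
        then have "\<beta> x y = \<beta> b b'" using xy K_T[OF bK] by simp
        then show ?thesis using xy0 1 b B1_01 by (auto simp: edge_def)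
      next
        case 2
        then have eq: "\<beta> x y = \<beta> b g" using xy K_T[OF bK] by simp
        then obtain e where e: "e \<in> E" "g = \<gamma> e" using Gcases[OF 2(1)] xy0 b by auto
        then have "e = b" "\<beta> x y = 1"
          using \<gamma>[of e b] EB1 b eq xy0 by (auto split: if_splits)
        then show ?thesis using e b 2 by (auto simp: edge_def)
      next
        case 3
        then show ?thesis using xy KL[OF bK hL] xy0 by simp
      qed
    next
      case g: 2
      have xy: "\<beta> x y = \<beta> g y" using g T_left yV by simp
      then have "\<not> (\<exists>z. y = T z)" using G_T[OF g(1)] xy0 by auto
      then obtain g' where "g' \<in> G" "y = h g'" using yN by (auto simp: N_def)
      then have "g' = g" "\<beta> x y = 1" using xy h[OF g(1), of g'] xy0 by (auto split: if_splits)
      then show ?thesis using g \<open>y = h g'\<close> by (auto simp: edge_def)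
    qed
  qed
  have Tinj: "x = y" if "T x = T y" "x \<in> B1 \<union> G" "y \<in> B1 \<union> G" for x y
    using inj_onD[OF injT that] .
  have Th: "T x \<noteq> h g" if "x \<in> B1 \<union> G" for x g using TL[OF that] hL by metis
  have \<gamma>G: "\<gamma> e \<in> G" if "e \<in> E" for e using that G0G by (auto simp: G0_def)
  have \<gamma>inj: "e = f" if "\<gamma> e = \<gamma> f" "e \<in> E" "f \<in> E" for e f
    using E\<gamma>[of e e] E\<gamma>[of f e] that by (auto split: if_splits)
  have E0: "\<beta> e b = 0" if "e \<in> E" "b \<in> B1" for e b using that by (auto simp: E_def)
  have edge_fun: "y = z" if "edge x y" "edge x z" for x y z
    using that(1) unfolding edge_def
  proof (elim disjE bexE conjE)
    fix b b' assume b: "b \<in> B1" "b' \<in> B1" "x = T b" "y = T b'" "\<beta> b b' \<noteq> 0"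
    show ?thesis using that(2) unfolding edge_def
    proof (elim disjE bexE conjE)
      fix c c' assume "c \<in> B1" "c' \<in> B1" "x = T c" "z = T c'" "\<beta> c c' \<noteq> 0"
      then show ?thesis using b Tinj[of b c] B1_fun by auto
    next
      fix e assume "e \<in> E" "x = T e"
      then show ?thesis using b Tinj[of b e] EB1 E0 by auto
    next
      fix g assume "g \<in> G" "x = T g"
      then show ?thesis using b Tinj[of b g] B1G by auto
    qed
  next
    fix e assume e: "e \<in> E" "x = T e" "y = T (\<gamma> e)"
    show ?thesis using that(2) unfolding edge_def
    proof (elim disjE bexE conjE)
      fix c c' assume "c \<in> B1" "c' \<in> B1" "x = T c" "\<beta> c c' \<noteq> 0"
      then show ?thesis using e Tinj[of e c] EB1 E0 by auto
    next
      fix f assume "f \<in> E" "x = T f" "z = T (\<gamma> f)"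
      then show ?thesis using e Tinj[of e f] EB1 by auto
    next
      fix g assume "g \<in> G" "x = T g"
      then show ?thesis using e Tinj[of e g] EB1 B1G by auto
    qed
  next
    fix g assume g: "g \<in> G" "x = T g" "y = h g"
    show ?thesis using that(2) unfolding edge_def
    proof (elim disjE bexE conjE)
      fix c c' assume "c \<in> B1" "x = T c"
      then show ?thesis using g Tinj[of g c] B1G by auto
    next
      fix f assume "f \<in> E" "x = T f"
      then show ?thesis using g Tinj[of g f] EB1 B1G by auto
    next
      fix k assume "k \<in> G" "x = T k" "z = h k"
      then show ?thesis using g Tinj[of g k] by auto
    qed
  qed
  have edge_inj: "x = y" if "edge x z" "edge y z" for x y z
    using that(1) unfolding edge_def
  proof (elim disjE bexE conjE)
    fix b b' assume b: "b \<in> B1" "b' \<in> B1" "x = T b" "z = T b'" "\<beta> b b' \<noteq> 0"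
    show ?thesis using that(2) unfolding edge_def
    proof (elim disjE bexE conjE)
      fix c c' assume "c \<in> B1" "c' \<in> B1" "y = T c" "z = T c'" "\<beta> c c' \<noteq> 0"
      then show ?thesis using b Tinj[of b' c'] B1_inj by auto
    next
      fix e assume "e \<in> E" "z = T (\<gamma> e)"
      then show ?thesis using b Tinj[of b' "\<gamma> e"] \<gamma>G B1G by auto
    next
      fix g assume "z = h g"
      then show ?thesis using b Th[of b' g] by auto
    qed
  next
    fix e assume e: "e \<in> E" "x = T e" "z = T (\<gamma> e)"
    show ?thesis using that(2) unfolding edge_def
    proof (elim disjE bexE conjE)
      fix c c' assume "c' \<in> B1" "z = T c'"
      then show ?thesis using e Tinj[of c' "\<gamma> e"] \<gamma>G B1G by auto
    next
      fix f assume "f \<in> E" "y = T f" "z = T (\<gamma> f)"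
      then show ?thesis using e Tinj[of "\<gamma> e" "\<gamma> f"] \<gamma>G \<gamma>inj[of e f] by auto
    next
      fix g assume "z = h g"
      then show ?thesis using e Th[of "\<gamma> e" g] \<gamma>G by auto
    qed
  next
    fix g assume g: "g \<in> G" "x = T g" "z = h g"
    show ?thesis using that(2) unfolding edge_def
    proof (elim disjE bexE conjE)
      fix c c' assume "c' \<in> B1" "z = T c'"
      then show ?thesis using g Th[of c' g] by auto
    next
      fix f assume "f \<in> E" "z = T (\<gamma> f)"
      then show ?thesis using g Th[of "\<gamma> f" g] \<gamma>G by auto
    next
      fix k assume "k \<in> G" "y = T k" "z = h k"
      then show ?thesis using g inj_onD[OF injh, of g k] by auto
    qed
  qed
  define M where "M = (\<Sum>b\<in>B1. \<rho> b)"
  have \<rho>M: "\<rho> b \<le> M" if "b \<in> B1" for b unfolding M_def using fB1 that by (intro member_le_sum) auto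
  \<comment> \<open>Old ranks are at most \<open>M\<close>, and the two new vectors of a chain come
    after all of them.\<close>
  define \<sigma> where "\<sigma> x = (if x \<in> T ` B1 then \<rho> (inv_into B1 T x) else if x \<in> T ` G then M + 1 else M + 2)" for x
  have \<sigma>B: "\<sigma> (T b) = \<rho> b" if "b \<in> B1" for b
    using that inv_into_f_f[OF inj_on_subset[OF injT], of B1 b] by (simp add: \<sigma>_def)
  have \<sigma>G: "\<sigma> (T g) = M + 1" if "g \<in> G" for g
  proof -
    have "T g \<notin> T ` B1" using Tinj[of g] that B1G by blast
    then show ?thesis using that by (simp add: \<sigma>_def)
  qed
  have \<sigma>h: "\<sigma> (h g) = M + 2" for g
  proof -
    have "h g \<notin> T ` (B1 \<union> G)"
    proof
      assume "h g \<in> T ` (B1 \<union> G)"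
      then obtain x where x: "x \<in> B1 \<union> G" "h g = T x" by blast
      then show False using Th[OF x(1), of g] by simp
    qed
    then show ?thesis by (simp add: \<sigma>_def image_Un)
  qed
  have edge_rank: "x = y \<or> \<sigma> x < \<sigma> y" if "edge x y" for x y
    using that unfolding edge_def
  proof (elim disjE bexE conjE)
    fix b b' assume b: "b \<in> B1" "b' \<in> B1" "x = T b" "y = T b'" "\<beta> b b' \<noteq> 0"
    then show ?thesis using \<rho>[of b b'] \<sigma>B by auto
  next
    fix e assume "e \<in> E" "x = T e" "y = T (\<gamma> e)"
    then show ?thesis using \<sigma>B[of e] \<sigma>G[OF \<gamma>G[of e]] \<rho>M[of e] EB1 by auto
  next
    fix g assume "g \<in> G" "x = T g" "y = h g"
    then show ?thesis using \<sigma>G \<sigma>h by auto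
  qed
  have "\<forall>x\<in>N. \<forall>y\<in>N. \<beta> x y \<noteq> 0 \<longrightarrow> \<beta> x y = 1" using edge by blast
  moreover have "\<forall>x\<in>N. \<forall>y\<in>N. \<forall>z\<in>N. \<beta> x y \<noteq> 0 \<longrightarrow> \<beta> x z \<noteq> 0 \<longrightarrow> y = z"
    using edge edge_fun by meson
  moreover have "\<forall>x\<in>N. \<forall>y\<in>N. \<forall>z\<in>N. \<beta> x z \<noteq> 0 \<longrightarrow> \<beta> y z \<noteq> 0 \<longrightarrow> x = y"
    using edge edge_inj by meson
  moreover have "\<forall>x\<in>N. \<forall>y\<in>N. \<beta> x y \<noteq> 0 \<longrightarrow> x = y \<or> \<sigma> x < \<sigma> y"
    using edge edge_rank by meson
  ultimately have "partial_permutation_basis N"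
    unfolding partial_permutation_basis_def using fN indN by blast
  then show ?thesis using spN by blast
qed

text \<open>The dimension drops in both recursive cases: by 1 when a vector common to both radicals
  is split off, and by at least the dimension of \<open>L\<close> when passing to a complement of
  \<open>L\<close> in its left orthogonal. Only the span of the complement matters, so the basis
  returned by the induction can replace the one chosen at first.\<close>

theorem exists_partial_permutation_basis:
  assumes "finite B0" "independent B0"
  shows "\<exists>B. partial_permutation_basis B \<and> span B = span B0"
  using assms
proof (induction "card B0" arbitrary: B0 rule: less_induct)
  case less
  define V where "V = span B0"
  define L where "L = {x \<in> V. \<forall>w\<in>V. \<beta> x w = 0}"
  have sV: "subspace V" by (simp add: V_def)
  have sL: "subspace L" using sV by (auto simp: L_def subspace_def add_left scale_left)
  have LV: "L \<subseteq> span B0" by (auto simp: L_def V_def)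
  consider "L \<subseteq> {0}" | v where "v \<in> L" "v \<noteq> 0" "\<And>w. w \<in> V \<Longrightarrow> \<beta> w v = 0"
    | "\<not> L \<subseteq> {0}" "\<And>x. x \<in> L \<Longrightarrow> (\<And>w. w \<in> V \<Longrightarrow> \<beta> w x = 0) \<Longrightarrow> x = 0"
    by blast
  then show ?case
  proof cases
    case 1
    have "\<exists>B. finite B \<and> independent B \<and> span B = span B0 \<and> (\<forall>x\<in>B. \<forall>y\<in>B. \<beta> x y = (if x = y then 1 else 0))"
      using less.prems
    proof (rule orthonormal_basis)
      fix x assume "x \<in> span B0" "\<And>w. w \<in> span B0 \<Longrightarrow> \<beta> x w = 0"
      then have "x \<in> L" by (simp add: L_def V_def)
      then show "x = 0" using 1 by blast
    qed
    then obtain B where B: "finite B" "independent B" "span B = span B0"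
      and \<beta>B: "\<And>x y. x \<in> B \<Longrightarrow> y \<in> B \<Longrightarrow> \<beta> x y = (if x = y then 1 else 0)" by blast
    have eq: "x = y \<and> \<beta> x y = 1" if "x \<in> B" "y \<in> B" "\<beta> x y \<noteq> 0" for x y
      using \<beta>B[OF that(1,2)] that(3) by (simp split: if_splits)
    have "partial_permutation_basis B"
      unfolding partial_permutation_basis_def
    proof (intro conjI)
      show "\<exists>\<rho> :: 'b \<Rightarrow> nat. \<forall>x\<in>B. \<forall>y\<in>B. \<beta> x y \<noteq> 0 \<longrightarrow> x = y \<or> \<rho> x < \<rho> y"
        using eq by blast
      show "\<forall>x\<in>B. \<forall>y\<in>B. \<forall>z\<in>B. \<beta> x y \<noteq> 0 \<longrightarrow> \<beta> x z \<noteq> 0 \<longrightarrow> y = z"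
        using eq by metis
      show "\<forall>x\<in>B. \<forall>y\<in>B. \<forall>z\<in>B. \<beta> x z \<noteq> 0 \<longrightarrow> \<beta> y z \<noteq> 0 \<longrightarrow> x = y"
        using eq by metis
    qed (use B eq in blast)+
    then show ?thesis using B by blast
  next
    \<comment> \<open>\<open>v\<close> pairs to 0 with \<open>V\<close> on both sides, so every
      complement will do, and \<open>v\<close> becomes an isolated vector with block
      \<open>[0]\<close>.\<close>
    case 2
    have vV: "v \<in> V" and vl: "\<And>w. w \<in> V \<Longrightarrow> \<beta> v w = 0" using 2(1) by (auto simp: L_def)
    have "{v} \<subseteq> V" "independent {v}" using vV 2(2) by auto
    then obtain C where C: "{v} \<subseteq> C" "C \<subseteq> V" "independent C" "V \<subseteq> span C"
      by (rule maximal_independent_subset_extend)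
    have fC: "finite C" "card C \<le> card B0"
      using independent_span_bound[OF less.prems(1) C(3)] C(2) by (auto simp: V_def)
    have "card (C - {v}) < card B0" using fC C(1) card_Diff1_less[of C v] by auto
    moreover have "independent (C - {v})" using C(3) independent_mono by blast
    ultimately obtain B where B: "partial_permutation_basis B" "span B = span (C - {v})"
      using less.hyps[of "C - {v}"] fC by auto
    have "v \<notin> span B" using C(1,3) B(2) by (auto simp: dependent_def)
    then have ind: "independent (insert v B)"
      using B(1) by (intro independent_insertI) (auto simp: partial_permutation_basis_def)
    have "span (insert v B) = span (insert v (C - {v}))" by (simp only: span_insert B(2))
    then have span: "span (insert v B) = V"
      using C sV span_minimal[OF C(2) sV] by (simp add: insert_absorb insert_Diff_if subset_antisym)
    then have BV: "insert v B \<subseteq> V" using span_superset by blast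
    have edge: "x \<in> B \<and> y \<in> B" if "x \<in> insert v B" "y \<in> insert v B" "\<beta> x y \<noteq> 0" for x y
      using that vl[of y] 2(3)[of x] BV by auto
    have "partial_permutation_basis (insert v B)"
      unfolding partial_permutation_basis_def
    proof (intro conjI)
      show "\<forall>x\<in>insert v B. \<forall>y\<in>insert v B. \<beta> x y \<noteq> 0 \<longrightarrow> \<beta> x y = 1"
        using edge B(1) unfolding partial_permutation_basis_def by meson
      show "\<forall>x\<in>insert v B. \<forall>y\<in>insert v B. \<forall>z\<in>insert v B. \<beta> x y \<noteq> 0 \<longrightarrow> \<beta> x z \<noteq> 0 \<longrightarrow> y = z"
        using edge B(1) unfolding partial_permutation_basis_def by meson
      show "\<forall>x\<in>insert v B. \<forall>y\<in>insert v B. \<forall>z\<in>insert v B. \<beta> x z \<noteq> 0 \<longrightarrow> \<beta> y z \<noteq> 0 \<longrightarrow> x = y"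
        using edge B(1) unfolding partial_permutation_basis_def by meson
      obtain \<rho> :: "'b \<Rightarrow> nat" where "\<forall>x\<in>B. \<forall>y\<in>B. \<beta> x y \<noteq> 0 \<longrightarrow> x = y \<or> \<rho> x < \<rho> y"
        using B(1) unfolding partial_permutation_basis_def by blast
      then show "\<exists>\<rho> :: 'b \<Rightarrow> nat. \<forall>x\<in>insert v B. \<forall>y\<in>insert v B. \<beta> x y \<noteq> 0 \<longrightarrow> x = y \<or> \<rho> x < \<rho> y"
        using edge by meson
    qed (use ind B(1) in \<open>auto simp: partial_permutation_basis_def\<close>)
    then show ?thesis using span by (auto simp: V_def)
  next
    case 3
    define K where "K = {v \<in> V. \<forall>l\<in>L. \<beta> v l = 0}"
    have sK: "subspace K" using sV by (auto simp: K_def subspace_def add_left scale_left)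
    have LK: "L \<subseteq> K" by (auto simp: K_def L_def)
    obtain H0 where H0: "finite H0" "independent H0" "span H0 = L"
      using subspace_finite_basis[OF less.prems(1) sL LV] by blast
    have "H0 \<noteq> {}" using H0(3) 3(1) by auto
    have "H0 \<subseteq> K" using H0(3) LK span_superset by blast
    then obtain C where C: "H0 \<subseteq> C" "C \<subseteq> K" "independent C" "K \<subseteq> span C"
      using H0(2) by (rule maximal_independent_subset_extend)
    have fC: "finite C" "card C \<le> card B0"
      using independent_span_bound[OF less.prems(1) C(3)] C(2) by (auto simp: K_def V_def)
    have "C - H0 \<subset> C" using C(1) \<open>H0 \<noteq> {}\<close> by blast
    then have "card (C - H0) < card B0" using fC psubset_card_mono[of C "C - H0"] by simp
    moreover have "independent (C - H0)" using C(3) independent_mono by blast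
    ultimately obtain B1 where B1: "partial_permutation_basis B1" "span B1 = span (C - H0)"
      using less.hyps[of "C - H0"] fC by auto
    have CU: "C - H0 \<union> H0 = C" "(C - H0) \<inter> H0 = {}" using C(1) by blast+
    have zero: "x = 0" if "x \<in> span B1" "x \<in> span H0" for x
      using span_Int_independent_Un[of "C - H0" H0 x] fC H0 C(3) B1(2) that CU by simp
    have fB1: "finite B1" "independent B1" using B1 by (auto simp: partial_permutation_basis_def)
    note un = independent_Un_if_span_Int[OF fB1(1) H0(1) fB1(2) H0(2) zero]
    have "span (B1 \<union> H0) = span (C - H0 \<union> H0)" by (simp only: span_Un B1(2))
    also have "\<dots> = K" unfolding CU(1) using C sK span_minimal[OF C(2) sK] by blast
    finally have spK: "span (B1 \<union> H0) = K" .
    show ?thesis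
      using partial_permutation_basis_extend[OF less.prems(1) V_def L_def 3(2) K_def B1(1) H0(1,3) un(1) un(2) spK]
      by (simp add: V_def)
  qed
qed

end

section \<open>Block decomposition\<close>

text \<open>For a list of length 1 the second alternative means \<open>\<not> R x x\<close>.
  Isolated points without a loop are therefore chains too; they are the future blocks
  \<open>[0]\<close>, as opposed to the loops, which become \<open>[1]\<close>.\<close>

definition chain_decomposition :: "('b \<Rightarrow> 'b \<Rightarrow> bool) \<Rightarrow> 'b set \<Rightarrow> 'b list set \<Rightarrow> bool"
  where "chain_decomposition R B S \<longleftrightarrow> finite S \<and> \<Union> (set ` S) = B \<and>
    (\<forall>c\<in>S. c \<noteq> [] \<and> distinct c \<and>
       ((\<exists>x. c = [x] \<and> R x x) \<or> (\<forall>i<length c. \<forall>j<length c. R (c ! i) (c ! j) \<longleftrightarrow> j = Suc i))) \<and>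
    (\<forall>c\<in>S. \<forall>d\<in>S. c \<noteq> d \<longrightarrow> set c \<inter> set d = {} \<and> (\<forall>x\<in>set c. \<forall>y\<in>set d. \<not> R x y))"

text \<open>An element \<open>b\<close> of least rank has no predecessor other than itself. After
  its removal it either forms a list of its own or is put in front of the list that starts with its
  successor.\<close>

lemma partial_permutation_chains:
  fixes R :: "'b \<Rightarrow> 'b \<Rightarrow> bool" and \<rho> :: "'b \<Rightarrow> nat"
  assumes "finite B"
    and "\<And>x y z. x \<in> B \<Longrightarrow> y \<in> B \<Longrightarrow> z \<in> B \<Longrightarrow> R x y \<Longrightarrow> R x z \<Longrightarrow> y = z"
    and "\<And>x y z. x \<in> B \<Longrightarrow> y \<in> B \<Longrightarrow> z \<in> B \<Longrightarrow> R x z \<Longrightarrow> R y z \<Longrightarrow> x = y"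
    and "\<And>x y. x \<in> B \<Longrightarrow> y \<in> B \<Longrightarrow> R x y \<Longrightarrow> x = y \<or> \<rho> x < \<rho> y"
  shows "\<exists>S. chain_decomposition R B S"
  using assms
proof (induction "card B" arbitrary: B)
  case 0
  then show ?case by (intro exI[of _ "{}"]) (auto simp: chain_decomposition_def)
next
  case (Suc n)
  then have "B \<noteq> {}" by auto
  then obtain b where b: "b \<in> B" "\<And>x. x \<in> B \<Longrightarrow> \<rho> b \<le> \<rho> x"
    using Suc.prems(1) ex_min_if_finite[of "\<rho> ` B"] by (metis (no_types, lifting) arg_min_least arg_min_if_finite(1))
  have pred: "x = b" if "x \<in> B" "R x b" for x
    using Suc.prems(4)[OF that(1) b(1) that(2)] b(2)[OF that(1)] by auto
  have "\<exists>S. chain_decomposition R (B - {b}) S"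
  proof (rule Suc.hyps(1))
    show "n = card (B - {b})" using Suc.hyps(2) b(1) by simp
  qed (use Suc.prems in blast)+
  then obtain S where fS: "finite S" and US: "\<Union> (set ` S) = B - {b}"
    and S1': "\<forall>c\<in>S. c \<noteq> [] \<and> distinct c \<and>
       ((\<exists>x. c = [x] \<and> R x x) \<or> (\<forall>i<length c. \<forall>j<length c. R (c ! i) (c ! j) \<longleftrightarrow> j = Suc i))"
    and S2': "\<forall>c\<in>S. \<forall>d\<in>S. c \<noteq> d \<longrightarrow> set c \<inter> set d = {} \<and> (\<forall>x\<in>set c. \<forall>y\<in>set d. \<not> R x y)"
    unfolding chain_decomposition_def by (elim exE conjE)
  note S1 = bspec[OF S1'] and S2 = S2'[rule_format]
  have SB: "x \<in> B" "x \<noteq> b" if "c \<in> S" "x \<in> set c" for c x using US that by blast+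
  show ?case
  proof (cases "\<exists>y\<in>B - {b}. R b y")
    case False
    have "chain_decomposition R B (insert [b] S)"
      unfolding chain_decomposition_def
    proof (intro conjI ballI impI)
      show "\<Union> (set ` insert [b] S) = B" using US b(1) by auto
      show "(\<exists>x. c = [x] \<and> R x x) \<or> (\<forall>i<length c. \<forall>j<length c. R (c ! i) (c ! j) \<longleftrightarrow> j = Suc i)"
        if "c \<in> insert [b] S" for c
        using that S1 by (cases "c = [b]") auto
      show "\<not> R x y" if "c \<in> insert [b] S" "d \<in> insert [b] S" "c \<noteq> d" "x \<in> set c" "y \<in> set d" for c d x y
      proof (cases "c = [b]")
        case True
        then have "d \<in> S" using that by auto
        then show ?thesis using True that SB[of d y] False by auto
      next
        case c: False
        then have cS: "c \<in> S" using that by auto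
        show ?thesis
        proof (cases "d = [b]")
          case True
          then show ?thesis using that pred[of x] SB[OF cS that(4)] by auto
        next
          case False
          then show ?thesis using that cS S2[of c d] by auto
        qed
      qed
    qed (use fS S1 S2 SB in auto)
    then show ?thesis by blast
  next
    case True
    then obtain y where y: "y \<in> B" "y \<noteq> b" "R b y" by blast
    then obtain c where c: "c \<in> S" "y \<in> set c" using US by blast
    have Rbb: "\<not> R b b" using Suc.prems(2)[of b b y] b(1) y by auto
    have Rb: "R b z \<longleftrightarrow> z = y" if "z \<in> B" for z using Suc.prems(2)[of b z y] b(1) y that by auto
    have Ry: "R z y \<longleftrightarrow> z = b" if "z \<in> B" for z using Suc.prems(3)[of z b y] b(1) y that by auto
    have cc: "R (c ! i) (c ! j) \<longleftrightarrow> j = Suc i" if "i < length c" "j < length c" for i j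
    proof -
      have "\<not> (\<exists>x. c = [x] \<and> R x x)" using c Ry[of y] y by auto
      then show ?thesis using S1[OF c(1)] that by blast
    qed
    obtain k where k: "k < length c" "c ! k = y" using c(2) by (auto simp: in_set_conv_nth)
    \<comment> \<open>At any later position of \<open>c\<close>, the element \<open>y\<close> would
      have a predecessor different from \<open>b\<close>.\<close>
    have "k = 0"
    proof (rule ccontr)
      assume "k \<noteq> 0"
      then obtain i where i: "k = Suc i" using not0_implies_Suc by blast
      then have "R (c ! i) y" using cc[of i k] k by simp
      moreover have "c ! i \<in> set c" using k i by simp
      ultimately show False using Ry SB[OF c(1)] by blast
    qed
    then have c0: "c ! 0 = y" using k by simp
    have dc: "distinct c" using S1[OF c(1)] by blast
    have bc: "R ((b # c) ! i) ((b # c) ! j) \<longleftrightarrow> j = Suc i" if ij: "i < length (b # c)" "j < length (b # c)" for i j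
    proof (cases i)
      case i: 0
      show ?thesis
      proof (cases j)
        case 0
        then show ?thesis using i Rbb by simp
      next
        case (Suc j')
        then have j': "j' < length c" using ij by simp
        then have "c ! j' \<in> B" using SB[OF c(1)] by simp
        then have "R b (c ! j') \<longleftrightarrow> c ! j' = c ! 0" using Rb c0 by simp
        also have "\<dots> \<longleftrightarrow> j' = 0" using dc j' k by (subst nth_eq_iff_index_eq) auto
        finally show ?thesis using i Suc by simp
      qed
    next
      case i: (Suc i')
      then have i': "i' < length c" using ij by simp
      show ?thesis
      proof (cases j)
        case 0
        have "c ! i' \<in> set c" using i' by simp
        then show ?thesis using i 0 pred[of "c ! i'"] SB[OF c(1)] by auto
      next
        case (Suc j')
        then show ?thesis using i ij cc[of i' j'] by simp
      qed
    qed
    have bcS: "b # c \<notin> S" using SB[of "b # c" b] by auto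
    let ?S = "insert (b # c) (S - {c})"
    have "chain_decomposition R B ?S"
      unfolding chain_decomposition_def
    proof (intro conjI ballI impI)
      have "\<Union> (set ` ?S) = insert b (\<Union> (set ` S))" using c(1) by auto
      then show "\<Union> (set ` ?S) = B" using US b(1) by auto
      show "(\<exists>x. d = [x] \<and> R x x) \<or> (\<forall>i<length d. \<forall>j<length d. R (d ! i) (d ! j) \<longleftrightarrow> j = Suc i)"
        if "d \<in> ?S" for d
      proof (cases "d = b # c")
        case True
        then show ?thesis using bc by blast
      next
        case False
        then show ?thesis using that S1[of d] by blast
      qed
      show "\<not> R x z" if d: "d \<in> ?S" "d' \<in> ?S" "d \<noteq> d'" "x \<in> set d" "z \<in> set d'" for d d' x z
      proof (cases "d = b # c")
        case True
        then have d': "d' \<in> S" "d' \<noteq> c" using d by auto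
        show ?thesis
        proof (cases "x = b")
          case True
          have "z \<noteq> y" using S2[OF c(1) d'(1)] d' d(5) c(2) by blast
          then show ?thesis using True Rb SB[OF d'(1) d(5)] by simp
        next
          case False
          then have "x \<in> set c" using d(4) \<open>d = b # c\<close> by simp
          then show ?thesis using S2[OF c(1) d'(1)] d' d(5) by blast
        qed
      next
        case False
        then have dS: "d \<in> S" "d \<noteq> c" using d by auto
        show ?thesis
        proof (cases "d' = b # c")
          case True
          show ?thesis
          proof (cases "z = b")
            case True
            then show ?thesis using pred[of x] SB[OF dS(1) d(4)] by auto
          next
            case False
            then have "z \<in> set c" using d(5) \<open>d' = b # c\<close> by simp
            then show ?thesis using S2[OF dS(1) c(1) dS(2)] d(4) by blast
          qed
        next
          case False
          then have "d' \<in> S" using d by auto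
          then show ?thesis using S2[OF dS(1)] d by blast
        qed
      qed
      show "set d \<inter> set d' = {}" if d: "d \<in> ?S" "d' \<in> ?S" "d \<noteq> d'" for d d'
      proof -
        have bnot: "b \<notin> set e" if "e \<in> S" for e using SB[OF that] by blast
        show ?thesis
          using d bnot[of d] bnot[of d'] S2[of d d'] S2[of c d'] S2[of d c] c(1) by auto
      qed
      show "distinct d" if "d \<in> ?S" for d
        using that S1[of d] dc SB[OF c(1), of b] by auto
      show "d \<noteq> []" if "d \<in> ?S" for d
        using that S1[of d] by auto
    qed (use fS in auto)
    then show ?thesis by blast
  qed
qed

section \<open>Gram matrices of concatenated lists\<close>

definition gram_mat :: "('b \<Rightarrow> 'b \<Rightarrow> 'a) \<Rightarrow> 'b list \<Rightarrow> 'a mat"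
  where "gram_mat \<beta> xs = mat (length xs) (length xs) (\<lambda>(i, j). \<beta> (xs ! i) (xs ! j))"

lemma gram_mat_concat:
  fixes \<beta> :: "'b \<Rightarrow> 'b \<Rightarrow> 'a::zero"
  assumes "distinct cs"
    and "\<And>c d x y. c \<in> set cs \<Longrightarrow> d \<in> set cs \<Longrightarrow> c \<noteq> d \<Longrightarrow> x \<in> set c \<Longrightarrow> y \<in> set d \<Longrightarrow> \<beta> x y = 0"
  shows "gram_mat \<beta> (concat cs) = diag_block_mat (map (gram_mat \<beta>) cs)"
  using assms
proof (induction cs)
  case Nil
  then show ?case by (auto simp: gram_mat_def)
next
  case (Cons c cs)
  have IH: "diag_block_mat (map (gram_mat \<beta>) cs) = gram_mat \<beta> (concat cs)"
    using Cons by (metis distinct.simps(2) list.set_intros(2))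
  have z: "\<beta> (c ! i) (concat cs ! j) = 0" "\<beta> (concat cs ! j) (c ! i) = 0"
    if "i < length c" "j < length (concat cs)" for i j
  proof -
    have "concat cs ! j \<in> set (concat cs)" using that nth_mem by blast
    then obtain d where d: "d \<in> set cs" "concat cs ! j \<in> set d" by auto
    then have "d \<noteq> c" using Cons.prems(1) by auto
    then show "\<beta> (c ! i) (concat cs ! j) = 0" "\<beta> (concat cs ! j) (c ! i) = 0"
      using Cons.prems(2)[of c d "c ! i" "concat cs ! j"] Cons.prems(2)[of d c "concat cs ! j" "c ! i"] d that
      by auto
  qed
  show ?case
    unfolding list.map diag_block_mat.simps Let_def IH
    by (rule eq_matI) (auto simp: gram_mat_def nth_append z)
qed

context sesquilinear_space
begin

text \<open>Quantifying over all orders \<open>cs'\<close> of the blocks avoids permutation matrices later on.\<close>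

theorem exists_block_basis:
  assumes "finite B0" "independent B0"
  shows "\<exists>cs. \<forall>cs'. mset cs' = mset cs \<longrightarrow>
    distinct (concat cs') \<and> independent (set (concat cs')) \<and> span (set (concat cs')) = span B0 \<and>
    gram_mat \<beta> (concat cs') = diag_block_mat (map (gram_mat \<beta>) cs') \<and>
    (\<forall>c\<in>set cs'. c \<noteq> [] \<and> (gram_mat \<beta> c = J_block (length c) \<or> gram_mat \<beta> c = 0\<^sub>m 1 1))"
proof -
  obtain B where B: "partial_permutation_basis B" "span B = span B0"
    using exists_partial_permutation_basis[OF assms] by blast
  have fB: "finite B" and indB: "independent B"
    and B01: "\<And>x y. x \<in> B \<Longrightarrow> y \<in> B \<Longrightarrow> \<beta> x y \<noteq> 0 \<Longrightarrow> \<beta> x y = 1"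
    and Bfun: "\<And>x y z. x \<in> B \<Longrightarrow> y \<in> B \<Longrightarrow> z \<in> B \<Longrightarrow> \<beta> x y \<noteq> 0 \<Longrightarrow> \<beta> x z \<noteq> 0 \<Longrightarrow> y = z"
    and Binj: "\<And>x y z. x \<in> B \<Longrightarrow> y \<in> B \<Longrightarrow> z \<in> B \<Longrightarrow> \<beta> x z \<noteq> 0 \<Longrightarrow> \<beta> y z \<noteq> 0 \<Longrightarrow> x = y"
    using B(1) unfolding partial_permutation_basis_def by blast+
  obtain \<rho> :: "'b \<Rightarrow> nat" where \<rho>: "\<And>x y. x \<in> B \<Longrightarrow> y \<in> B \<Longrightarrow> \<beta> x y \<noteq> 0 \<Longrightarrow> x = y \<or> \<rho> x < \<rho> y"
    using B(1) unfolding partial_permutation_basis_def by blast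
  have dec: "\<exists>S. chain_decomposition (\<lambda>x y. \<beta> x y \<noteq> 0) B S"
    using fB by (rule partial_permutation_chains[where \<rho> = \<rho>]) (use Bfun Binj \<rho> in blast)+
  obtain S where S: "finite S" "\<Union> (set ` S) = B"
    and S1: "\<forall>c\<in>S. c \<noteq> [] \<and> distinct c \<and> ((\<exists>x. c = [x] \<and> \<beta> x x \<noteq> 0) \<or>
       (\<forall>i<length c. \<forall>j<length c. \<beta> (c ! i) (c ! j) \<noteq> 0 \<longleftrightarrow> j = Suc i))"
    and S2: "\<forall>c\<in>S. \<forall>d\<in>S. c \<noteq> d \<longrightarrow> set c \<inter> set d = {} \<and> (\<forall>x\<in>set c. \<forall>y\<in>set d. \<not> \<beta> x y \<noteq> 0)"
    using dec unfolding chain_decomposition_def by (elim exE conjE)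
  have gram: "gram_mat \<beta> c = J_block (length c) \<or> gram_mat \<beta> c = 0\<^sub>m 1 1" if c: "c \<in> S" for c
  proof -
    have cB: "c ! i \<in> B" if "i < length c" for i using S(2) c that by auto
    from S1 c consider x where "c = [x]" "\<beta> x x \<noteq> 0"
      | "\<forall>i<length c. \<forall>j<length c. \<beta> (c ! i) (c ! j) \<noteq> 0 \<longleftrightarrow> j = Suc i" by blast
    then show ?thesis
    proof cases
      case 1
      then have "\<beta> x x = 1" using B01[of x x] cB[of 0] by simp
      then have "gram_mat \<beta> c = J_block (length c)"
        using 1 by (intro eq_matI) (auto simp: gram_mat_def J_block_def)
      then show ?thesis ..
    next
      case 2
      have val: "\<beta> (c ! i) (c ! j) = (if j = Suc i then 1 else 0)" if "i < length c" "j < length c" for i j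
        using 2 B01[OF cB[OF that(1)] cB[OF that(2)]] that by (cases "j = Suc i") auto
      \<comment> \<open>Length 1 is special: here it means a vector without a loop, whose Gram
        matrix is \<open>[0]\<close>, whereas \<open>J_block 1\<close> is
        \<open>[1]\<close>.\<close>
      show ?thesis
      proof (cases "length c = 1")
        case True
        then have "gram_mat \<beta> c = 0\<^sub>m 1 1" using val by (intro eq_matI) (auto simp: gram_mat_def)
        then show ?thesis ..
      next
        case False
        then have "gram_mat \<beta> c = J_block (length c)"
          using val by (intro eq_matI) (auto simp: gram_mat_def J_block_def)
        then show ?thesis ..
      qed
    qed
  qed
  obtain cs0 where cs0: "set cs0 = S" "distinct cs0" using finite_distinct_list[OF S(1)] by blast
  have "distinct (concat cs) \<and> independent (set (concat cs)) \<and> span (set (concat cs)) = span B0 \<and>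
      gram_mat \<beta> (concat cs) = diag_block_mat (map (gram_mat \<beta>) cs) \<and>
      (\<forall>c\<in>set cs. c \<noteq> [] \<and> (gram_mat \<beta> c = J_block (length c) \<or> gram_mat \<beta> c = 0\<^sub>m 1 1))"
    if "mset cs = mset cs0" for cs
  proof -
    have cs: "set cs = S" "distinct cs"
      using that cs0 mset_eq_setD mset_eq_imp_distinct_iff by blast+
    then have "set (concat cs) = B" using S(2) by auto
    moreover have "distinct (concat cs)"
      using S1 S2 cs by (intro distinct_concat) auto
    moreover have "gram_mat \<beta> (concat cs) = diag_block_mat (map (gram_mat \<beta>) cs)"
      using S2 cs by (intro gram_mat_concat) auto
    ultimately show ?thesis using indB B(2) gram S1 cs(1) by auto
  qed
  then show ?thesis by blast
qed

end

section \<open>Frobenius forms and matrices\<close>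

definition frob_cong :: "nat \<Rightarrow> 'a::comm_ring_1 mat \<Rightarrow> 'a mat \<Rightarrow> 'a mat"
  where "frob_cong q M A = transpose_mat (map_mat (\<lambda>x. x ^ q) M) * A * M"

lemma frob_cong_carrier [simp]:
  "M \<in> carrier_mat n n \<Longrightarrow> A \<in> carrier_mat n n \<Longrightarrow> frob_cong q M A \<in> carrier_mat n n"
  by (simp add: frob_cong_def)

lemma frob_cong_index:
  assumes "M \<in> carrier_mat n n" "A \<in> carrier_mat n n" "k < n" "l < n"
  shows "frob_cong q M A $$ (k, l) = (\<Sum>i<n. \<Sum>j<n. M $$ (i, k) ^ q * A $$ (i, j) * M $$ (j, l))"
proof -
  have "frob_cong q M A $$ (k, l) = (\<Sum>i<n. M $$ (i, k) ^ q * (\<Sum>j<n. A $$ (i, j) * M $$ (j, l)))"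
    using assms by (simp add: frob_cong_def scalar_prod_def lessThan_atLeast0)
  then show ?thesis by (simp add: sum_distrib_left mult.assoc)
qed

section \<open>Monomials of Frobenius forms and uniqueness of the representing matrix\<close>

definition frob_monom :: "nat \<Rightarrow> nat \<Rightarrow> nat \<Rightarrow> nat \<Rightarrow>\<^sub>0 nat"
  where "frob_monom q i j = Poly_Mapping.single i q + Poly_Mapping.single j 1"

lemma lookup_frob_monom:
  "Poly_Mapping.lookup (frob_monom q i j) k = (q when i = k) + (1 when j = k)"
  by (simp add: frob_monom_def lookup_add lookup_single)

lemma Const_0 [simp]: "Const 0 = 0"
  by (simp add: Const_def)

lemma Const_add: "Const (a + b) = Const a + Const b"
  by (simp add: Const_def single_add)

lemma Const_mult: "Const (a * b) = Const a * Const b"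
  by (simp add: Const_def mult_single)

lemma Const_power: "Const (a ^ k) = Const a ^ k"
  by (induction k) (simp_all add: Const_mult, simp add: Const_def)

lemma Const_sum: "Const (sum f A) = (\<Sum>i\<in>A. Const (f i))"
  by (induction A rule: infinite_finite_induct) (simp_all add: Const_add)

lemma Var_power: "Var i ^ k = Poly_Mapping.single (Poly_Mapping.single i k) (1 :: 'a::comm_ring_1)"
proof (induction k)
  case (Suc k)
  have "Var i ^ Suc k = Poly_Mapping.single (Poly_Mapping.single i 1 + Poly_Mapping.single i k) (1 :: 'a)"
    by (simp add: Suc) (simp add: Var_def mult_single)
  then show ?case by (simp add: single_add[symmetric])
qed simp

lemma Const_Var_Var:
  "Const c * Var i ^ q * Var j = Poly_Mapping.single (frob_monom q i j) c"
  by (simp add: Var_power) (simp add: Const_def Var_def mult_single frob_monom_def)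

lemma form_of_mat_alt:
  assumes "A \<in> carrier_mat n n"
  shows "form_of_mat q A = (\<Sum>i<n. \<Sum>j<n. Poly_Mapping.single (frob_monom q i j) (A $$ (i, j)))"
  using assms by (simp add: form_of_mat_def flip: Const_Var_Var) (simp add: mult_ac)

text \<open>For q \<ge> 2 the index i is recognized as the one with exponent at least q, since any
  other exponent is at most 1. With q = 1 the two indices could be exchanged, and matrices would not
  be determined by their forms.\<close>

lemma frob_monom_eq_iff:
  assumes "q \<ge> 2"
  shows "frob_monom q i j = frob_monom q i' j' \<longleftrightarrow> i = i' \<and> j = j'"
proof
  assume eq: "frob_monom q i j = frob_monom q i' j'"
  have lk: "(q when i = k) + (1 when j = k) = (q when i' = k) + (1 when j' = k)" for k
    using arg_cong[OF eq, of "\<lambda>m. Poly_Mapping.lookup m k"] by (simp only: lookup_frob_monom)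
  have "i = i'" using lk[of i] assms by (auto simp: when_def split: if_splits)
  moreover from this have "j = j'" using lk[of j] by (auto simp: when_def split: if_splits)
  ultimately show "i = i' \<and> j = j'" ..
qed simp

lemma lookup_form_of_mat:
  assumes "q \<ge> 2" "A \<in> carrier_mat n n" "i < n" "j < n"
  shows "Poly_Mapping.lookup (form_of_mat q A) (frob_monom q i j) = A $$ (i, j)"
proof -
  have "Poly_Mapping.lookup (form_of_mat q A) (frob_monom q i j) =
      (\<Sum>i'<n. \<Sum>j'<n. A $$ (i', j') when frob_monom q i' j' = frob_monom q i j)"
    unfolding form_of_mat_alt[OF assms(2)] lookup_sum lookup_single ..
  also have "\<dots> = (\<Sum>i'<n. \<Sum>j'<n. if j' = j then (if i' = i then A $$ (i', j') else 0) else 0)"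
    unfolding frob_monom_eq_iff[OF assms(1)] when_def by (intro sum.cong) auto
  also have "\<dots> = A $$ (i, j)" using assms by simp
  finally show ?thesis .
qed

lemma keys_form_of_mat:
  assumes "A \<in> carrier_mat n n"
  shows "Poly_Mapping.keys (form_of_mat q A) \<subseteq> {frob_monom q i j | i j. i < n \<and> j < n}"
proof
  fix m assume "m \<in> Poly_Mapping.keys (form_of_mat q A)"
  then have "m \<in> (\<Union>i<n. Poly_Mapping.keys (\<Sum>j<n. Poly_Mapping.single (frob_monom q i j) (A $$ (i, j))))"
    unfolding form_of_mat_alt[OF assms] by (rule subsetD[OF keys_sum])
  then obtain i where i: "i < n" "m \<in> Poly_Mapping.keys (\<Sum>j<n. Poly_Mapping.single (frob_monom q i j) (A $$ (i, j)))" by auto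
  from subsetD[OF keys_sum i(2)] have "m \<in> (\<Union>j<n. Poly_Mapping.keys (Poly_Mapping.single (frob_monom q i j) (A $$ (i, j))))" .
  then show "m \<in> {frob_monom q i j | i j. i < n \<and> j < n}" using i(1) by (auto split: if_splits)
qed

lemma keys_form_of_mat_eq:
  assumes "q \<ge> 2" "A \<in> carrier_mat n n"
  shows "Poly_Mapping.keys (form_of_mat q A) = {frob_monom q i j | i j. i < n \<and> j < n \<and> A $$ (i, j) \<noteq> 0}"
proof -
  have "frob_monom q i j \<in> Poly_Mapping.keys (form_of_mat q A) \<longleftrightarrow> A $$ (i, j) \<noteq> 0" if "i < n" "j < n" for i j
    using lookup_form_of_mat[OF assms that] by (simp add: in_keys_iff)
  then show ?thesis using keys_form_of_mat[OF assms(2), of q] by blast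
qed

lemma form_of_mat_inj:
  assumes "q \<ge> 2" "A \<in> carrier_mat n n" "B \<in> carrier_mat n n" "form_of_mat q A = form_of_mat q B"
  shows "A = B"
proof (rule eq_matI)
  fix i j assume "i < dim_row B" "j < dim_col B"
  then have "i < n" "j < n" using assms(3) by simp_all
  then show "A $$ (i, j) = B $$ (i, j)"
    using lookup_form_of_mat[OF assms(1,2), of i j] lookup_form_of_mat[OF assms(1,3), of i j] assms(4) by simp
qed (use assms in auto)

lemma keys_frob_monom:
  assumes "q > 0"
  shows "Poly_Mapping.keys (frob_monom q i j) = {i, j}"
proof -
  have "k \<in> Poly_Mapping.keys (frob_monom q i j) \<longleftrightarrow> k = i \<or> k = j" for k
    using assms by (simp add: in_keys_iff lookup_frob_monom when_def)
  then show ?thesis by blast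
qed

lemma vars_form_of_mat:
  assumes "q \<ge> 2" "A \<in> carrier_mat n n"
  shows "vars (form_of_mat q A) = {i. i < n \<and> (\<exists>j<n. A $$ (i, j) \<noteq> 0 \<or> A $$ (j, i) \<noteq> 0)}"
proof -
  have "vars (form_of_mat q A) = (\<Union>m\<in>{frob_monom q i j | i j. i < n \<and> j < n \<and> A $$ (i, j) \<noteq> 0}. Poly_Mapping.keys m)"
    unfolding vars_def keys_form_of_mat_eq[OF assms] ..
  also have "\<dots> = (\<Union>i<n. \<Union>j\<in>{j. j < n \<and> A $$ (i, j) \<noteq> 0}. Poly_Mapping.keys (frob_monom q i j))"
    by blast
  also have "\<dots> = (\<Union>i<n. \<Union>j\<in>{j. j < n \<and> A $$ (i, j) \<noteq> 0}. {i, j})"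
    using assms(1) by (simp add: keys_frob_monom)
  also have "\<dots> = {i. i < n \<and> (\<exists>j<n. A $$ (i, j) \<noteq> 0 \<or> A $$ (j, i) \<noteq> 0)}"
    by auto
  finally show ?thesis .
qed

section \<open>Degrees, and Frobenius forms as forms of matrices\<close>

lemma monom_degree_superset:
  assumes "finite S" "Poly_Mapping.keys m \<subseteq> S"
  shows "monom_degree m = (\<Sum>i\<in>S. Poly_Mapping.lookup m i)"
  unfolding monom_degree_def using assms
  by (intro sum.mono_neutral_left) (auto simp: in_keys_iff)

lemma monom_degree_add: "monom_degree (a + b) = monom_degree a + monom_degree b"
proof -
  have "monom_degree (a + b) = (\<Sum>i\<in>Poly_Mapping.keys a \<union> Poly_Mapping.keys b. Poly_Mapping.lookup (a + b) i)"
    by (rule monom_degree_superset) (simp_all add: keys_add)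
  then show ?thesis
    by (simp add: lookup_add sum.distrib monom_degree_superset[of "Poly_Mapping.keys a \<union> Poly_Mapping.keys b"])
qed

lemma monom_degree_single [simp]: "monom_degree (Poly_Mapping.single i k) = k"
  by (simp add: monom_degree_superset[of "{i}"])

lemma monom_degree_1:
  assumes "monom_degree a = 1"
  shows "\<exists>j\<in>Poly_Mapping.keys a. a = Poly_Mapping.single j 1"
proof -
  have "\<exists>j\<in>Poly_Mapping.keys a. Poly_Mapping.lookup a j = 1 \<and> (\<forall>k\<in>Poly_Mapping.keys a. j \<noteq> k \<longrightarrow> Poly_Mapping.lookup a k = 0)"
    using assms unfolding monom_degree_def by (subst (asm) sum_eq_1_iff) auto
  then obtain j where j: "j \<in> Poly_Mapping.keys a" "Poly_Mapping.lookup a j = 1" "\<And>k. k \<in> Poly_Mapping.keys a \<Longrightarrow> j \<noteq> k \<Longrightarrow> Poly_Mapping.lookup a k = 0"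
    by blast
  have "a = Poly_Mapping.single j 1"
  proof (rule poly_mapping_eqI)
    fix k show "Poly_Mapping.lookup a k = Poly_Mapping.lookup (Poly_Mapping.single j 1) k"
      using j by (cases "k = j") (auto simp: lookup_single when_def in_keys_iff)
  qed
  then show ?thesis using j(1) by blast
qed

lemma frobenius_form_form_of_mat:
  assumes "q \<ge> 2" "A \<in> carrier_mat n n"
  shows "frobenius_form n q (form_of_mat q A)"
proof -
  have "form_of_mat q A \<in> poly_ring n"
    using vars_form_of_mat[OF assms] by (auto simp: poly_ring_def)
  moreover have "homogeneous (q + 1) (form_of_mat q A)"
    using keys_form_of_mat[OF assms(2), of q] by (auto simp: homogeneous_def monom_degree_add frob_monom_def)
  moreover have "form_of_mat q A \<in> power_ideal n q"
  proof -
    define g where "g i = (\<Sum>j<n. Const (A $$ (i, j)) * Var j)" for i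
    have "form_of_mat q A = (\<Sum>i<n. g i * Var i ^ q)"
      using assms(2) by (simp add: form_of_mat_def g_def sum_distrib_left mult_ac)
    moreover have "g i \<in> poly_ring n" for i
    proof -
      have "g i = (\<Sum>j<n. Poly_Mapping.single (Poly_Mapping.single j 1) (A $$ (i, j)))"
        by (simp add: g_def Const_def Var_def mult_single)
      then have "Poly_Mapping.keys (g i) \<subseteq> (\<Union>j<n. Poly_Mapping.keys (Poly_Mapping.single (Poly_Mapping.single j (1::nat)) (A $$ (i, j))))"
        using keys_sum by metis
      then have "Poly_Mapping.keys (g i) \<subseteq> (\<lambda>j. Poly_Mapping.single j 1) ` {..<n}"
        by (force split: if_splits)
      then show ?thesis by (fastforce simp: poly_ring_def vars_def)
    qed
    ultimately show ?thesis by (auto simp: power_ideal_def)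
  qed
  ultimately show ?thesis by (simp add: frobenius_form_def)
qed

text \<open>The cofactors \<open>g i\<close> need not be linear. But a monomial surviving in
  \<open>h\<close> has degree q + 1 and comes from some \<open>g i * Var i ^ q\<close>, so the
  factor contributed by \<open>g i\<close> has degree 1 and is a variable.\<close>

lemma frobenius_form_imp_form_of_mat:
  fixes h :: "'a::comm_ring_1 mpoly"
  assumes "q \<ge> 2" "frobenius_form n q h"
  shows "\<exists>A\<in>carrier_mat n n. h = form_of_mat q A"
proof -
  obtain g where g: "h = (\<Sum>i<n. g i * Var i ^ q)" "\<And>i. i < n \<Longrightarrow> g i \<in> poly_ring n"
    using assms(2) by (auto simp: frobenius_form_def power_ideal_def)
  have keys_h: "Poly_Mapping.keys h \<subseteq> {frob_monom q i j | i j. i < n \<and> j < n}"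
  proof
    fix m assume m: "m \<in> Poly_Mapping.keys h"
    then have "m \<in> (\<Union>i<n. Poly_Mapping.keys (g i * Var i ^ q))" unfolding g(1) by (rule subsetD[OF keys_sum])
    then obtain i where i: "i < n" and mem: "m \<in> Poly_Mapping.keys (g i * Poly_Mapping.single (Poly_Mapping.single i q) 1)"
      by (auto simp: Var_power)
    from subsetD[OF keys_mult mem] have "m \<in> {a + b | a b. a \<in> Poly_Mapping.keys (g i) \<and>
        b \<in> Poly_Mapping.keys (Poly_Mapping.single (Poly_Mapping.single i q) (1 :: 'a))}" .
    then obtain a where a: "a \<in> Poly_Mapping.keys (g i)" "m = a + Poly_Mapping.single i q" by auto
    have "monom_degree m = q + 1" using assms(2) m by (simp add: frobenius_form_def homogeneous_def)
    then have "monom_degree a = 1" by (simp add: a monom_degree_add)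
    then obtain j where j: "j \<in> Poly_Mapping.keys a" "a = Poly_Mapping.single j 1" using monom_degree_1 by blast
    have "j < n" using g(2)[OF i] a(1) j(1) by (auto simp: poly_ring_def vars_def)
    then show "m \<in> {frob_monom q i j | i j. i < n \<and> j < n}" using a(2) j(2) i by (auto simp: frob_monom_def add.commute)
  qed
  define A where "A = mat n n (\<lambda>(i, j). Poly_Mapping.lookup h (frob_monom q i j))"
  have A: "A \<in> carrier_mat n n" by (simp add: A_def)
  have "h = form_of_mat q A"
  proof (rule poly_mapping_eqI)
    fix m
    show "Poly_Mapping.lookup h m = Poly_Mapping.lookup (form_of_mat q A) m"
    proof (cases "m \<in> {frob_monom q i j | i j. i < n \<and> j < n}")
      case True
      then obtain i j where ij: "i < n" "j < n" "m = frob_monom q i j" by blast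
      show ?thesis unfolding ij(3) lookup_form_of_mat[OF assms(1) A ij(1,2)] using ij by (simp add: A_def)
    next
      case False
      then have "m \<notin> Poly_Mapping.keys h" "m \<notin> Poly_Mapping.keys (form_of_mat q A)"
        using keys_h keys_form_of_mat[OF A, of q] by blast+
      then show ?thesis by (simp add: in_keys_iff)
    qed
  qed
  then show ?thesis using A by blast
qed

section \<open>Linear substitution in Frobenius forms\<close>

lemma subst_superset:
  assumes "finite S" "Poly_Mapping.keys f \<subseteq> S"
  shows "subst \<sigma> f = (\<Sum>m\<in>S. Const (Poly_Mapping.lookup f m) * (\<Prod>i\<in>Poly_Mapping.keys m. \<sigma> i ^ Poly_Mapping.lookup m i))"
  unfolding subst_def using assms
  by (intro sum.mono_neutral_left) (auto simp: in_keys_iff)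

lemma subst_add: "subst \<sigma> (f + g) = subst \<sigma> f + subst \<sigma> g"
proof -
  have "subst \<sigma> (f + g) = (\<Sum>m\<in>Poly_Mapping.keys f \<union> Poly_Mapping.keys g. Const (Poly_Mapping.lookup (f + g) m) * (\<Prod>i\<in>Poly_Mapping.keys m. \<sigma> i ^ Poly_Mapping.lookup m i))"
    by (rule subst_superset) (simp_all add: keys_add)
  then show ?thesis
    by (simp add: lookup_add Const_add distrib_right sum.distrib subst_superset[of "Poly_Mapping.keys f \<union> Poly_Mapping.keys g"])
qed

lemma subst_sum: "subst \<sigma> (sum f A) = (\<Sum>i\<in>A. subst \<sigma> (f i))"
  by (induction A rule: infinite_finite_induct) (simp_all add: subst_add, simp_all add: subst_def)

lemma subst_frob_monom:
  assumes "q > 0"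
  shows "subst \<sigma> (Poly_Mapping.single (frob_monom q i j) c) = Const c * \<sigma> i ^ q * \<sigma> j"
proof -
  have "subst \<sigma> (Poly_Mapping.single (frob_monom q i j) c) =
      Const c * (\<Prod>k\<in>{i, j}. \<sigma> k ^ Poly_Mapping.lookup (frob_monom q i j) k)"
    by (subst subst_superset[of "{frob_monom q i j}"]) (auto simp: keys_frob_monom[OF assms])
  also have "(\<Prod>k\<in>{i, j}. \<sigma> k ^ Poly_Mapping.lookup (frob_monom q i j) k) = \<sigma> i ^ q * \<sigma> j"
    by (cases "i = j") (auto simp: lookup_frob_monom when_def)
  finally show ?thesis by (simp add: mult.assoc)
qed

lemma sum_swap_pairs:
  fixes t :: "nat \<Rightarrow> nat \<Rightarrow> nat \<Rightarrow> nat \<Rightarrow> 'b::comm_monoid_add"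
  shows "(\<Sum>i<n. \<Sum>j<n. \<Sum>k<n. \<Sum>l<n. t i j k l) = (\<Sum>k<n. \<Sum>l<n. \<Sum>i<n. \<Sum>j<n. t i j k l)"
proof -
  have "(\<Sum>i<n. \<Sum>j<n. \<Sum>k<n. \<Sum>l<n. t i j k l) = (\<Sum>i<n. \<Sum>k<n. \<Sum>j<n. \<Sum>l<n. t i j k l)"
    by (intro sum.cong refl sum.swap)
  also have "\<dots> = (\<Sum>k<n. \<Sum>i<n. \<Sum>j<n. \<Sum>l<n. t i j k l)" by (rule sum.swap)
  also have "\<dots> = (\<Sum>k<n. \<Sum>i<n. \<Sum>l<n. \<Sum>j<n. t i j k l)"
    by (intro sum.cong refl sum.swap)
  also have "\<dots> = (\<Sum>k<n. \<Sum>l<n. \<Sum>i<n. \<Sum>j<n. t i j k l)"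
    by (intro sum.cong refl sum.swap)
  finally show ?thesis .
qed

text \<open>Allows the additivity of the q-th power to be used for linear forms, that is, inside the
  polynomial ring.\<close>

lemma CHAR_mpoly: "CHAR('a::comm_ring_1 mpoly) = CHAR('a)"
proof (rule CHAR_eqI)
  show "of_nat CHAR('a) = (0 :: 'a mpoly)" by (simp flip: single_of_nat)
  fix k assume "of_nat k = (0 :: 'a mpoly)"
  then have "Poly_Mapping.lookup (of_nat k :: 'a mpoly) 0 = 0" by simp
  then show "CHAR('a) dvd k" by (simp add: lookup_of_nat of_nat_eq_0_iff_char_dvd)
qed

text \<open>Since q is a power of the characteristic, the q-th power of a linear form has no mixed
  terms: its coefficients and its variables are raised to the power q separately.\<close>

lemma lin_subst_form_of_mat:
  fixes A M :: "'a::comm_ring_1 mat"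
  assumes "prime CHAR('a)" "q = CHAR('a) ^ e" and A: "A \<in> carrier_mat n n" and M: "M \<in> carrier_mat n n"
  shows "lin_subst M (form_of_mat q A) = form_of_mat q (frob_cong q M A)"
proof -
  have q: "q > 0" using assms(1,2) prime_gt_0_nat by simp
  have frob: "(\<Sum>j<n. f j :: 'a mpoly) ^ q = (\<Sum>j<n. f j ^ q)" for f
    using assms(1,2) by (intro freshmans_dream_sum'[of q e]) (simp_all add: CHAR_mpoly)
  define \<sigma> where "\<sigma> = (\<lambda>i. \<Sum>j<n. Const (M $$ (i, j)) * Var j)"
  have "lin_subst M (form_of_mat q A) = subst \<sigma> (form_of_mat q A)"
    using M by (simp add: lin_subst_def \<sigma>_def)
  also have "\<dots> = (\<Sum>i<n. \<Sum>j<n. Const (A $$ (i, j)) * \<sigma> i ^ q * \<sigma> j)"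
    unfolding form_of_mat_alt[OF A] subst_sum subst_frob_monom[OF q] ..
  also have "\<dots> = (\<Sum>i<n. \<Sum>j<n. \<Sum>k<n. \<Sum>l<n.
      Const (M $$ (i, k) ^ q * A $$ (i, j) * M $$ (j, l)) * Var k ^ q * Var l)"
    unfolding \<sigma>_def frob
    by (simp add: sum_distrib_left sum_distrib_right Const_mult Const_power power_mult_distrib mult_ac)
  also have "\<dots> = (\<Sum>k<n. \<Sum>l<n. \<Sum>i<n. \<Sum>j<n.
      Const (M $$ (i, k) ^ q * A $$ (i, j) * M $$ (j, l)) * Var k ^ q * Var l)"
    by (rule sum_swap_pairs)
  also have "\<dots> = (\<Sum>k<n. \<Sum>l<n. Const (frob_cong q M A $$ (k, l)) * Var k ^ q * Var l)"
    by (intro sum.cong refl) (simp add: frob_cong_index[OF M A] Const_sum sum_distrib_right)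
  also have "\<dots> = form_of_mat q (frob_cong q M A)"
    using A M by (simp add: form_of_mat_alt[OF frob_cong_carrier] Const_Var_Var)
  finally show ?thesis .
qed

text \<open>Fewer than n variables occur exactly if some variable is missing, and a variable is
  missing exactly if both the row and the column with its index vanish.\<close>

lemma nondegenerate_form_of_mat_iff:
  fixes A :: "'a::comm_ring_1 mat"
  assumes "prime CHAR('a)" "q = CHAR('a) ^ e" "e > 0" and A: "A \<in> carrier_mat n n"
  shows "nondegenerate n (form_of_mat q A) \<longleftrightarrow>
    (\<forall>M\<in>carrier_mat n n. invertible_mat M \<longrightarrow>
       (\<forall>i<n. \<exists>j<n. frob_cong q M A $$ (i, j) \<noteq> 0 \<or> frob_cong q M A $$ (j, i) \<noteq> 0))"
proof -
  have q: "q \<ge> 2"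
    using prime_ge_2_nat[OF assms(1)] assms(2,3) self_le_power[of "CHAR('a)" e] by linarith
  have "card (vars (lin_subst M (form_of_mat q A))) < n \<longleftrightarrow>
      \<not> (\<forall>i<n. \<exists>j<n. frob_cong q M A $$ (i, j) \<noteq> 0 \<or> frob_cong q M A $$ (j, i) \<noteq> 0)"
    if M: "M \<in> carrier_mat n n" for M
  proof -
    define S where "S = vars (lin_subst M (form_of_mat q A))"
    have S: "S = {i. i < n \<and> (\<exists>j<n. frob_cong q M A $$ (i, j) \<noteq> 0 \<or> frob_cong q M A $$ (j, i) \<noteq> 0)}"
      unfolding S_def lin_subst_form_of_mat[OF assms(1,2) A M]
      by (rule vars_form_of_mat[OF q frob_cong_carrier[OF M A]])
    then have sub: "S \<subseteq> {..<n}" by auto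
    then have "card S < n \<longleftrightarrow> S \<noteq> {..<n}"
      using card_subset_eq[OF _ sub] card_mono[OF _ sub] by (auto simp: le_less)
    then show ?thesis unfolding S_def[symmetric] using S by auto
  qed
  then show ?thesis unfolding nondegenerate_def by blast
qed

section \<open>Congruence and invariants of block diagonal matrices\<close>

lemma frob_cong_one [simp]:
  assumes "A \<in> carrier_mat n n" "q > 0"
  shows "frob_cong q (1\<^sub>m n) A = A"
proof -
  have "map_mat (\<lambda>x. x ^ q) (1\<^sub>m n) = (1\<^sub>m n :: 'a mat)"
    using assms(2) by (intro eq_matI) (auto simp: power_0_left)
  then show ?thesis using assms(1) by (simp add: frob_cong_def)
qed

text \<open>Raising to the power q is a ring homomorphism here, hence multiplicative on matrices.
  Congruence is a right action: the change of coordinates made first is the left factor.\<close>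

lemma frob_cong_mult:
  fixes A M N :: "'a::comm_ring_1 mat"
  assumes "prime CHAR('a)" "q = CHAR('a) ^ e"
    and "A \<in> carrier_mat n n" "M \<in> carrier_mat n n" "N \<in> carrier_mat n n"
  shows "frob_cong q N (frob_cong q M A) = frob_cong q (M * N) A"
proof -
  have "map_mat (\<lambda>x. x ^ q) (M * N) = map_mat (\<lambda>x. x ^ q) M * map_mat (\<lambda>x. x ^ q) N"
    using assms(3-5)
    by (intro eq_matI) (auto simp: scalar_prod_def freshmans_dream_sum'[OF assms(1,2)] power_mult_distrib)
  then have "transpose_mat (map_mat (\<lambda>x. x ^ q) (M * N)) =
      transpose_mat (map_mat (\<lambda>x. x ^ q) N) * transpose_mat (map_mat (\<lambda>x. x ^ q) M)"
    using assms(3-5) by (simp add: transpose_mult[where n = n])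
  then show ?thesis
    using assms(3-5)
    by (simp add: frob_cong_def assoc_mult_mat[where n\<^sub>2 = n and n\<^sub>3 = n and n\<^sub>4 = n] mult_carrier_mat[where n = n])
qed

lemma invertible_mat_obtain_inverse:
  assumes "M \<in> carrier_mat n n" "invertible_mat M"
  obtains N where "N \<in> carrier_mat n n" "M * N = 1\<^sub>m n" "N * M = 1\<^sub>m n" "invertible_mat N"
proof -
  obtain N where N: "inverts_mat M N" "inverts_mat N M"
    using assms(2) by (auto simp: invertible_mat_def)
  have MN: "M * N = 1\<^sub>m n" using N(1) assms(1) by (simp add: inverts_mat_def)
  then have "dim_col N = n" by (metis index_mult_mat(3) index_one_mat(3))
  moreover have NM: "N * M = 1\<^sub>m (dim_row N)" using N(2) by (simp add: inverts_mat_def)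
  then have "dim_row N = n" using assms(1) by (metis carrier_matD(2) index_mult_mat(3) index_one_mat(3))
  ultimately have c: "N \<in> carrier_mat n n" by auto
  moreover have "invertible_mat N"
    using N c by (auto simp: invertible_mat_def)
  ultimately show ?thesis using that MN NM by auto
qed

lemma invertible_matI:
  assumes "M \<in> carrier_mat n n" "N \<in> carrier_mat n n" "M * N = 1\<^sub>m n" "N * M = 1\<^sub>m n"
  shows "invertible_mat M"
  using assms by (auto simp: invertible_mat_def inverts_mat_def)

lemma invertible_mat_mult:
  fixes M N :: "'a::comm_ring_1 mat"
  assumes "M \<in> carrier_mat n n" "N \<in> carrier_mat n n" "invertible_mat M" "invertible_mat N"
  shows "invertible_mat (M * N)"
proof -
  obtain M' where M': "M' \<in> carrier_mat n n" "M * M' = 1\<^sub>m n" "M' * M = 1\<^sub>m n"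
    using invertible_mat_obtain_inverse[OF assms(1,3)] by blast
  obtain N' where N': "N' \<in> carrier_mat n n" "N * N' = 1\<^sub>m n" "N' * N = 1\<^sub>m n"
    using invertible_mat_obtain_inverse[OF assms(2,4)] by blast
  have "N * (N' * M') = N * N' * M'" using assms(2) N' M' by (intro assoc_mult_mat[symmetric]) auto
  moreover have "M * N * (N' * M') = M * (N * (N' * M'))" using assms N' M' by (intro assoc_mult_mat) auto
  ultimately have 1: "M * N * (N' * M') = 1\<^sub>m n" using M' N' by simp
  have "M' * (M * N) = M' * M * N" using assms M' by (intro assoc_mult_mat[symmetric]) auto
  moreover have "N' * M' * (M * N) = N' * (M' * (M * N))" using assms N' M' by (intro assoc_mult_mat) auto
  ultimately have 2: "N' * M' * (M * N) = 1\<^sub>m n" using assms M' N' by simp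
  show ?thesis
    by (rule invertible_matI[OF _ _ 1 2]) (use assms M' N' in auto)
qed

definition frob_congruent :: "nat \<Rightarrow> nat \<Rightarrow> 'a::comm_ring_1 mat \<Rightarrow> 'a mat \<Rightarrow> bool"
  where "frob_congruent q n A B \<longleftrightarrow> (\<exists>M\<in>carrier_mat n n. invertible_mat M \<and> B = frob_cong q M A)"

lemma frob_congruent_refl:
  "A \<in> carrier_mat n n \<Longrightarrow> q > 0 \<Longrightarrow> frob_congruent q n A A"
  using invertible_matI[of "1\<^sub>m n" n "1\<^sub>m n"] frob_cong_one[of A n q]
  unfolding frob_congruent_def by (metis left_mult_one_mat one_carrier_mat)

lemma frob_congruent_sym:
  fixes A B :: "'a::comm_ring_1 mat"
  assumes "prime CHAR('a)" "q = CHAR('a) ^ e" "A \<in> carrier_mat n n" "frob_congruent q n A B"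
  shows "frob_congruent q n B A"
proof -
  obtain M where M: "M \<in> carrier_mat n n" "invertible_mat M" "B = frob_cong q M A"
    using assms(4) by (auto simp: frob_congruent_def)
  obtain N where N: "N \<in> carrier_mat n n" "M * N = 1\<^sub>m n" "invertible_mat N"
    using invertible_mat_obtain_inverse[OF M(1,2)] by blast
  have "q > 0" using assms(1,2) prime_gt_0_nat by simp
  then have "frob_cong q N B = A"
    using N assms(3) by (simp add: M(3) frob_cong_mult[OF assms(1-3) M(1) N(1)])
  then show ?thesis using N by (auto simp: frob_congruent_def)
qed

lemma frob_congruent_trans:
  fixes A B C :: "'a::comm_ring_1 mat"
  assumes "prime CHAR('a)" "q = CHAR('a) ^ e" "A \<in> carrier_mat n n"
    and "frob_congruent q n A B" "frob_congruent q n B C"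
  shows "frob_congruent q n A C"
proof -
  obtain M where M: "M \<in> carrier_mat n n" "invertible_mat M" "B = frob_cong q M A"
    using assms(4) by (auto simp: frob_congruent_def)
  obtain N where N: "N \<in> carrier_mat n n" "invertible_mat N" "C = frob_cong q N B"
    using assms(5) by (auto simp: frob_congruent_def)
  have "C = frob_cong q (M * N) A" by (simp add: M(3) N(3) frob_cong_mult[OF assms(1-3) M(1) N(1)])
  then show ?thesis using M N invertible_mat_mult[of M n N] unfolding frob_congruent_def
    by (intro bexI[of _ "M * N"]) auto
qed

text \<open>What the later arguments use of a sum of blocks \<open>J_block s\<close>, in a form that
  passes to block sums. The first two clauses make the orthogonals of coordinate subspaces
  coordinate subspaces; the third excludes a block \<open>[0]\<close>.\<close>

definition partial_permutation_mat :: "'a::zero mat \<Rightarrow> bool"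
  where "partial_permutation_mat A \<longleftrightarrow>
    (\<forall>i<dim_row A. \<forall>j<dim_row A. \<forall>k<dim_row A. A $$ (i, j) \<noteq> 0 \<longrightarrow> A $$ (i, k) \<noteq> 0 \<longrightarrow> j = k) \<and>
    (\<forall>i<dim_row A. \<forall>j<dim_row A. \<forall>k<dim_row A. A $$ (i, k) \<noteq> 0 \<longrightarrow> A $$ (j, k) \<noteq> 0 \<longrightarrow> i = j) \<and>
    (\<forall>i<dim_row A. \<exists>j<dim_row A. A $$ (i, j) \<noteq> 0 \<or> A $$ (j, i) \<noteq> 0)"

lemma partial_permutation_mat_row:
  assumes "partial_permutation_mat A" "i < dim_row A" "j < dim_row A" "k < dim_row A"
    and "A $$ (i, j) \<noteq> 0" "A $$ (i, k) \<noteq> 0"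
  shows "j = k"
  using assms unfolding partial_permutation_mat_def by meson

lemma partial_permutation_mat_col:
  assumes "partial_permutation_mat A" "i < dim_row A" "j < dim_row A" "k < dim_row A"
    and "A $$ (i, k) \<noteq> 0" "A $$ (j, k) \<noteq> 0"
  shows "i = j"
  using assms unfolding partial_permutation_mat_def by meson

lemma partial_permutation_mat_nonzero:
  assumes "partial_permutation_mat A" "i < dim_row A"
  shows "\<exists>j<dim_row A. A $$ (i, j) \<noteq> 0 \<or> A $$ (j, i) \<noteq> 0"
  using assms unfolding partial_permutation_mat_def by meson

lemma J_block_carrier [simp]: "J_block s \<in> carrier_mat s s"
  by (simp add: J_block_def)

lemma dim_J_block [simp]: "dim_row (J_block s) = s" "dim_col (J_block s) = s"
  by (simp_all add: J_block_def)

lemma J_block_index: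
  "s \<noteq> 1 \<Longrightarrow> i < s \<Longrightarrow> j < s \<Longrightarrow> J_block s $$ (i, j) = (if j = Suc i then 1 else 0)"
  by (simp add: J_block_def)

lemma partial_permutation_mat_J_block:
  "partial_permutation_mat (J_block s :: 'a::comm_ring_1 mat)"
proof (cases "s = 1")
  case True
  then show ?thesis by (simp add: partial_permutation_mat_def J_block_def)
next
  case False
  have "\<exists>j<s. J_block s $$ (i, j) \<noteq> (0 :: 'a) \<or> J_block s $$ (j, i) \<noteq> (0 :: 'a)" if "i < s" for i
  proof (cases i)
    case 0
    then show ?thesis using that False by (intro exI[of _ 1]) (auto simp: J_block_index)
  next
    case (Suc j)
    then show ?thesis using that False by (intro exI[of _ j]) (auto simp: J_block_index)
  qed
  then show ?thesis using False
    by (auto simp: partial_permutation_mat_def J_block_index split: if_splits)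
qed

lemma diag_block_mat_carrier:
  assumes "\<And>A. A \<in> set As \<Longrightarrow> dim_col A = dim_row A"
  shows "diag_block_mat As \<in> carrier_mat (sum_list (map dim_row As)) (sum_list (map dim_row As))"
proof -
  have "map dim_col As = map dim_row As" by (rule map_cong) (simp_all add: assms)
  then show ?thesis by (intro carrier_matI) (simp_all only: dim_diag_block_mat)
qed

lemma partial_permutation_mat_four_block:
  assumes A: "A \<in> carrier_mat a a" "partial_permutation_mat A"
    and B: "B \<in> carrier_mat b b" "partial_permutation_mat B"
  shows "partial_permutation_mat (four_block_mat A (0\<^sub>m a b) (0\<^sub>m b a) B)"
proof -
  let ?F = "four_block_mat A (0\<^sub>m a b) (0\<^sub>m b a) B"
  have F: "?F $$ (i, j) = (if i < a then if j < a then A $$ (i, j) else 0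
      else if j < a then 0 else B $$ (i - a, j - a))" if "i < a + b" "j < a + b" for i j
    using that A B by auto
  have dF: "dim_row ?F = a + b" using A B by simp
  have 1: "j = k" if "i < a + b" "j < a + b" "k < a + b" "?F $$ (i, j) \<noteq> 0" "?F $$ (i, k) \<noteq> 0" for i j k
  proof (cases "i < a")
    case True
    then have "j < a" "k < a" "A $$ (i, j) \<noteq> 0" "A $$ (i, k) \<noteq> 0"
      using that F by (auto split: if_splits)
    then show ?thesis using A True partial_permutation_mat_row[OF A(2), of i j k] by simp
  next
    case False
    then have "\<not> j < a" "\<not> k < a" "B $$ (i - a, j - a) \<noteq> 0" "B $$ (i - a, k - a) \<noteq> 0"
      using that F by (auto split: if_splits)
    moreover from this have "i - a < b" "j - a < b" "k - a < b" using that False by auto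
    ultimately have "j - a = k - a"
      using B partial_permutation_mat_row[OF B(2), of "i - a" "j - a" "k - a"] by simp
    then show ?thesis using \<open>\<not> j < a\<close> \<open>\<not> k < a\<close> by simp
  qed
  have 2: "i = j" if "i < a + b" "j < a + b" "k < a + b" "?F $$ (i, k) \<noteq> 0" "?F $$ (j, k) \<noteq> 0" for i j k
  proof (cases "k < a")
    case True
    then have "i < a" "j < a" "A $$ (i, k) \<noteq> 0" "A $$ (j, k) \<noteq> 0"
      using that F by (auto split: if_splits)
    then show ?thesis using A True partial_permutation_mat_col[OF A(2), of i j k] by simp
  next
    case False
    then have "\<not> i < a" "\<not> j < a" "B $$ (i - a, k - a) \<noteq> 0" "B $$ (j - a, k - a) \<noteq> 0"
      using that F by (auto split: if_splits)
    moreover from this have "i - a < b" "j - a < b" "k - a < b" using that False by auto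
    ultimately have "i - a = j - a"
      using B partial_permutation_mat_col[OF B(2), of "i - a" "j - a" "k - a"] by simp
    then show ?thesis using \<open>\<not> i < a\<close> \<open>\<not> j < a\<close> by simp
  qed
  have 3: "\<exists>j<a + b. ?F $$ (i, j) \<noteq> 0 \<or> ?F $$ (j, i) \<noteq> 0" if i: "i < a + b" for i
  proof (cases "i < a")
    case True
    then obtain j where "j < a" "A $$ (i, j) \<noteq> 0 \<or> A $$ (j, i) \<noteq> 0"
      using A partial_permutation_mat_nonzero[OF A(2), of i] by auto
    then show ?thesis using True F by (intro exI[of _ j]) auto
  next
    case False
    then have "i - a < b" using i by auto
    then obtain j where "j < b" "B $$ (i - a, j) \<noteq> 0 \<or> B $$ (j, i - a) \<noteq> 0"
      using B partial_permutation_mat_nonzero[OF B(2), of "i - a"] by auto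
    then show ?thesis using False F i by (intro exI[of _ "j + a"]) auto
  qed
  show ?thesis unfolding partial_permutation_mat_def dF using 1 2 3 by blast
qed

lemma diag_J_blocks_carrier:
  "(diag_block_mat (map J_block ss) :: 'a::comm_ring_1 mat) \<in> carrier_mat (sum_list ss) (sum_list ss)"
proof -
  have "dim_col A = dim_row A" if "A \<in> set (map J_block ss)" for A :: "'a mat"
    using that by auto
  from diag_block_mat_carrier[of "map J_block ss :: 'a mat list", OF this] show ?thesis
    by (simp add: o_def)
qed

lemma dim_diag_J_blocks:
  "dim_row (diag_block_mat (map J_block ss) :: 'a::comm_ring_1 mat) = sum_list ss"
  "dim_col (diag_block_mat (map J_block ss) :: 'a::comm_ring_1 mat) = sum_list ss"
  using carrier_matD[OF diag_J_blocks_carrier[of ss, where 'a = 'a]] by auto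

lemma diag_J_blocks_Cons:
  "(diag_block_mat (map J_block (s # ss)) :: 'a::comm_ring_1 mat) =
    four_block_mat (J_block s) (0\<^sub>m s (sum_list ss)) (0\<^sub>m (sum_list ss) s) (diag_block_mat (map J_block ss))"
  by (simp only: list.map diag_block_mat.simps Let_def dim_J_block dim_diag_J_blocks)

lemma partial_permutation_mat_diag_J_blocks:
  "partial_permutation_mat (diag_block_mat (map J_block ss) :: 'a::comm_ring_1 mat)"
proof (induction ss)
  case (Cons s ss)
  show ?case
    by (subst diag_J_blocks_Cons) (rule partial_permutation_mat_four_block[OF J_block_carrier partial_permutation_mat_J_block
          diag_J_blocks_carrier Cons])
qed (simp add: partial_permutation_mat_def)

text \<open>If row and column i of the transformed matrix vanish, column i of \<open>M\<close> lies
  in both radicals of \<open>D\<close>. Every index l has a nonzero entry of \<open>D\<close> in its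
  column or its row, alone in its other line, so one of the two radical conditions makes entry l of
  that column 0. A zero column contradicts invertibility.\<close>

lemma frob_cong_partial_permutation_nonzero:
  fixes D :: "'a::field mat"
  assumes char: "prime CHAR('a)" "q = CHAR('a) ^ e"
    and D: "D \<in> carrier_mat n n" "partial_permutation_mat D"
    and M: "M \<in> carrier_mat n n" "invertible_mat M" and i: "i < n"
  shows "\<exists>j<n. frob_cong q M D $$ (i, j) \<noteq> 0 \<or> frob_cong q M D $$ (j, i) \<noteq> 0"
proof (rule ccontr)
  assume neg: "\<not> ?thesis"
  have q: "q > 0" using char prime_gt_0_nat by simp
  define A where "A = frob_cong q M D"
  define P where "P = transpose_mat (map_mat (\<lambda>x. x ^ q) M)"
  obtain N where N: "N \<in> carrier_mat n n" "M * N = 1\<^sub>m n" "N * M = 1\<^sub>m n"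
    using invertible_mat_obtain_inverse[OF M] by blast
  define R where "R = transpose_mat (map_mat (\<lambda>x. x ^ q) N)"
  have P: "P \<in> carrier_mat n n" and R: "R \<in> carrier_mat n n" and A: "A \<in> carrier_mat n n"
    using M N D by (simp_all add: P_def R_def A_def)
  have A0: "A $$ (i, j) = 0" "A $$ (j, i) = 0" if "j < n" for j
    using neg that by (auto simp: A_def)
  have "D = frob_cong q N A"
    unfolding A_def frob_cong_mult[OF char D(1) M(1) N(1)] using N(2) D(1) q by simp
  then have "D * M = R * A * N * M" by (simp add: frob_cong_def R_def)
  also have "\<dots> = R * A * (N * M)" using R A N M by (intro assoc_mult_mat) auto
  finally have DM: "D * M = R * A" using R A N by simp
  have "A * N = P * D * M * N" by (simp add: A_def frob_cong_def P_def)
  also have "\<dots> = P * D * (M * N)" using P D N M by (intro assoc_mult_mat) auto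
  finally have PD: "P * D = A * N" using P D N by simp
  have col: "(\<Sum>l<n. D $$ (k, l) * M $$ (l, i)) = 0" if k: "k < n" for k
  proof -
    have "(\<Sum>l<n. D $$ (k, l) * M $$ (l, i)) = (D * M) $$ (k, i)"
      using D M k i by (simp add: scalar_prod_def lessThan_atLeast0)
    also have "\<dots> = (\<Sum>l<n. R $$ (k, l) * A $$ (l, i))"
      unfolding DM using R A k i by (simp add: scalar_prod_def lessThan_atLeast0)
    finally show ?thesis using A0 by simp
  qed
  have row: "(\<Sum>k<n. M $$ (k, i) ^ q * D $$ (k, l)) = 0" if l: "l < n" for l
  proof -
    have "(\<Sum>k<n. M $$ (k, i) ^ q * D $$ (k, l)) = (P * D) $$ (i, l)"
      using D M l i by (simp add: P_def scalar_prod_def lessThan_atLeast0)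
    also have "\<dots> = (\<Sum>k<n. A $$ (i, k) * N $$ (k, l))"
      unfolding PD using N A l i by (simp add: scalar_prod_def lessThan_atLeast0)
    finally show ?thesis using A0 by simp
  qed
  have dD: "dim_row D = n" using D(1) by simp
  note rowD = partial_permutation_mat_row[OF D(2), unfolded dD]
    and colD = partial_permutation_mat_col[OF D(2), unfolded dD]
  have "M $$ (l, i) = 0" if l: "l < n" for l
  proof -
    obtain k where k: "k < n" "D $$ (k, l) \<noteq> 0 \<or> D $$ (l, k) \<noteq> 0"
      using partial_permutation_mat_nonzero[OF D(2), unfolded dD, OF l] by blast
    from k(2) show ?thesis
    proof
      assume nz: "D $$ (k, l) \<noteq> 0"
      have "D $$ (k, l') = 0" if "l' < n" "l' \<noteq> l" for l'
        using rowD[OF k(1) that(1) l _ nz] that(2) by blast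
      then have "(\<Sum>l'<n. D $$ (k, l') * M $$ (l', i)) = D $$ (k, l) * M $$ (l, i)"
        using l by (subst sum.remove[of _ l]) auto
      then show ?thesis using col[OF k(1)] nz by simp
    next
      assume nz: "D $$ (l, k) \<noteq> 0"
      have "D $$ (l', k) = 0" if "l' < n" "l' \<noteq> l" for l'
        using colD[OF that(1) l k(1) _ nz] that(2) by blast
      then have "(\<Sum>l'<n. M $$ (l', i) ^ q * D $$ (l', k)) = M $$ (l, i) ^ q * D $$ (l, k)"
        using l by (subst sum.remove[of _ l]) auto
      then show ?thesis using row[OF k(1)] nz q by simp
    qed
  qed
  then have "(N * M) $$ (i, i) = 0" using N(1) M(1) i by (simp add: scalar_prod_def)
  then show False using N(3) i by simp
qed

text \<open>The index set of the coordinate subspace \<open>U\<^sub>k\<close>, where \<open>U\<^sub>0\<close> is the whole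
  space and \<open>U\<^sub>k\<^sub>+\<^sub>1\<close> is the right orthogonal of \<open>U\<^sub>k\<close>.\<close>

primrec orth_indices :: "'a::zero mat \<Rightarrow> nat \<Rightarrow> nat set"
  where "orth_indices A 0 = {..<dim_row A}"
  | "orth_indices A (Suc k) = {j. j < dim_row A \<and> (\<forall>i\<in>orth_indices A k. A $$ (i, j) = 0)}"

lemma orth_indices_subset: "orth_indices A k \<subseteq> {..<dim_row A}"
  by (cases k) auto

text \<open>Different blocks are orthogonal to one another, so iterated orthogonals are formed in
  each block separately.\<close>

lemma orth_indices_four_block:
  assumes A: "A \<in> carrier_mat a a" and B: "B \<in> carrier_mat b b"
  shows "orth_indices (four_block_mat A (0\<^sub>m a b) (0\<^sub>m b a) B) k =
    orth_indices A k \<union> (\<lambda>i. i + a) ` orth_indices B k"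
proof (induction k)
  case 0
  have "{..<a + b} = {..<a} \<union> (\<lambda>i. i + a) ` {..<b}"
  proof (intro equalityI subsetI)
    fix x assume x: "x \<in> {..<a + b}"
    show "x \<in> {..<a} \<union> (\<lambda>i. i + a) ` {..<b}"
    proof (cases "x < a")
      case False
      then have "x = (x - a) + a" "x - a \<in> {..<b}" using x by auto
      then show ?thesis by blast
    qed simp
  qed auto
  then show ?case using A B by simp
next
  case (Suc k)
  let ?F = "four_block_mat A (0\<^sub>m a b) (0\<^sub>m b a) B"
  have F: "?F $$ (i, j) = (if i < a then if j < a then A $$ (i, j) else 0
      else if j < a then 0 else B $$ (i - a, j - a))" if "i < a + b" "j < a + b" for i j
    using that A B by auto
  have sA: "orth_indices A k \<subseteq> {..<a}" and sB: "orth_indices B k \<subseteq> {..<b}"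
    using orth_indices_subset[of A k] orth_indices_subset[of B k] A B by auto
  have iff: "j \<in> orth_indices ?F (Suc k) \<longleftrightarrow> j < a + b \<and>
      (\<forall>i\<in>orth_indices A k. ?F $$ (i, j) = 0) \<and> (\<forall>i\<in>orth_indices B k. ?F $$ (i + a, j) = 0)" for j
    using Suc A B by auto
  show ?case
  proof (intro equalityI subsetI)
    fix j assume j: "j \<in> orth_indices ?F (Suc k)"
    then have jab: "j < a + b" and jA: "\<And>i. i \<in> orth_indices A k \<Longrightarrow> ?F $$ (i, j) = 0"
      and jB: "\<And>i. i \<in> orth_indices B k \<Longrightarrow> ?F $$ (i + a, j) = 0"
      unfolding iff by blast+
    show "j \<in> orth_indices A (Suc k) \<union> (\<lambda>i. i + a) ` orth_indices B (Suc k)"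
    proof (cases "j < a")
      case True
      have "A $$ (i, j) = 0" if i: "i \<in> orth_indices A k" for i
        using jA[OF i] F[of i j] True sA i by auto
      then show ?thesis using True A by auto
    next
      case False
      have "B $$ (i, j - a) = 0" if i: "i \<in> orth_indices B k" for i
        using jB[OF i] F[of "i + a" j] False jab sB i by auto
      then have "j - a \<in> orth_indices B (Suc k)" using False jab B by auto
      then show ?thesis using False by (intro UnI2 image_eqI[of _ _ "j - a"]) auto
    qed
  next
    fix j assume "j \<in> orth_indices A (Suc k) \<union> (\<lambda>i. i + a) ` orth_indices B (Suc k)"
    then consider "j \<in> orth_indices A (Suc k)"
      | j' where "j' \<in> orth_indices B (Suc k)" "j = j' + a" by blast
    then show "j \<in> orth_indices ?F (Suc k)"
    proof cases
      case 1
      then have "j < a" using A by simp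
      have "?F $$ (i, j) = 0" if i: "i \<in> orth_indices A k" for i
        using F[of i j] 1 i sA \<open>j < a\<close> by auto
      moreover have "?F $$ (i + a, j) = 0" if i: "i \<in> orth_indices B k" for i
        using F[of "i + a" j] i sB \<open>j < a\<close> by auto
      ultimately show ?thesis unfolding iff using \<open>j < a\<close> by simp
    next
      case 2
      then have "j' < b" using B by simp
      have "?F $$ (i, j) = 0" if i: "i \<in> orth_indices A k" for i
        using F[of i j] 2(2) i sA \<open>j' < b\<close> by auto
      moreover have "?F $$ (i + a, j) = 0" if i: "i \<in> orth_indices B k" for i
        using F[of "i + a" j] 2 i sB \<open>j' < b\<close> by auto
      ultimately show ?thesis unfolding iff using \<open>j' < b\<close> 2(2) by simp
    qed
  qed
qed

lemma card_orth_indices_diag_J_blocks: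
  "card (orth_indices (diag_block_mat (map J_block ss) :: 'a::comm_ring_1 mat) k) =
    (\<Sum>s\<leftarrow>ss. card (orth_indices (J_block s :: 'a mat) k))"
proof (induction ss)
  case Nil
  have "orth_indices (0\<^sub>m 0 0 :: 'a mat) k = {}"
    using orth_indices_subset[of "0\<^sub>m 0 0 :: 'a mat" k] by auto
  then show ?case by simp
next
  case (Cons s ss)
  let ?D = "diag_block_mat (map J_block ss) :: 'a mat"
  have D: "?D \<in> carrier_mat (sum_list ss) (sum_list ss)" by (rule diag_J_blocks_carrier)
  have "orth_indices (diag_block_mat (map J_block (s # ss)) :: 'a mat) k =
      orth_indices (J_block s :: 'a mat) k \<union> (\<lambda>i. i + s) ` orth_indices ?D k"
    by (subst diag_J_blocks_Cons) (rule orth_indices_four_block[OF J_block_carrier D])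
  moreover have "finite (orth_indices (J_block s :: 'a mat) k)" "finite (orth_indices ?D k)"
    by (rule finite_subset[OF orth_indices_subset], simp)+
  moreover have "orth_indices (J_block s :: 'a mat) k \<inter> (\<lambda>i. i + s) ` orth_indices ?D k = {}"
    using orth_indices_subset[of "J_block s :: 'a mat" k] by auto
  ultimately show ?case using Cons by (simp add: card_Un_disjoint card_image)
qed

text \<open>Only index j - 1 pairs with j, so j belongs to \<open>U\<^sub>k\<^sub>+\<^sub>1\<close>
  iff j = 0 or j - 1 is not in \<open>U\<^sub>k\<close>. Going down step by step, membership
  alternates until either index 0, which is in all of them, or \<open>U\<^sub>0\<close> is reached;
  this gives the parity of j or of k.\<close>

lemma orth_indices_J_block:
  assumes "s \<ge> 2"
  shows "j \<in> orth_indices (J_block s :: 'a::comm_ring_1 mat) k \<longleftrightarrow> j < s \<and> (if j < k then even j else even k)"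
proof (induction k arbitrary: j)
  case (Suc k)
  have "(\<forall>i\<in>orth_indices (J_block s :: 'a mat) k. J_block s $$ (i, j) = (0 :: 'a)) \<longleftrightarrow>
      (\<forall>i\<in>orth_indices (J_block s :: 'a mat) k. j \<noteq> Suc i)" if "j < s"
    using orth_indices_subset[of "J_block s :: 'a mat" k] assms that
    by (intro ball_cong) (auto simp: J_block_index)
  then have "j \<in> orth_indices (J_block s :: 'a mat) (Suc k) \<longleftrightarrow>
      j < s \<and> (\<forall>i\<in>orth_indices (J_block s :: 'a mat) k. j \<noteq> Suc i)" by auto
  also have "\<dots> \<longleftrightarrow> j < s \<and> (j = 0 \<or> j - 1 \<notin> orth_indices (J_block s :: 'a mat) k)"
    by (cases j) auto
  finally show ?case using Suc.IH[of "j - 1"] by (cases j) auto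
qed simp

lemma orth_indices_J_block_1:
  "orth_indices (J_block 1 :: 'a::comm_ring_1 mat) k = (if even k then {0} else {})"
  by (induction k) (auto simp: J_block_def)

text \<open>For s \<ge> 2 the two index sets can differ only at k + 1, which is an index of the
  block iff s \<ge> k + 2. For s = 1 they agree. The sign of the difference is expressed by adding
  on one side or the other, as cardinalities are natural numbers.\<close>

lemma card_orth_indices_J_block:
  assumes "s \<ge> 1"
  shows "card (orth_indices (J_block s :: 'a::comm_ring_1 mat) (k + 2)) + (if even k \<and> s \<ge> k + 2 then 1 else 0) =
    card (orth_indices (J_block s :: 'a mat) k) + (if odd k \<and> s \<ge> k + 2 then 1 else 0)"
proof (cases "s = 1")
  case True
  then show ?thesis using orth_indices_J_block_1[of k, where ?'a = 'a] orth_indices_J_block_1[of "k + 2", where ?'a = 'a]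
    by (simp del: orth_indices.simps)
next
  case False
  then have s: "s \<ge> 2" using assms by simp
  note mem = orth_indices_J_block[OF s, where ?'a = 'a]
  let ?I = "\<lambda>k. orth_indices (J_block s :: 'a mat) k"
  have fin: "finite (?I k)" for k by (rule finite_subset[OF orth_indices_subset]) simp
  show ?thesis
  proof (cases "s \<ge> k + 2")
    case False
    have "?I (k + 2) = ?I k"
    proof (rule Set.set_eqI)
      fix j show "j \<in> ?I (k + 2) \<longleftrightarrow> j \<in> ?I k" unfolding mem using False by (auto simp: less_Suc_eq)
    qed
    then show ?thesis using False by (simp del: orth_indices.simps)
  next
    case True
    show ?thesis
    proof (cases "even k")
      case ev: True
      have eq: "?I k = insert (k + 1) (?I (k + 2))"
      proof (rule Set.set_eqI)
        fix j show "j \<in> ?I k \<longleftrightarrow> j \<in> insert (k + 1) (?I (k + 2))"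
          unfolding insert_iff mem using True ev by (auto simp: less_Suc_eq)
      qed
      have nin: "k + 1 \<notin> ?I (k + 2)" unfolding mem using ev by simp
      have "card (?I k) = Suc (card (?I (k + 2)))"
        by (subst eq) (rule card_insert_disjoint[OF fin nin])
      then show ?thesis using ev True by (simp del: orth_indices.simps)
    next
      case od: False
      have eq: "?I (k + 2) = insert (k + 1) (?I k)"
      proof (rule Set.set_eqI)
        fix j show "j \<in> ?I (k + 2) \<longleftrightarrow> j \<in> insert (k + 1) (?I k)"
          unfolding insert_iff mem using True od by (auto simp: less_Suc_eq)
      qed
      have nin: "k + 1 \<notin> ?I k" unfolding mem using od by simp
      have "card (?I (k + 2)) = Suc (card (?I k))"
        by (subst eq) (rule card_insert_disjoint[OF fin nin])
      then show ?thesis using od True by (simp del: orth_indices.simps)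
    qed
  qed
qed

text \<open>Differences of consecutive counts give the multiplicity of every part m \<ge> 2. The
  parts 1 make up the rest of the sum n.\<close>

lemma number_partition_eq:
  assumes P: "P \<in> number_partitions n" and Q: "Q \<in> number_partitions n"
    and ge: "\<And>k. size {#s \<in># P. s \<ge> k + 2#} = size {#s \<in># Q. s \<ge> k + 2#}"
  shows "P = Q"
proof -
  have split: "size {#s \<in># R. s \<ge> m#} = count R m + size {#s \<in># R. s \<ge> Suc m#}" for R :: "nat multiset" and m
    by (induction R) auto
  have ge2: "count P m = count Q m" if "m \<ge> 2" for m
    using split[where R = P and m = m] split[where R = Q and m = m] ge[of "m - 2"] ge[of "m - 1"] that by (simp add: Suc_diff_Suc numeral_2_eq_2)
  have 0: "count P 0 = 0" "count Q 0 = 0" using P Q by (auto simp: number_partitions_def not_in_iff)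
  have filter: "{#s \<in># P. s \<noteq> 1#} = {#s \<in># Q. s \<noteq> 1#}"
  proof (rule multiset_eqI)
    fix m show "count {#s \<in># P. s \<noteq> 1#} m = count {#s \<in># Q. s \<noteq> 1#} m"
      using ge2[of m] 0 by (cases "m = 0 \<or> m = 1") auto
  qed
  have sum: "sum_mset R = sum_mset {#s \<in># R. s \<noteq> 1#} + count R 1" for R :: "nat multiset"
    by (induction R) auto
  have "sum_mset P = n" "sum_mset Q = n" using P Q by (simp_all add: number_partitions_def)
  then have 1: "count P 1 = count Q 1"
    using sum[of P] sum[of Q] unfolding filter by linarith
  show ?thesis
  proof (rule multiset_eqI)
    fix m show "count P m = count Q m"
      using 0 1 ge2[of m] by (cases "m = 0 \<or> m = 1") auto
  qed
qed

lemma number_partition_eq_if_card_orth_indices_eq: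
  assumes ss: "mset ss \<in> number_partitions n" and ts: "mset ts \<in> number_partitions n"
    and card: "\<And>k. card (orth_indices (diag_block_mat (map J_block ss) :: 'a::comm_ring_1 mat) k) =
      card (orth_indices (diag_block_mat (map J_block ts) :: 'a mat) k)"
  shows "mset ss = mset ts"
proof (rule number_partition_eq[OF ss ts])
  fix k
  let ?c = "\<lambda>us k. card (orth_indices (diag_block_mat (map J_block us) :: 'a mat) k)"
  have step: "?c us (k + 2) + (if even k then size {#s \<in># mset us. s \<ge> k + 2#} else 0) =
      ?c us k + (if odd k then size {#s \<in># mset us. s \<ge> k + 2#} else 0)" if "0 \<notin> set us" for us
    unfolding card_orth_indices_diag_J_blocks using that
  proof (induction us)
    case (Cons u us)
    then have "u \<ge> 1" by auto
    then show ?case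
      using Cons card_orth_indices_J_block[of u k, where ?'a = 'a]
      by (simp del: orth_indices.simps split: if_splits)
  qed simp
  have "0 \<notin> set ss" "0 \<notin> set ts" using ss ts by (auto simp: number_partitions_def)
  then show "size {#s \<in># mset ss. s \<ge> k + 2#} = size {#s \<in># mset ts. s \<ge> k + 2#}"
    using step[of ss] step[of ts] card[of k] card[of "k + 2"]
    by (simp del: orth_indices.simps split: if_splits)
qed

section \<open>Classification of matrices\<close>

definition sesq :: "nat \<Rightarrow> nat \<Rightarrow> 'a::comm_ring_1 mat \<Rightarrow> (nat \<Rightarrow> 'a) \<Rightarrow> (nat \<Rightarrow> 'a) \<Rightarrow> 'a"
  where "sesq q n A u v = (\<Sum>i<n. \<Sum>j<n. u i ^ q * A $$ (i, j) * v j)"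

text \<open>The dimension n is a variable and not a type, so k^n is realized inside the space of all
  functions on the natural numbers, as those supported on \<open>{..<n}\<close>.\<close>

interpretation fun_vs: vector_space "\<lambda>(c :: 'a::field) (f :: nat \<Rightarrow> 'a) i. c * f i"
  by unfold_locales (auto simp: fun_eq_iff algebra_simps)

lemma sum_fun_apply: "(\<Sum>i\<in>A. f i) x = (\<Sum>i\<in>A. f i x)"
  for f :: "'i \<Rightarrow> nat \<Rightarrow> 'a::comm_monoid_add"
  by (induction A rule: infinite_finite_induct) auto

definition unit_fun :: "nat \<Rightarrow> nat \<Rightarrow> 'a::field"
  where "unit_fun i = (\<lambda>k. if k = i then 1 else 0)"

definition supported :: "nat set \<Rightarrow> (nat \<Rightarrow> 'a::zero) set"
  where "supported I = {f. \<forall>k. k \<notin> I \<longrightarrow> f k = 0}"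

lemma supported_eq_sum:
  fixes f :: "nat \<Rightarrow> 'a::field"
  assumes "finite I" "f \<in> supported I"
  shows "f = (\<Sum>i\<in>I. (\<lambda>k. f i * unit_fun i k))"
proof
  fix k
  have "(\<Sum>i\<in>I. f i * unit_fun i k) = (\<Sum>i\<in>I. if i = k then f i else 0)"
    by (intro sum.cong) (auto simp: unit_fun_def)
  then show "f k = (\<Sum>i\<in>I. (\<lambda>k. f i * unit_fun i k)) k"
    using assms by (simp add: sum_fun_apply supported_def)
qed

lemma inj_unit_fun: "inj_on (unit_fun :: nat \<Rightarrow> nat \<Rightarrow> 'a::field) I"
proof (rule inj_onI)
  fix i j assume "(unit_fun i :: nat \<Rightarrow> 'a) = unit_fun j"
  then have "unit_fun i i = (unit_fun j i :: 'a)" by simp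
  then show "i = j" by (simp add: unit_fun_def split: if_splits)
qed

lemma independent_unit_fun:
  assumes "finite I"
  shows "fun_vs.independent (unit_fun ` I :: (nat \<Rightarrow> 'a::field) set)"
proof (rule fun_vs.independent_if_scalars_zero)
  fix f :: "(nat \<Rightarrow> 'a) \<Rightarrow> 'a" and y :: "nat \<Rightarrow> 'a"
  assume "(\<Sum>x\<in>unit_fun ` I. (\<lambda>k. f x * x k)) = 0" and "y \<in> unit_fun ` I"
  then obtain i where z: "(\<Sum>j\<in>I. (\<lambda>k. f (unit_fun j) * unit_fun j k)) i = 0" and i: "i \<in> I" "y = unit_fun i"
    by (auto simp: sum.reindex inj_unit_fun)
  have "(\<Sum>j\<in>I. (\<lambda>k. f (unit_fun j) * unit_fun j k)) i = (\<Sum>j\<in>I. if j = i then f (unit_fun j) else 0)"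
    unfolding sum_fun_apply by (intro sum.cong) (auto simp: unit_fun_def)
  then show "f y = 0" using z i assms by simp
qed (use assms in simp)

lemma span_unit_fun:
  assumes "finite I"
  shows "fun_vs.span (unit_fun ` I) = (supported I :: (nat \<Rightarrow> 'a::field) set)"
proof
  have "fun_vs.subspace (supported I :: (nat \<Rightarrow> 'a) set)"
    by (auto simp: fun_vs.subspace_def supported_def)
  then show "fun_vs.span (unit_fun ` I) \<subseteq> (supported I :: (nat \<Rightarrow> 'a) set)"
    by (intro fun_vs.span_minimal) (auto simp: supported_def unit_fun_def)
  show "(supported I :: (nat \<Rightarrow> 'a) set) \<subseteq> fun_vs.span (unit_fun ` I)"
  proof
    fix f :: "nat \<Rightarrow> 'a" assume "f \<in> supported I"
    then have "f = (\<Sum>i\<in>I. (\<lambda>k. f i * unit_fun i k))" by (rule supported_eq_sum[OF assms])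
    also have "\<dots> \<in> fun_vs.span (unit_fun ` I)"
      by (intro fun_vs.span_sum fun_vs.span_scale fun_vs.span_base) auto
    finally show "f \<in> fun_vs.span (unit_fun ` I)" .
  qed
qed

lemma sesquilinear_space_sesq:
  fixes A :: "'a::alg_closed_field mat"
  assumes "prime CHAR('a)" "q = CHAR('a) ^ e" "e > 0"
  shows "sesquilinear_space (\<lambda>(c :: 'a) f i. c * f i) q (sesq q n A)"
proof (intro sesquilinear_space.intro alg_closed_vector_space.intro fun_vs.vector_space_axioms
    sesquilinear_space_axioms.intro)
  show "q > 1" using one_less_power[OF prime_gt_1_nat[OF assms(1)] assms(3)] assms(2) by simp
  show frob: "(x + y) ^ q = x ^ q + y ^ q" for x y :: 'a by (rule freshmans_dream'[OF assms(1,2)])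
  show "sesq q n A (u + v) w = sesq q n A u w + sesq q n A v w" for u v w
    by (simp add: sesq_def frob algebra_simps sum.distrib)
  show "sesq q n A u (v + w) = sesq q n A u v + sesq q n A u w" for u v w
    by (simp add: sesq_def algebra_simps sum.distrib)
  show "sesq q n A (\<lambda>i. c * u i) v = c ^ q * sesq q n A u v" for c u v
    by (simp add: sesq_def power_mult_distrib sum_distrib_left mult_ac)
  show "sesq q n A u (\<lambda>i. c * v i) = c * sesq q n A u v" for c u v
    by (simp add: sesq_def sum_distrib_left mult_ac)
qed

text \<open>The change of coordinates has the basis vectors as its columns. Expressing the unit
  vectors through the basis gives a right inverse, which for a square matrix is two-sided.\<close>

lemma frob_cong_basis:
  fixes A :: "'a::alg_closed_field mat"
  assumes A: "A \<in> carrier_mat n n"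
    and xs: "distinct xs" "fun_vs.independent (set xs)" "fun_vs.span (set xs) = supported {..<n}"
  shows "length xs = n" "frob_congruent q n A (gram_mat (sesq q n A) xs)"
proof -
  have "card (set xs) = card (unit_fun ` {..<n} :: (nat \<Rightarrow> 'a) set)"
    using fun_vs.dim_span_eq_card_independent[OF xs(2)]
      fun_vs.dim_span_eq_card_independent[OF independent_unit_fun[of "{..<n}", where 'a = 'a]]
    by (simp add: xs(3) span_unit_fun)
  then show len: "length xs = n"
    using distinct_card[OF xs(1)] by (simp add: card_image inj_unit_fun)
  define M where "M = mat n n (\<lambda>(i, j). (xs ! j) i)"
  have M: "M \<in> carrier_mat n n" by (simp add: M_def)
  have "\<exists>a. unit_fun j = (\<Sum>l<n. (\<lambda>k. a l * (xs ! l) k))" if "j < n" for j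
  proof -
    have "set xs = (!) xs ` {..<n}" using len by (auto simp: set_conv_nth)
    moreover have "unit_fun j \<in> fun_vs.span (set xs)"
      using that by (auto simp: xs(3) supported_def unit_fun_def)
    ultimately show ?thesis using fun_vs.span_image_finite[of "{..<n}" "unit_fun j" "(!) xs"] by auto
  qed
  then obtain a where a: "\<And>j. j < n \<Longrightarrow> unit_fun j = (\<Sum>l<n. (\<lambda>k. a j l * (xs ! l) k))" by metis
  define N where "N = mat n n (\<lambda>(l, j). a j l)"
  have N: "N \<in> carrier_mat n n" by (simp add: N_def)
  have MN: "M * N = 1\<^sub>m n"
  proof (rule eq_matI)
    fix i j assume "i < dim_row (1\<^sub>m n :: 'a mat)" "j < dim_col (1\<^sub>m n :: 'a mat)"
    then have ij: "i < n" "j < n" by auto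
    have "(M * N) $$ (i, j) = (\<Sum>l<n. (\<lambda>k. a j l * (xs ! l) k)) i"
      using ij by (simp add: M_def N_def scalar_prod_def sum_fun_apply lessThan_atLeast0 mult.commute)
    then show "(M * N) $$ (i, j) = 1\<^sub>m n $$ (i, j)"
      using ij by (simp add: a[OF ij(2), symmetric] unit_fun_def)
  qed (use M N in auto)
  have NM: "N * M = 1\<^sub>m n" by (rule mat_mult_left_right_inverse[OF M N MN])
  have "gram_mat (sesq q n A) xs = frob_cong q M A"
  proof (rule eq_matI)
    fix i j assume "i < dim_row (frob_cong q M A)" "j < dim_col (frob_cong q M A)"
    then have ij: "i < n" "j < n" using frob_cong_carrier[OF M A, of q] by auto
    then have "gram_mat (sesq q n A) xs $$ (i, j) = (\<Sum>k<n. \<Sum>l<n. (xs ! i) k ^ q * A $$ (k, l) * (xs ! j) l)"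
      by (simp add: gram_mat_def len sesq_def)
    also have "\<dots> = (\<Sum>k<n. \<Sum>l<n. M $$ (k, i) ^ q * A $$ (k, l) * M $$ (l, j))"
      using ij by (intro sum.cong refl) (simp add: M_def)
    also have "\<dots> = frob_cong q M A $$ (i, j)" by (rule frob_cong_index[OF M A ij, symmetric])
    finally show "gram_mat (sesq q n A) xs $$ (i, j) = frob_cong q M A $$ (i, j)" .
  qed (use frob_cong_carrier[OF M A, of q] in \<open>auto simp: gram_mat_def len\<close>)
  then show "frob_congruent q n A (gram_mat (sesq q n A) xs)"
    using M invertible_matI[OF M N MN NM] by (auto simp: frob_congruent_def)
qed

text \<open>Any order of the block sizes is thus realized by some order of the chains
  themselves.\<close>

lemma mset_eq_map_obtain:
  assumes "mset ss = mset (map f cs)"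
  shows "\<exists>cs'. mset cs' = mset cs \<and> map f cs' = ss"
  using assms
proof (induction ss arbitrary: cs)
  case (Cons s ss)
  then have "s \<in> f ` set cs" by (metis list.set_intros(1) list.set_map mset_eq_setD)
  then obtain c where c: "c \<in> set cs" "f c = s" by blast
  have "mset ss = mset (map f (remove1 c cs))"
    using Cons.prems c by (simp add: image_mset_Diff) (metis add_mset_remove_trivial)
  then obtain cs' where "mset cs' = mset (remove1 c cs)" "map f cs' = ss" using Cons.IH by blast
  then show ?case using c by (intro exI[of _ "c # cs'"]) auto
qed auto

lemma diag_block_mat_zero_block:
  fixes As :: "'a::zero mat list"
  assumes "0\<^sub>m 1 1 \<in> set As" "\<And>A. A \<in> set As \<Longrightarrow> dim_col A = dim_row A"
  shows "\<exists>l<sum_list (map dim_row As). \<forall>j<sum_list (map dim_row As).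
    diag_block_mat As $$ (l, j) = 0 \<and> diag_block_mat As $$ (j, l) = 0"
  using assms
proof (induction As)
  case (Cons A As)
  let ?m = "sum_list (map dim_row As)"
  have As: "diag_block_mat As \<in> carrier_mat ?m ?m" using Cons.prems by (intro diag_block_mat_carrier) auto
  have dA: "dim_col A = dim_row A" using Cons.prems by simp
  have "diag_block_mat (A # As) = four_block_mat A (0\<^sub>m (dim_row A) ?m) (0\<^sub>m ?m (dim_row A)) (diag_block_mat As)"
    by (simp only: diag_block_mat.simps Let_def carrier_matD[OF As] dA)
  then have F: "diag_block_mat (A # As) $$ (i, j) = (if i < dim_row A then if j < dim_row A then A $$ (i, j) else 0
      else if j < dim_row A then 0 else diag_block_mat As $$ (i - dim_row A, j - dim_row A))"
    if "i < dim_row A + ?m" "j < dim_row A + ?m" for i j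
    using that carrier_matD[OF As] dA by simp
  show ?case
  proof (cases "A = 0\<^sub>m 1 1")
    case True
    then show ?thesis using F by (intro exI[of _ 0]) auto
  next
    case False
    then obtain l where "l < ?m" "\<forall>j<?m. diag_block_mat As $$ (l, j) = 0 \<and> diag_block_mat As $$ (j, l) = 0"
      using Cons by auto
    then show ?thesis using F by (intro exI[of _ "l + dim_row A"]) auto
  qed
qed simp

text \<open>A block \<open>[0]\<close> would give coordinates in which one variable does not occur,
  so non-degeneracy leaves only blocks \<open>J_block s\<close>; the lengths of the chains are the
  parts of the partition.\<close>

theorem frob_congruent_diag_J_blocks:
  fixes A :: "'a::alg_closed_field mat"
  assumes char: "prime CHAR('a)" "q = CHAR('a) ^ e" "e > 0"
    and A: "A \<in> carrier_mat n n" and nd: "nondegenerate n (form_of_mat q A)"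
  shows "\<exists>P\<in>number_partitions n. \<forall>ss. mset ss = P \<longrightarrow> frob_congruent q n A (diag_block_mat (map J_block ss))"
proof -
  interpret S: sesquilinear_space "\<lambda>(c :: 'a) f i. c * f i" q "sesq q n A"
    using char by (rule sesquilinear_space_sesq)
  let ?gram = "gram_mat (sesq q n A)"
  have "\<exists>cs. \<forall>cs'. mset cs' = mset cs \<longrightarrow> distinct (concat cs') \<and> fun_vs.independent (set (concat cs')) \<and>
      fun_vs.span (set (concat cs')) = fun_vs.span (unit_fun ` {..<n}) \<and>
      ?gram (concat cs') = diag_block_mat (map ?gram cs') \<and>
      (\<forall>c\<in>set cs'. c \<noteq> [] \<and> (?gram c = J_block (length c) \<or> ?gram c = 0\<^sub>m 1 1))"
    by (rule S.exists_block_basis) (simp_all add: independent_unit_fun)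
  then obtain cs where cs: "\<And>cs'. mset cs' = mset cs \<Longrightarrow> distinct (concat cs') \<and> fun_vs.independent (set (concat cs')) \<and>
      fun_vs.span (set (concat cs')) = fun_vs.span (unit_fun ` {..<n}) \<and>
      ?gram (concat cs') = diag_block_mat (map ?gram cs') \<and>
      (\<forall>c\<in>set cs'. c \<noteq> [] \<and> (?gram c = J_block (length c) \<or> ?gram c = 0\<^sub>m 1 1))" by blast
  have cong: "length (concat cs') = n" "frob_congruent q n A (diag_block_mat (map ?gram cs'))"
    if "mset cs' = mset cs" for cs'
    using frob_cong_basis(1)[OF A, of "concat cs'"] frob_cong_basis(2)[OF A, of "concat cs'" q] cs[OF that] by (auto simp: span_unit_fun)
  have J: "?gram c = J_block (length c)" if c: "c \<in> set cs" for c
  proof (rule ccontr)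
    assume "?gram c \<noteq> J_block (length c)"
    then have z: "0\<^sub>m 1 1 = ?gram c" using cs[OF refl] c by metis
    have "0\<^sub>m 1 1 \<in> set (map ?gram cs)" unfolding set_map z using c by (rule imageI)
    moreover have "sum_list (map dim_row (map ?gram cs)) = n"
      using cong(1)[of cs] by (simp add: gram_mat_def length_concat o_def)
    moreover have "dim_col B = dim_row B" if "B \<in> set (map ?gram cs)" for B
      using that by (auto simp: gram_mat_def)
    ultimately obtain l where l: "l < n" "\<forall>j<n. diag_block_mat (map ?gram cs) $$ (l, j) = 0 \<and>
        diag_block_mat (map ?gram cs) $$ (j, l) = 0"
      using diag_block_mat_zero_block[of "map ?gram cs"] by auto
    obtain M where "M \<in> carrier_mat n n" "invertible_mat M" "diag_block_mat (map ?gram cs) = frob_cong q M A"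
      using cong(2)[of cs] by (auto simp: frob_congruent_def)
    then show False using nd l unfolding nondegenerate_form_of_mat_iff[OF char A] by metis
  qed
  have "mset (map length cs) \<in> number_partitions n"
    using cong(1)[of cs] cs[of cs]
    by (auto simp: number_partitions_def length_concat sum_mset_sum_list simp flip: mset_map)
  moreover have "frob_congruent q n A (diag_block_mat (map J_block ss))" if ss: "mset ss = mset (map length cs)" for ss
  proof -
    obtain cs' where cs': "mset cs' = mset cs" "map length cs' = ss" using mset_eq_map_obtain[OF ss] by blast
    have "map ?gram cs' = map J_block (map length cs')"
      using J mset_eq_setD[OF cs'(1)] by simp
    then show ?thesis using cong(2)[OF cs'(1)] cs'(2) by simp
  qed
  ultimately show ?thesis by blast
qed

section \<open>Iterated orthogonals under congruence\<close>

definition mat_apply :: "nat \<Rightarrow> 'a::comm_ring_1 mat \<Rightarrow> (nat \<Rightarrow> 'a) \<Rightarrow> nat \<Rightarrow> 'a"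
  where "mat_apply n M u = (\<lambda>i. if i < n then \<Sum>j<n. M $$ (i, j) * u j else 0)"

lemma mat_apply_supported: "mat_apply n M u \<in> supported {..<n}"
  by (simp add: mat_apply_def supported_def)

lemma mat_apply_mult:
  fixes M N :: "'a::comm_ring_1 mat" and u :: "nat \<Rightarrow> 'a"
  assumes "M \<in> carrier_mat n n" "N \<in> carrier_mat n n"
  shows "mat_apply n M (mat_apply n N u) = mat_apply n (M * N) u"
proof
  fix i
  have "(\<Sum>j<n. M $$ (i, j) * (\<Sum>k<n. N $$ (j, k) * u k)) = (\<Sum>k<n. (\<Sum>j<n. M $$ (i, j) * N $$ (j, k)) * u k)"
    unfolding sum_distrib_left sum_distrib_right by (subst sum.swap) (simp add: mult.assoc)
  then show "mat_apply n M (mat_apply n N u) i = mat_apply n (M * N) u i"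
    using assms by (simp add: mat_apply_def scalar_prod_def lessThan_atLeast0)
qed

lemma mat_apply_one:
  fixes u :: "nat \<Rightarrow> 'a::comm_ring_1"
  assumes "u \<in> supported {..<n}"
  shows "mat_apply n (1\<^sub>m n) u = u"
proof
  fix i
  have "(\<Sum>j<n. 1\<^sub>m n $$ (i, j) * u j) = (\<Sum>j<n. if j = i then u j else 0)" if "i < n"
    using that by (intro sum.cong) auto
  then show "mat_apply n (1\<^sub>m n) u i = u i" using assms by (auto simp: mat_apply_def supported_def)
qed

lemma sesq_frob_cong:
  fixes D M :: "'a::comm_ring_1 mat" and u v :: "nat \<Rightarrow> 'a"
  assumes char: "prime CHAR('a)" "q = CHAR('a) ^ e" and D: "D \<in> carrier_mat n n" and M: "M \<in> carrier_mat n n"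
  shows "sesq q n (frob_cong q M D) u v = sesq q n D (mat_apply n M u) (mat_apply n M v)"
proof -
  have "sesq q n D (mat_apply n M u) (mat_apply n M v) =
      (\<Sum>i<n. \<Sum>j<n. \<Sum>k<n. \<Sum>l<n. u k ^ q * (M $$ (i, k) ^ q * D $$ (i, j) * M $$ (j, l)) * v l)"
    by (simp add: sesq_def mat_apply_def freshmans_dream_sum'[OF char] power_mult_distrib
        sum_distrib_left sum_distrib_right mult_ac)
  also have "\<dots> = (\<Sum>k<n. \<Sum>l<n. \<Sum>i<n. \<Sum>j<n. u k ^ q * (M $$ (i, k) ^ q * D $$ (i, j) * M $$ (j, l)) * v l)"
    by (rule sum_swap_pairs)
  also have "\<dots> = sesq q n (frob_cong q M D) u v"
    unfolding sesq_def
    by (intro sum.cong refl) (simp add: frob_cong_index[OF M D] sum_distrib_left sum_distrib_right)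
  finally show ?thesis ..
qed

text \<open>Justifies the combinatorial definition of \<open>orth_indices\<close>. If j was dropped
  because of an entry at (i, j), this is the only nonzero entry in row i, so testing
  \<open>v\<close> against the unit vector i isolates \<open>v j\<close>.\<close>

lemma supported_orth_indices_Suc:
  fixes D :: "'a::field mat" and v :: "nat \<Rightarrow> 'a"
  assumes "q > 0" and D: "D \<in> carrier_mat n n" "partial_permutation_mat D" and v: "v \<in> supported {..<n}"
  shows "v \<in> supported (orth_indices D (Suc k)) \<longleftrightarrow> (\<forall>u\<in>supported (orth_indices D k). sesq q n D u v = 0)"
proof
  assume *: "v \<in> supported (orth_indices D (Suc k))"
  show "\<forall>u\<in>supported (orth_indices D k). sesq q n D u v = 0"
  proof
    fix u :: "nat \<Rightarrow> 'a" assume u: "u \<in> supported (orth_indices D k)"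
    have zero: "u i ^ q * D $$ (i, j) * v j = 0" for i j
    proof (cases "i \<in> orth_indices D k \<and> j \<in> orth_indices D (Suc k)")
      case True
      then show ?thesis by auto
    next
      case False
      then have "u i = 0 \<or> v j = 0" using u * unfolding supported_def by blast
      then show ?thesis using assms(1) by (auto simp: power_0_left)
    qed
    show "sesq q n D u v = 0" unfolding sesq_def zero by simp
  qed
next
  assume *: "\<forall>u\<in>supported (orth_indices D k). sesq q n D u v = 0"
  have "v j = 0" if j: "j \<notin> orth_indices D (Suc k)" for j
  proof (cases "j < n")
    case False
    then show ?thesis using v by (simp add: supported_def)
  next
    case True
    then obtain i where i: "i \<in> orth_indices D k" "D $$ (i, j) \<noteq> 0" using j D by auto
    have "i < n" using orth_indices_subset[of D k] i D by auto
    have "D $$ (i, l) = 0" if "l < n" "l \<noteq> j" for l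
      using partial_permutation_mat_row[OF D(2), of i l j] D(1) i(2) \<open>i < n\<close> True that by auto
    then have row: "(\<Sum>l<n. D $$ (i, l) * v l) = D $$ (i, j) * v j"
      using True by (subst sum.remove[of _ j]) auto
    have "sesq q n D (unit_fun i) v = (\<Sum>i'<n. if i' = i then \<Sum>l<n. D $$ (i, l) * v l else 0)"
      unfolding sesq_def using assms(1) by (intro sum.cong) (auto simp: unit_fun_def power_0_left)
    also have "\<dots> = D $$ (i, j) * v j" using \<open>i < n\<close> row by simp
    also have "sesq q n D (unit_fun i) v = 0"
      using * i(1) by (auto simp: supported_def unit_fun_def)
    finally show ?thesis using i(2) by simp
  qed
  then show "v \<in> supported (orth_indices D (Suc k))" by (auto simp: supported_def)
qed

lemma supported_mono: "I \<subseteq> J \<Longrightarrow> supported I \<subseteq> supported J"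
  by (auto simp: supported_def)

text \<open>The subspaces \<open>U\<^sub>k\<close> are defined by the form alone, and
  \<open>M\<close> is an isometry from the form of \<open>E\<close> to that of \<open>D\<close>. It
  maps \<open>U\<^sub>k\<close> of \<open>E\<close> onto \<open>U\<^sub>k\<close> of
  \<open>D\<close>, so the dimension of the latter is at most that of the former.\<close>

lemma card_orth_indices_le:
  fixes D M :: "'a::field mat"
  assumes char: "prime CHAR('a)" "q = CHAR('a) ^ e"
    and D: "D \<in> carrier_mat n n" "partial_permutation_mat D"
    and E: "E \<in> carrier_mat n n" "partial_permutation_mat E"
    and cong: "frob_congruent q n D E"
  shows "card (orth_indices D k) \<le> card (orth_indices E k)"
proof -
  have q: "q > 0" using char prime_gt_0_nat by simp
  obtain M where M: "M \<in> carrier_mat n n" "invertible_mat M" "E = frob_cong q M D"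
    using cong by (auto simp: frob_congruent_def)
  obtain N where N: "N \<in> carrier_mat n n" "M * N = 1\<^sub>m n"
    using invertible_mat_obtain_inverse[OF M(1,2)] by blast
  have sub: "orth_indices D k \<subseteq> {..<n}" "orth_indices E k \<subseteq> {..<n}" for k
    using orth_indices_subset[of D k] orth_indices_subset[of E k] D E by auto
  have inv: "mat_apply n M (mat_apply n N u) = u" if "u \<in> supported {..<n}" for u :: "nat \<Rightarrow> 'a"
    using that M N by (simp add: mat_apply_mult mat_apply_one)
  have corr: "v \<in> supported (orth_indices E k) \<longleftrightarrow> mat_apply n M v \<in> supported (orth_indices D k)"
    if "v \<in> supported {..<n}" for v :: "nat \<Rightarrow> 'a" and k
    using that
  proof (induction k arbitrary: v)
    case 0
    then show ?case using mat_apply_supported[of n M v] D E by simp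
  next
    case (Suc k)
    have "v \<in> supported (orth_indices E (Suc k)) \<longleftrightarrow> (\<forall>u\<in>supported (orth_indices E k). sesq q n E u v = 0)"
      by (rule supported_orth_indices_Suc[OF q E Suc.prems])
    also have "\<dots> \<longleftrightarrow> (\<forall>u\<in>supported (orth_indices E k). sesq q n D (mat_apply n M u) (mat_apply n M v) = 0)"
      by (simp add: M(3) sesq_frob_cong[OF char D(1) M(1)])
    also have "\<dots> \<longleftrightarrow> (\<forall>u\<in>supported (orth_indices D k). sesq q n D u (mat_apply n M v) = 0)"
    \<comment> \<open>As u runs over \<open>U\<^sub>k\<close> of \<open>E\<close>, its image runs
      over all of \<open>U\<^sub>k\<close> of \<open>D\<close>; for surjectivity the inverse matrix
      \<open>N\<close> supplies a preimage, to which the induction hypothesis applies.\<close>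
    proof (intro iffI ballI)
      fix u :: "nat \<Rightarrow> 'a"
      assume *: "\<forall>u\<in>supported (orth_indices E k). sesq q n D (mat_apply n M u) (mat_apply n M v) = 0"
        and u: "u \<in> supported (orth_indices D k)"
      have u': "mat_apply n M (mat_apply n N u) = u" using u supported_mono[OF sub(1)] by (intro inv) blast
      then have "mat_apply n N u \<in> supported (orth_indices E k)"
        using Suc.IH[OF mat_apply_supported, of N u] u by simp
      then show "sesq q n D u (mat_apply n M v) = 0" using * u' by force
    next
      fix u :: "nat \<Rightarrow> 'a"
      assume *: "\<forall>u\<in>supported (orth_indices D k). sesq q n D u (mat_apply n M v) = 0"
        and u: "u \<in> supported (orth_indices E k)"
      then have "mat_apply n M u \<in> supported (orth_indices D k)"
        using Suc.IH[of u] supported_mono[OF sub(2)] by blast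
      then show "sesq q n D (mat_apply n M u) (mat_apply n M v) = 0" using * by blast
    qed
    also have "\<dots> \<longleftrightarrow> mat_apply n M v \<in> supported (orth_indices D (Suc k))"
      by (rule supported_orth_indices_Suc[OF q D mat_apply_supported, symmetric])
    finally show ?case .
  qed
  have fin: "finite (orth_indices D k)" "finite (orth_indices E k)" for k
    using finite_subset[OF sub(1)] finite_subset[OF sub(2)] by simp_all
  let ?T = "mat_apply n M ` unit_fun ` orth_indices E k"
  have "(unit_fun ` orth_indices D k :: (nat \<Rightarrow> 'a) set) \<subseteq> fun_vs.span ?T"
  proof
    fix f :: "nat \<Rightarrow> 'a" assume "f \<in> unit_fun ` orth_indices D k"
    then have f: "f \<in> supported (orth_indices D k)" by (auto simp: unit_fun_def supported_def)
    define w where "w = mat_apply n N f"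
    have w: "mat_apply n M w = f" unfolding w_def using f supported_mono[OF sub(1)] by (intro inv) blast
    then have wE: "w \<in> supported (orth_indices E k)"
      using f corr[of w k] mat_apply_supported[of n N f] by (simp add: w_def)
    have "f = (\<Sum>i\<in>orth_indices E k. (\<lambda>r. w i * mat_apply n M (unit_fun i) r))"
    proof
      fix r
      have col: "(\<Sum>j<n. M $$ (r, j) * unit_fun i j) = M $$ (r, i)" if "i < n" for i
      proof -
        have "(\<Sum>j<n. M $$ (r, j) * unit_fun i j) = (\<Sum>j<n. if j = i then M $$ (r, j) else 0)"
          by (intro sum.cong) (auto simp: unit_fun_def)
        then show ?thesis using that by simp
      qed
      show "f r = (\<Sum>i\<in>orth_indices E k. (\<lambda>r. w i * mat_apply n M (unit_fun i) r)) r"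
      proof (cases "r < n")
        case True
        have "(\<Sum>i\<in>orth_indices E k. w i * mat_apply n M (unit_fun i) r) = (\<Sum>i\<in>orth_indices E k. M $$ (r, i) * w i)"
          using True sub(2)[of k] col by (intro sum.cong) (auto simp: mat_apply_def)
        also have "\<dots> = (\<Sum>i<n. M $$ (r, i) * w i)"
          using sub(2)[of k] wE by (intro sum.mono_neutral_left) (auto simp: supported_def)
        also have "\<dots> = f r" using True by (simp add: w[symmetric] mat_apply_def)
        finally show ?thesis by (simp add: sum_fun_apply)
      next
        case False
        then show ?thesis by (simp add: w[symmetric] mat_apply_def sum_fun_apply)
      qed
    qed
    also have "\<dots> \<in> fun_vs.span ?T"
      by (intro fun_vs.span_sum fun_vs.span_scale fun_vs.span_base) auto
    finally show "f \<in> fun_vs.span ?T" .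
  qed
  from fun_vs.independent_span_bound[OF _ independent_unit_fun[OF fin(1)] this]
  have "card (unit_fun ` orth_indices D k :: (nat \<Rightarrow> 'a) set) \<le> card ?T" using fin(2) by simp
  also have "\<dots> \<le> card (unit_fun ` orth_indices E k :: (nat \<Rightarrow> 'a) set)"
    by (intro card_image_le finite_imageI fin)
  also have "\<dots> \<le> card (orth_indices E k)" by (rule card_image_le[OF fin(2)])
  finally show ?thesis by (simp add: card_image inj_unit_fun)
qed

theorem frob_congruent_diag_J_blocks_unique:
  fixes ss ts :: "nat list"
  assumes char: "prime CHAR('a::field)" "q = CHAR('a) ^ e"
    and ss: "mset ss \<in> number_partitions n" and ts: "mset ts \<in> number_partitions n"
    and cong: "frob_congruent q n (diag_block_mat (map J_block ss) :: 'a mat) (diag_block_mat (map J_block ts))"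
  shows "mset ss = mset ts"
proof (rule number_partition_eq_if_card_orth_indices_eq[OF ss ts])
  fix k
  have n: "sum_list ss = n" "sum_list ts = n" using ss ts by (auto simp: number_partitions_def sum_mset_sum_list)
  have D: "(diag_block_mat (map J_block ss) :: 'a mat) \<in> carrier_mat n n"
    "(diag_block_mat (map J_block ts) :: 'a mat) \<in> carrier_mat n n"
    using diag_J_blocks_carrier[of ss] diag_J_blocks_carrier[of ts] n by simp_all
  note pp = partial_permutation_mat_diag_J_blocks
  show "card (orth_indices (diag_block_mat (map J_block ss) :: 'a mat) k) =
      card (orth_indices (diag_block_mat (map J_block ts) :: 'a mat) k)"
    using card_orth_indices_le[OF char D(1) pp D(2) pp cong]
      card_orth_indices_le[OF char D(2) pp D(1) pp frob_congruent_sym[OF char D(1) cong]]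
    by (rule le_antisym)
qed

theorem theorem7p1:
  fixes p e q n :: nat
  assumes "CHAR('a::alg_closed_field) = p" and "p > 0"
    and "e > 0" and "q = p ^ e" and "n \<ge> 1"
  shows "\<exists>\<Phi> :: nat multiset \<Rightarrow> 'a mpoly set.
    bij_betw \<Phi> (number_partitions n)
      (nondeg_frobenius_forms n q // lin_equiv_rel n q) \<and>
    (\<forall>ss :: nat list. mset ss \<in> number_partitions n \<longrightarrow>
      \<Phi> (mset ss) =
        lin_equiv_rel n q `` {form_of_mat q (diag_block_mat (map J_block ss))})"
proof -
  have "CHAR('a) > 0" using assms(1,2) by simp
  then have "prime CHAR('a)" by (rule prime_CHAR_semidom)
  moreover have "q = CHAR('a) ^ e" by (simp only: assms(1,4))
  ultimately have char: "prime CHAR('a)" "q = CHAR('a) ^ e" .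
  have q2: "q \<ge> 2"
    using prime_ge_2_nat[OF char(1)] char(2) assms(3) self_le_power[of "CHAR('a)" e] by linarith
  define X where "X = (nondeg_frobenius_forms n q :: 'a mpoly set)"
  define R where "R = (lin_equiv_rel n q :: ('a mpoly \<times> 'a mpoly) set)"
  define D where "D ss = (diag_block_mat (map J_block ss) :: 'a mat)" for ss
  have X_form: "\<exists>A\<in>carrier_mat n n. f = form_of_mat q A \<and> nondegenerate n (form_of_mat q A)" if "f \<in> X" for f
    using that frobenius_form_imp_form_of_mat[OF q2, of n f] by (auto simp: X_def nondeg_frobenius_forms_def)
  \<comment> \<open>Since matrices are determined by their forms, equivalence of forms becomes
    congruence of matrices, and the rest can be argued with matrices.\<close>
  have R_iff: "(form_of_mat q A, form_of_mat q B) \<in> R \<longleftrightarrow>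
      form_of_mat q A \<in> X \<and> form_of_mat q B \<in> X \<and> frob_congruent q n A B"
    if A: "A \<in> carrier_mat n n" and B: "B \<in> carrier_mat n n" for A B
  proof -
    have "form_of_mat q B = lin_subst M (form_of_mat q A) \<longleftrightarrow> B = frob_cong q M A" if "M \<in> carrier_mat n n" for M
      using form_of_mat_inj[OF q2 B frob_cong_carrier[OF that A]] lin_subst_form_of_mat[OF char A that] by auto
    then show ?thesis by (auto simp: R_def X_def lin_equiv_rel_def lin_equiv_def frob_congruent_def)
  qed
  have RX: "R \<subseteq> X \<times> X" by (auto simp: R_def X_def lin_equiv_rel_def)
  have equiv: "equiv X R"
  proof (rule equivI)
    show "R \<subseteq> X \<times> X" by (rule RX)
    show "refl_on X R"
    proof (rule refl_onI)
      fix f assume f: "f \<in> X"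
      then obtain A where "A \<in> carrier_mat n n" "f = form_of_mat q A" using X_form by blast
      then show "(f, f) \<in> R" using f frob_congruent_refl[of A n q] q2 by (simp add: R_iff)
    qed
    show "sym R"
    proof (rule symI)
      fix f g assume fg: "(f, g) \<in> R"
      then obtain A B where "A \<in> carrier_mat n n" "f = form_of_mat q A" "B \<in> carrier_mat n n" "g = form_of_mat q B"
        using X_form RX by blast
      then show "(g, f) \<in> R" using fg frob_congruent_sym[OF char, of A n B] by (simp add: R_iff)
    qed
    show "trans R"
    proof (rule transI)
      fix f g h assume fgh: "(f, g) \<in> R" "(g, h) \<in> R"
      then have "f \<in> X" "g \<in> X" "h \<in> X" using RX by blast+
      then obtain A B C where "A \<in> carrier_mat n n" "f = form_of_mat q A"
        "B \<in> carrier_mat n n" "g = form_of_mat q B" "C \<in> carrier_mat n n" "h = form_of_mat q C"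
        using X_form by meson
      then show "(f, h) \<in> R" using fgh frob_congruent_trans[OF char, of A n B C] by (simp add: R_iff)
    qed
  qed
  have D: "D ss \<in> carrier_mat n n" if "mset ss \<in> number_partitions n" for ss
    using diag_J_blocks_carrier[of ss, where ?'a = 'a] that
    by (simp add: D_def number_partitions_def sum_mset_sum_list)
  have D_nd: "nondegenerate n (form_of_mat q (D ss))" if "mset ss \<in> number_partitions n" for ss
    unfolding nondegenerate_form_of_mat_iff[OF char assms(3) D[OF that]]
  proof (intro ballI impI allI)
    have "partial_permutation_mat (D ss)" unfolding D_def by (rule partial_permutation_mat_diag_J_blocks)
    then show "\<exists>j<n. frob_cong q M (D ss) $$ (i, j) \<noteq> 0 \<or> frob_cong q M (D ss) $$ (j, i) \<noteq> 0"
      if "M \<in> carrier_mat n n" "invertible_mat M" "i < n" for M i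
      using frob_cong_partial_permutation_nonzero[OF char D[OF \<open>mset ss \<in> number_partitions n\<close>]] that by blast
  qed
  have DX: "form_of_mat q (D ss) \<in> X" if "mset ss \<in> number_partitions n" for ss
    unfolding X_def nondeg_frobenius_forms_def
    using D_nd[OF that] frobenius_form_form_of_mat[OF q2 D[OF that]] by blast
  have unique: "mset ss = mset ts"
    if "mset ss \<in> number_partitions n" "mset ts \<in> number_partitions n" "frob_congruent q n (D ss) (D ts)" for ss ts
    using frob_congruent_diag_J_blocks_unique[OF char that(1,2)] that(3) by (simp add: D_def)
  have normal: "\<exists>P\<in>number_partitions n. \<forall>ss. mset ss = P \<longrightarrow> frob_congruent q n A (D ss)"
    if "A \<in> carrier_mat n n" "nondegenerate n (form_of_mat q A)" for A
    using frob_congruent_diag_J_blocks[OF char assms(3) that] by (simp add: D_def)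
  \<comment> \<open>Normal forms come in all orders of their blocks, so by uniqueness reordering does not matter.\<close>
  have order: "frob_congruent q n (D ss) (D ts)" if ss: "mset ss \<in> number_partitions n" and "mset ts = mset ss" for ss ts
  proof -
    obtain P where P: "P \<in> number_partitions n" "\<And>us. mset us = P \<Longrightarrow> frob_congruent q n (D ss) (D us)"
      using normal[OF D[OF ss] D_nd[OF ss]] by blast
    obtain us where us: "mset us = P" using ex_mset by blast
    have "mset ss = P" using unique[OF ss, of us] P us by blast
    then show ?thesis using P(2) that(2) by simp
  qed
  \<comment> \<open>A multiset does not order its blocks, so some order is chosen; by
    \<open>order\<close> the class does not depend on it.\<close>
  define \<Phi> where "\<Phi> P = R `` {form_of_mat q (D (SOME ss. mset ss = P))}" for P
  have \<Phi>: "\<Phi> (mset ss) = R `` {form_of_mat q (D ss)}" if ss: "mset ss \<in> number_partitions n" for ss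
  proof -
    define ts where "ts = (SOME ts. mset ts = mset ss)"
    have ts: "mset ts = mset ss" unfolding ts_def by (rule someI) simp
    then have tsP: "mset ts \<in> number_partitions n" using ss by simp
    have "(form_of_mat q (D ts), form_of_mat q (D ss)) \<in> R"
      by (rule R_iff[OF D[OF tsP] D[OF ss], THEN iffD2])
        (intro conjI DX[OF tsP] DX[OF ss] order[OF tsP ts[symmetric]])
    then show ?thesis unfolding \<Phi>_def ts_def[symmetric] by (rule equiv_class_eq[OF equiv])
  qed
  have "bij_betw \<Phi> (number_partitions n) (X // R)"
    unfolding bij_betw_def
  proof (intro conjI inj_onI equalityI subsetI)
    fix P Q assume P: "P \<in> number_partitions n" and Q: "Q \<in> number_partitions n" and eq: "\<Phi> P = \<Phi> Q"
    obtain ss where ss: "mset ss = P" using ex_mset by blast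
    obtain ts where ts: "mset ts = Q" using ex_mset by blast
    have ssP: "mset ss \<in> number_partitions n" and tsP: "mset ts \<in> number_partitions n"
      using P Q ss ts by simp_all
    have "R `` {form_of_mat q (D ss)} = R `` {form_of_mat q (D ts)}"
      unfolding \<Phi>[OF ssP, symmetric] \<Phi>[OF tsP, symmetric] ss ts by (rule eq)
    then have "(form_of_mat q (D ss), form_of_mat q (D ts)) \<in> R"
      by (rule eq_equiv_class_iff[OF equiv DX[OF ssP] DX[OF tsP], THEN iffD1])
    then have "frob_congruent q n (D ss) (D ts)" using R_iff[OF D[OF ssP] D[OF tsP]] by blast
    then show "P = Q" using unique[OF ssP tsP] ss ts by simp
  next
    fix c assume "c \<in> \<Phi> ` number_partitions n"
    then obtain P where P: "P \<in> number_partitions n" "c = \<Phi> P" by blast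
    obtain ss where ss: "mset ss = P" using ex_mset by blast
    then have ssP: "mset ss \<in> number_partitions n" using P(1) by simp
    show "c \<in> X // R" unfolding P(2) ss[symmetric] \<Phi>[OF ssP] by (rule quotientI[OF DX[OF ssP]])
  next
    fix c assume "c \<in> X // R"
    then obtain f where f: "f \<in> X" "c = R `` {f}" by (rule quotientE)
    then obtain A where A: "A \<in> carrier_mat n n" "f = form_of_mat q A" "nondegenerate n (form_of_mat q A)"
      using X_form by blast
    then obtain P where P: "P \<in> number_partitions n" "\<And>ss. mset ss = P \<Longrightarrow> frob_congruent q n A (D ss)"
      using normal by blast
    obtain ss where ss: "mset ss = P" using ex_mset by blast
    then have ssP: "mset ss \<in> number_partitions n" using P(1) by simp
    have "(f, form_of_mat q (D ss)) \<in> R"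
      unfolding A(2) using R_iff[OF A(1) D[OF ssP]] f(1) A(2) DX[OF ssP] P(2)[OF ss] by simp
    then have "c = \<Phi> P" unfolding f(2) ss[symmetric] \<Phi>[OF ssP] by (rule equiv_class_eq[OF equiv])
    then show "c \<in> \<Phi> ` number_partitions n" using P(1) by blast
  qed
  then show ?thesis using \<Phi> unfolding X_def R_def D_def by blast
qed

end
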